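(* Let $k$ be a commutative ring, $G$ a group, $\mathcal{C}$ a free $G$-category over $k$, $\mathcal{B}=\mathcal{C}/G$ the quotient category, and $F:\mathcal{C}\to\mathcal{B}$ the corresponding Galois covering (the projection functor). Then $\mathcal{B}\text{-}\mathsf{Mod}$ and $(\mathcal{C}\text{-}\mathsf{Mod})^G$ are isomorphic categories.
   Context: Category over $k$: a small category $\mathcal{C}$ with object set $\mathcal{C}_0$ such that each morphism set ${}_y\mathcal{C}_x$ (morphisms from $x$ to $y$) is a $k$-module and composition is $k$-bilinear. $G$-category over $k$: a category $\mathcal{C}$ over $k$ with an action of $G$ on the set $\mathcal{C}_0$ and $k$-module maps $s:{}_y\mathcal{C}_x\to{}_{sy}\mathcal{C}_{sx}$ such that $s(gf)=(sg)(sf)$ for composable $g,f$, $(ts)f=t(sf)$ and $1f=f$. It is free if the action on $\mathcal{C}_0$ is free. Quotient category $\mathcal{C}/G$ (for $\mathcal{C}$ a free $G$-category): objects are the $G$-orbits of $\mathcal{C}_0$, and ${}_\beta(\mathcal{C}/G)_\alpha=\left(\bigoplus_{x\in\alpha,\,y\in\beta}{}_y\mathcal{C}_x\right)/G$, where for a $kG$-module $X$ one sets $X/G=X/(\ker\epsilon)X$ with $\epsilon:kG\to k$ the augmentation map. Composition: if $f\in{}_y\mathcal{C}_x$, $g\in{}_z\mathcal{C}_{y'}$ with $y,y'$ in the same orbit and $s$ is the unique element of $G$ with $sy=y'$, then $[g][f]=[g\circ(sf)]$. A Galois covering is the projection functor $\mathcal{C}\to\mathcal{C}/G$. A left $\mathcal{C}$-module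 $\mathcal{M}$ is a $k$-linear covariant functor from $\mathcal{C}$ to $k$-modules: a collection of $k$-modules $\{{}_x\mathcal{M}\}_{x\in\mathcal{C}_0}$ with $k$-module maps ${}_y\mathcal{C}_x\otimes_k{}_x\mathcal{M}\to{}_y\mathcal{M}$ satisfying associativity and unit axioms. $\mathcal{C}\text{-}\mathsf{Mod}$ is the category of left $\mathcal{C}$-modules, with natural transformations as morphisms. $G$ acts on $\mathcal{C}\text{-}\mathsf{Mod}$: for a $\mathcal{C}$-module $\mathcal{M}$ and $s\in G$, ${}^s\mathcal{M}$ is given by ${}_x({}^s\mathcal{M})={}_{s^{-1}x}\mathcal{M}$, where $c\in{}_y\mathcal{C}_x$ acts on $m\in{}_{s^{-1}x}\mathcal{M}$ by $(s^{-1}c)m\in{}_{s^{-1}y}\mathcal{M}={}_y({}^s\mathcal{M})$. $(\mathcal{C}\text{-}\mathsf{Mod})^G$ is the full subcategory of $\mathcal{C}\text{-}\mathsf{Mod}$ whose objects are the modules fixed under the action of $G$, namely the modules $\mathcal{M}$ such that ${}^s\mathcal{M}=\mathcal{M}$ for all $s\in G$.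
   Formalization: The category of fixed modules is taken with only the G-fixed natural transformations as morphisms, instead of as a full subcategory; with the full subcategory the claim is false (k a field, objects G ≠ 1, only scalar multiples of identities as morphisms). *)

theory Defs
  imports "HOL-Algebra.Algebra"
begin

subsection \<open>Modules over a commutative ring\<close>

text \<open>
  The record \<^type>\<open>module\<close> extends \<^type>\<open>ring\<close>, so a module carries two fields (the ring
  multiplication and the ring unit) that play no role. The constructions below set them to
  \<^const>\<open>undefined\<close>.
\<close>

definition direct_sum :: "'i set \<Rightarrow> ('i \<Rightarrow> ('k, 'm) module) \<Rightarrow> ('k, 'i \<Rightarrow> 'm) module" where
  "direct_sum I M =
     (let S = sum_group I (\<lambda>i. add_monoid (M i)) in
      \<lparr>carrier = carrier S, monoid.mult = undefined, monoid.one = undefined,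
       ring.zero = monoid.one S, ring.add = monoid.mult S,
       smult = (\<lambda>a u. \<lambda>i\<in>I. a \<odot>\<^bsub>M i\<^esub> u i)\<rparr>)"

definition single :: "'i set \<Rightarrow> ('i \<Rightarrow> ('k, 'm) module) \<Rightarrow> 'i \<Rightarrow> 'm \<Rightarrow> 'i \<Rightarrow> 'm" where
  "single I M i m = (\<lambda>j\<in>I. if j = i then m else \<zero>\<^bsub>M j\<^esub>)"

definition quotient_module :: "('k, 'm) module \<Rightarrow> 'm set \<Rightarrow> ('k, 'm set) module" where
  "quotient_module M N =
     \<lparr>carrier = carrier (M A_Mod N), monoid.mult = undefined, monoid.one = undefined,
      ring.zero = monoid.one (M A_Mod N), ring.add = monoid.mult (M A_Mod N),
      smult = (\<lambda>a A. \<Union>m\<in>A. N +>\<^bsub>M\<^esub> (a \<odot>\<^bsub>M\<^esub> m))\<rparr>"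

definition module_hom ::
  "('k, 'r) ring_scheme \<Rightarrow> ('k, 'm) module \<Rightarrow> ('k, 'n) module \<Rightarrow> ('m \<Rightarrow> 'n) set" where
  "module_hom k M N =
     {h \<in> carrier M \<rightarrow> carrier N.
        (\<forall>m\<in>carrier M. \<forall>m'\<in>carrier M. h (m \<oplus>\<^bsub>M\<^esub> m') = h m \<oplus>\<^bsub>N\<^esub> h m') \<and>
        (\<forall>a\<in>carrier k. \<forall>m\<in>carrier M. h (a \<odot>\<^bsub>M\<^esub> m) = a \<odot>\<^bsub>N\<^esub> h m)}"

text \<open>
  A \<open>k\<close>-module whose record has no information outside its carrier: two such records are equal
  iff they have the same underlying set, addition, zero and scalar multiplication. This makes the
  equality of modules, which the notion of a module fixed by \<open>G\<close> relies on, the equality of records.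
\<close>

definition strict_module :: "('k, 'r) ring_scheme \<Rightarrow> ('k, 'm) module \<Rightarrow> bool" where
  "strict_module k M \<longleftrightarrow>
     module k M \<and> monoid.mult M = undefined \<and> monoid.one M = undefined \<and>
     (\<forall>m m'. \<not> (m \<in> carrier M \<and> m' \<in> carrier M) \<longrightarrow> m \<oplus>\<^bsub>M\<^esub> m' = undefined) \<and>
     (\<forall>a m. \<not> (a \<in> carrier k \<and> m \<in> carrier M) \<longrightarrow> a \<odot>\<^bsub>M\<^esub> m = undefined)"


subsection \<open>Coinvariants\<close>

definition group_algebra_carrier ::
  "('k, 'r) ring_scheme \<Rightarrow> ('g, 'h) monoid_scheme \<Rightarrow> ('g \<Rightarrow> 'k) set" where
  "group_algebra_carrier k G =
     {a \<in> carrier G \<rightarrow>\<^sub>E carrier k. finite {s \<in> carrier G. a s \<noteq> \<zero>\<^bsub>k\<^esub>}}"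

definition augmentation ::
  "('k, 'r) ring_scheme \<Rightarrow> ('g, 'h) monoid_scheme \<Rightarrow> ('g \<Rightarrow> 'k) \<Rightarrow> 'k" where
  "augmentation k G a = (\<Oplus>\<^bsub>k\<^esub>s\<in>{s \<in> carrier G. a s \<noteq> \<zero>\<^bsub>k\<^esub>}. a s)"

definition augmentation_kernel ::
  "('k, 'r) ring_scheme \<Rightarrow> ('g, 'h) monoid_scheme \<Rightarrow> ('g \<Rightarrow> 'k) set" where
  "augmentation_kernel k G = {a \<in> group_algebra_carrier k G. augmentation k G a = \<zero>\<^bsub>k\<^esub>}"

text \<open>A \<open>kG\<close>-module is a \<open>k\<close>-module \<open>V\<close> with a \<open>k\<close>-linear action \<open>\<rho>\<close> of \<open>G\<close>.\<close>

definition group_algebra_act ::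
  "('k, 'r) ring_scheme \<Rightarrow> ('g, 'h) monoid_scheme \<Rightarrow> ('k, 'm) module \<Rightarrow> ('g \<Rightarrow> 'm \<Rightarrow> 'm) \<Rightarrow>
     ('g \<Rightarrow> 'k) \<Rightarrow> 'm \<Rightarrow> 'm" where
  "group_algebra_act k G V \<rho> a m =
     (\<Oplus>\<^bsub>V\<^esub>s\<in>{s \<in> carrier G. a s \<noteq> \<zero>\<^bsub>k\<^esub>}. a s \<odot>\<^bsub>V\<^esub> \<rho> s m)"

text \<open>The submodule \<open>(ker \<epsilon>)V\<close>, consisting of the finite sums of products \<open>a m\<close> with \<open>a \<in> ker \<epsilon>\<close>.\<close>

definition augmentation_submodule ::
  "('k, 'r) ring_scheme \<Rightarrow> ('g, 'h) monoid_scheme \<Rightarrow> ('k, 'm) module \<Rightarrow> ('g \<Rightarrow> 'm \<Rightarrow> 'm) \<Rightarrow>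
     'm set" where
  "augmentation_submodule k G V \<rho> =
     generate (add_monoid V)
       {group_algebra_act k G V \<rho> a m |a m. a \<in> augmentation_kernel k G \<and> m \<in> carrier V}"

definition coinvariants ::
  "('k, 'r) ring_scheme \<Rightarrow> ('g, 'h) monoid_scheme \<Rightarrow> ('k, 'm) module \<Rightarrow> ('g \<Rightarrow> 'm \<Rightarrow> 'm) \<Rightarrow>
     ('k, 'm set) module" where
  "coinvariants k G V \<rho> = quotient_module V (augmentation_submodule k G V \<rho>)"


subsection \<open>Categories over a commutative ring\<close>

text \<open>
  \<open>Mor C y x\<close> is the module of morphisms from \<open>x\<close> to \<open>y\<close>, and \<open>Cmp C z y x g f\<close> is the composite
  of \<open>f\<close> from \<open>x\<close> to \<open>y\<close> and \<open>g\<close> from \<open>y\<close> to \<open>z\<close>: targets come first throughout.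
\<close>

record ('o, 'a, 'k) k_category =
  Ob :: "'o set"
  Mor :: "'o \<Rightarrow> 'o \<Rightarrow> ('k, 'a) module"
  Cmp :: "'o \<Rightarrow> 'o \<Rightarrow> 'o \<Rightarrow> 'a \<Rightarrow> 'a \<Rightarrow> 'a"
  Idn :: "'o \<Rightarrow> 'a"

locale category_over = cring k
  for k :: "('k, 'r) ring_scheme" and C :: "('o, 'a, 'k, 'c) k_category_scheme" +
  assumes Mor_module: "\<lbrakk>x \<in> Ob C; y \<in> Ob C\<rbrakk> \<Longrightarrow> module k (Mor C y x)"
    and Idn_closed: "x \<in> Ob C \<Longrightarrow> Idn C x \<in> carrier (Mor C x x)"
    and Cmp_linear_left:
      "\<lbrakk>x \<in> Ob C; y \<in> Ob C; z \<in> Ob C; f \<in> carrier (Mor C y x)\<rbrakk> \<Longrightarrow>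
         (\<lambda>g. Cmp C z y x g f) \<in> module_hom k (Mor C z y) (Mor C z x)"
    and Cmp_linear_right:
      "\<lbrakk>x \<in> Ob C; y \<in> Ob C; z \<in> Ob C; g \<in> carrier (Mor C z y)\<rbrakk> \<Longrightarrow>
         Cmp C z y x g \<in> module_hom k (Mor C y x) (Mor C z x)"
    and Cmp_assoc:
      "\<lbrakk>w \<in> Ob C; x \<in> Ob C; y \<in> Ob C; z \<in> Ob C;
        f \<in> carrier (Mor C x w); g \<in> carrier (Mor C y x); h \<in> carrier (Mor C z y)\<rbrakk> \<Longrightarrow>
         Cmp C z x w (Cmp C z y x h g) f = Cmp C z y w h (Cmp C y x w g f)"
    and Cmp_Idn_left:
      "\<lbrakk>x \<in> Ob C; y \<in> Ob C; f \<in> carrier (Mor C y x)\<rbrakk> \<Longrightarrow> Cmp C y y x (Idn C y) f = f"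
    and Cmp_Idn_right:
      "\<lbrakk>x \<in> Ob C; y \<in> Ob C; f \<in> carrier (Mor C y x)\<rbrakk> \<Longrightarrow> Cmp C y x x f (Idn C x) = f"

text \<open>\<open>m_act C s y x\<close> is the action of \<open>s\<close> on the morphisms from \<open>x\<close> to \<open>y\<close>.\<close>

record ('o, 'a, 'k, 'g) g_category = "('o, 'a, 'k) k_category" +
  o_act :: "'g \<Rightarrow> 'o \<Rightarrow> 'o"
  m_act :: "'g \<Rightarrow> 'o \<Rightarrow> 'o \<Rightarrow> 'a \<Rightarrow> 'a"

locale G_category_over =
  category_over k C + group G + group_action G "Ob C" "o_act C"
  for k :: "('k, 'r) ring_scheme" and G :: "('g, 'h) monoid_scheme"
    and C :: "('o, 'a, 'k, 'g, 'c) g_category_scheme" +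
  assumes m_act_linear:
      "\<lbrakk>s \<in> carrier G; x \<in> Ob C; y \<in> Ob C\<rbrakk> \<Longrightarrow>
         m_act C s y x \<in> module_hom k (Mor C y x) (Mor C (o_act C s y) (o_act C s x))"
    and m_act_Cmp:
      "\<lbrakk>s \<in> carrier G; x \<in> Ob C; y \<in> Ob C; z \<in> Ob C;
        f \<in> carrier (Mor C y x); g \<in> carrier (Mor C z y)\<rbrakk> \<Longrightarrow>
         m_act C s z x (Cmp C z y x g f) =
           Cmp C (o_act C s z) (o_act C s y) (o_act C s x) (m_act C s z y g) (m_act C s y x f)"
    and m_act_mult:
      "\<lbrakk>s \<in> carrier G; t \<in> carrier G; x \<in> Ob C; y \<in> Ob C; f \<in> carrier (Mor C y x)\<rbrakk> \<Longrightarrow>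
         m_act C (t \<otimes>\<^bsub>G\<^esub> s) y x f = m_act C t (o_act C s y) (o_act C s x) (m_act C s y x f)"
    and m_act_one:
      "\<lbrakk>x \<in> Ob C; y \<in> Ob C; f \<in> carrier (Mor C y x)\<rbrakk> \<Longrightarrow> m_act C \<one>\<^bsub>G\<^esub> y x f = f"

locale free_G_category_over = G_category_over +
  assumes free: "x \<in> Ob C \<Longrightarrow> stabilizer G (o_act C) x = {\<one>\<^bsub>G\<^esub>}"


subsection \<open>The quotient category and the Galois covering\<close>

text \<open>
  The direct sum of all \<open>Mor C y x\<close> with \<open>x \<in> \<alpha>\<close> and \<open>y \<in> \<beta>\<close>, where \<open>Mor C y x\<close> is the summand
  of index \<open>(y, x)\<close>; the action of \<open>s\<close> maps the summand \<open>(y, x)\<close> to the summand \<open>(s y, s x)\<close>.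
\<close>

definition orbit_sum ::
  "('o, 'a, 'k, 'c) k_category_scheme \<Rightarrow> 'o set \<Rightarrow> 'o set \<Rightarrow> ('k, 'o \<times> 'o \<Rightarrow> 'a) module" where
  "orbit_sum C \<beta> \<alpha> = direct_sum (\<beta> \<times> \<alpha>) (\<lambda>(y, x). Mor C y x)"

definition orbit_single ::
  "('o, 'a, 'k, 'c) k_category_scheme \<Rightarrow> 'o set \<Rightarrow> 'o set \<Rightarrow> 'o \<Rightarrow> 'o \<Rightarrow> 'a \<Rightarrow> 'o \<times> 'o \<Rightarrow> 'a" where
  "orbit_single C \<beta> \<alpha> y x f = single (\<beta> \<times> \<alpha>) (\<lambda>(y, x). Mor C y x) (y, x) f"

definition orbit_sum_act ::
  "('g, 'h) monoid_scheme \<Rightarrow> ('o, 'a, 'k, 'g, 'c) g_category_scheme \<Rightarrow> 'o set \<Rightarrow> 'o set \<Rightarrow>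
     'g \<Rightarrow> ('o \<times> 'o \<Rightarrow> 'a) \<Rightarrow> 'o \<times> 'o \<Rightarrow> 'a" where
  "orbit_sum_act G C \<beta> \<alpha> s u =
     (\<lambda>(y, x)\<in>\<beta> \<times> \<alpha>.
        let y' = o_act C (inv\<^bsub>G\<^esub> s) y; x' = o_act C (inv\<^bsub>G\<^esub> s) x
        in m_act C s y' x' (u (y', x')))"

definition quotient_Mor ::
  "('k, 'r) ring_scheme \<Rightarrow> ('g, 'h) monoid_scheme \<Rightarrow> ('o, 'a, 'k, 'g, 'c) g_category_scheme \<Rightarrow>
     'o set \<Rightarrow> 'o set \<Rightarrow> ('k, ('o \<times> 'o \<Rightarrow> 'a) set) module" where
  "quotient_Mor k G C \<beta> \<alpha> = coinvariants k G (orbit_sum C \<beta> \<alpha>) (orbit_sum_act G C \<beta> \<alpha>)"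

definition orbit_class ::
  "('k, 'r) ring_scheme \<Rightarrow> ('g, 'h) monoid_scheme \<Rightarrow> ('o, 'a, 'k, 'g, 'c) g_category_scheme \<Rightarrow>
     'o set \<Rightarrow> 'o set \<Rightarrow> ('o \<times> 'o \<Rightarrow> 'a) \<Rightarrow> ('o \<times> 'o \<Rightarrow> 'a) set" where
  "orbit_class k G C \<beta> \<alpha> u =
     augmentation_submodule k G (orbit_sum C \<beta> \<alpha>) (orbit_sum_act G C \<beta> \<alpha>)
       +>\<^bsub>orbit_sum C \<beta> \<alpha>\<^esub> u"

definition transporter ::
  "('g, 'h) monoid_scheme \<Rightarrow> ('o, 'a, 'k, 'g, 'c) g_category_scheme \<Rightarrow> 'o \<Rightarrow> 'o \<Rightarrow> 'g" where
  "transporter G C y y' = (THE s. s \<in> carrier G \<and> o_act C s y = y')"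

text \<open>
  The biadditive extension of \<open>(g, f) \<mapsto> g \<circ> (s f)\<close>, where \<open>f\<close> has target \<open>y\<close>, \<open>g\<close> has source
  \<open>y'\<close> and \<open>s y = y'\<close>, to elements \<open>v\<close> and \<open>u\<close> of the direct sums.
\<close>

definition orbit_sum_Cmp ::
  "('g, 'h) monoid_scheme \<Rightarrow> ('o, 'a, 'k, 'g, 'c) g_category_scheme \<Rightarrow>
     'o set \<Rightarrow> 'o set \<Rightarrow> 'o set \<Rightarrow> ('o \<times> 'o \<Rightarrow> 'a) \<Rightarrow> ('o \<times> 'o \<Rightarrow> 'a) \<Rightarrow> 'o \<times> 'o \<Rightarrow> 'a" where
  "orbit_sum_Cmp G C \<gamma> \<beta> \<alpha> v u =
     finsum (orbit_sum C \<gamma> \<alpha>)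
       (\<lambda>((z, y'), (y, x)).
          let s = transporter G C y y'; x' = o_act C s x
          in orbit_single C \<gamma> \<alpha> z x' (Cmp C z y' x' (v (z, y')) (m_act C s y x (u (y, x)))))
       ({(z, y'). z \<in> \<gamma> \<and> y' \<in> \<beta> \<and> v (z, y') \<noteq> \<zero>\<^bsub>Mor C z y'\<^esub>} \<times>
        {(y, x). y \<in> \<beta> \<and> x \<in> \<alpha> \<and> u (y, x) \<noteq> \<zero>\<^bsub>Mor C y x\<^esub>})"

text \<open>
  Composites and identities do not depend on the chosen representatives, so the unions below are
  unions of copies of a single class (as in the multiplication of cosets in a factor ring).
\<close>

definition quotient_category ::
  "('k, 'r) ring_scheme \<Rightarrow> ('g, 'h) monoid_scheme \<Rightarrow> ('o, 'a, 'k, 'g, 'c) g_category_scheme \<Rightarrow>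
     ('o set, ('o \<times> 'o \<Rightarrow> 'a) set, 'k) k_category" where
  "quotient_category k G C =
     \<lparr>Ob = orbits G (Ob C) (o_act C),
      Mor = quotient_Mor k G C,
      Cmp = (\<lambda>\<gamma> \<beta> \<alpha> g f. \<Union>v\<in>g. \<Union>u\<in>f. orbit_class k G C \<gamma> \<alpha> (orbit_sum_Cmp G C \<gamma> \<beta> \<alpha> v u)),
      Idn = (\<lambda>\<alpha>. \<Union>x\<in>\<alpha>. orbit_class k G C \<alpha> \<alpha> (orbit_single C \<alpha> \<alpha> x x (Idn C x)))\<rparr>"

text \<open>\<open>on_mor F y x\<close> is the map of a functor \<open>F\<close> on the morphisms from \<open>x\<close> to \<open>y\<close>.\<close>

record ('o1, 'a1, 'o2, 'a2) functor_data =
  on_ob :: "'o1 \<Rightarrow> 'o2"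
  on_mor :: "'o1 \<Rightarrow> 'o1 \<Rightarrow> 'a1 \<Rightarrow> 'a2"

definition galois_covering ::
  "('k, 'r) ring_scheme \<Rightarrow> ('g, 'h) monoid_scheme \<Rightarrow> ('o, 'a, 'k, 'g, 'c) g_category_scheme \<Rightarrow>
     ('o, 'a, 'o set, ('o \<times> 'o \<Rightarrow> 'a) set) functor_data" where
  "galois_covering k G C =
     \<lparr>on_ob = orbit G (o_act C),
      on_mor = (\<lambda>y x f. let \<beta> = orbit G (o_act C) y; \<alpha> = orbit G (o_act C) x
                        in orbit_class k G C \<beta> \<alpha> (orbit_single C \<beta> \<alpha> y x f))\<rparr>"


subsection \<open>Categories and isomorphisms of categories\<close>

text \<open>
  \<open>arr A R Q\<close> is the set of morphisms from \<open>Q\<close> to \<open>R\<close>. Hom-sets are indexed by pairs of objects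
  and need not be disjoint, so composition takes the three objects involved as arguments.
\<close>

record ('o, 'a) cat =
  obj :: "'o set"
  arr :: "'o \<Rightarrow> 'o \<Rightarrow> 'a set"
  cmp :: "'o \<Rightarrow> 'o \<Rightarrow> 'o \<Rightarrow> 'a \<Rightarrow> 'a \<Rightarrow> 'a"
  idn :: "'o \<Rightarrow> 'a"

locale is_cat =
  fixes A :: "('o, 'a) cat"
  assumes idn_closed: "Q \<in> obj A \<Longrightarrow> idn A Q \<in> arr A Q Q"
    and cmp_closed:
      "\<lbrakk>Q \<in> obj A; R \<in> obj A; S \<in> obj A; f \<in> arr A R Q; g \<in> arr A S R\<rbrakk> \<Longrightarrow>
         cmp A S R Q g f \<in> arr A S Q"
    and cmp_assoc:
      "\<lbrakk>P \<in> obj A; Q \<in> obj A; R \<in> obj A; S \<in> obj A;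
        f \<in> arr A Q P; g \<in> arr A R Q; h \<in> arr A S R\<rbrakk> \<Longrightarrow>
         cmp A S Q P (cmp A S R Q h g) f = cmp A S R P h (cmp A R Q P g f)"
    and cmp_idn_left:
      "\<lbrakk>Q \<in> obj A; R \<in> obj A; f \<in> arr A R Q\<rbrakk> \<Longrightarrow> cmp A R R Q (idn A R) f = f"
    and cmp_idn_right:
      "\<lbrakk>Q \<in> obj A; R \<in> obj A; f \<in> arr A R Q\<rbrakk> \<Longrightarrow> cmp A R Q Q f (idn A Q) = f"

locale is_functor =
  fixes A :: "('o1, 'a1) cat" and B :: "('o2, 'a2) cat"
    and F :: "('o1, 'a1, 'o2, 'a2) functor_data"
  assumes on_ob_closed: "Q \<in> obj A \<Longrightarrow> on_ob F Q \<in> obj B"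
    and on_mor_closed:
      "\<lbrakk>Q \<in> obj A; R \<in> obj A; f \<in> arr A R Q\<rbrakk> \<Longrightarrow>
         on_mor F R Q f \<in> arr B (on_ob F R) (on_ob F Q)"
    and on_mor_idn: "Q \<in> obj A \<Longrightarrow> on_mor F Q Q (idn A Q) = idn B (on_ob F Q)"
    and on_mor_cmp:
      "\<lbrakk>Q \<in> obj A; R \<in> obj A; S \<in> obj A; f \<in> arr A R Q; g \<in> arr A S R\<rbrakk> \<Longrightarrow>
         on_mor F S Q (cmp A S R Q g f) =
           cmp B (on_ob F S) (on_ob F R) (on_ob F Q) (on_mor F S R g) (on_mor F R Q f)"

definition left_inverse_functor ::
  "('o1, 'a1) cat \<Rightarrow> ('o2, 'a2, 'o1, 'a1) functor_data \<Rightarrow> ('o1, 'a1, 'o2, 'a2) functor_data \<Rightarrow>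
     bool" where
  "left_inverse_functor A H F \<longleftrightarrow>
     (\<forall>Q\<in>obj A. on_ob H (on_ob F Q) = Q) \<and>
     (\<forall>Q\<in>obj A. \<forall>R\<in>obj A. \<forall>f\<in>arr A R Q.
        on_mor H (on_ob F R) (on_ob F Q) (on_mor F R Q f) = f)"

definition isomorphic_categories :: "('o1, 'a1) cat \<Rightarrow> ('o2, 'a2) cat \<Rightarrow> bool" where
  "isomorphic_categories A B \<longleftrightarrow>
     is_cat A \<and> is_cat B \<and>
     (\<exists>F H. is_functor A B F \<and> is_functor B A H \<and>
            left_inverse_functor A H F \<and> left_inverse_functor B F H)"


subsection \<open>Modules over a category\<close>

text \<open>\<open>act M y x c m\<close> is the result of applying \<open>c\<close> from \<open>x\<close> to \<open>y\<close> to the element \<open>m\<close> of \<open>space M x\<close>.\<close>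

record ('o, 'a, 'k, 'm) c_module =
  space :: "'o \<Rightarrow> ('k, 'm) module"
  act :: "'o \<Rightarrow> 'o \<Rightarrow> 'a \<Rightarrow> 'm \<Rightarrow> 'm"

text \<open>
  The last two assumptions fix the values outside the relevant domains, so that equal modules are
  equal records. They do not restrict the mathematical objects.
\<close>

locale left_module =
  fixes k :: "('k, 'r) ring_scheme" and C :: "('o, 'a, 'k, 'c) k_category_scheme"
    and M :: "('o, 'a, 'k, 'm) c_module"
  assumes space_module: "x \<in> Ob C \<Longrightarrow> strict_module k (space M x)"
    and act_linear_left:
      "\<lbrakk>x \<in> Ob C; y \<in> Ob C; m \<in> carrier (space M x)\<rbrakk> \<Longrightarrow>
         (\<lambda>c. act M y x c m) \<in> module_hom k (Mor C y x) (space M y)"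
    and act_linear_right:
      "\<lbrakk>x \<in> Ob C; y \<in> Ob C; c \<in> carrier (Mor C y x)\<rbrakk> \<Longrightarrow>
         act M y x c \<in> module_hom k (space M x) (space M y)"
    and act_Cmp:
      "\<lbrakk>x \<in> Ob C; y \<in> Ob C; z \<in> Ob C; f \<in> carrier (Mor C y x); g \<in> carrier (Mor C z y);
        m \<in> carrier (space M x)\<rbrakk> \<Longrightarrow>
         act M z x (Cmp C z y x g f) m = act M z y g (act M y x f m)"
    and act_Idn: "\<lbrakk>x \<in> Ob C; m \<in> carrier (space M x)\<rbrakk> \<Longrightarrow> act M x x (Idn C x) m = m"
    and space_extensional: "space M \<in> extensional (Ob C)"
    and act_extensional:
      "\<not> (x \<in> Ob C \<and> y \<in> Ob C \<and> c \<in> carrier (Mor C y x) \<and> m \<in> carrier (space M x)) \<Longrightarrow>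
         act M y x c m = undefined"

definition natural_transformations ::
  "('k, 'r) ring_scheme \<Rightarrow> ('o, 'a, 'k, 'c) k_category_scheme \<Rightarrow>
     ('o, 'a, 'k, 'm) c_module \<Rightarrow> ('o, 'a, 'k, 'm) c_module \<Rightarrow> ('o \<Rightarrow> 'm \<Rightarrow> 'm) set" where
  "natural_transformations k C N M =
     {\<phi> \<in> (\<Pi>\<^sub>E x\<in>Ob C. module_hom k (space M x) (space N x) \<inter> extensional (carrier (space M x))).
        \<forall>x\<in>Ob C. \<forall>y\<in>Ob C. \<forall>c\<in>carrier (Mor C y x). \<forall>m\<in>carrier (space M x).
          \<phi> y (act M y x c m) = act N y x c (\<phi> x m)}"

text \<open>
  The category of left modules, with the elements of the modules taken from the type \<open>'m\<close>; the
  type variable \<open>'m\<close> plays the role of the universe.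
\<close>

definition module_category ::
  "('k, 'r) ring_scheme \<Rightarrow> ('o, 'a, 'k, 'c) k_category_scheme \<Rightarrow>
     (('o, 'a, 'k, 'm) c_module, 'o \<Rightarrow> 'm \<Rightarrow> 'm) cat" where
  "module_category k C =
     \<lparr>obj = {M. left_module k C M},
      arr = natural_transformations k C,
      cmp = (\<lambda>P N M \<psi> \<phi>. \<lambda>x\<in>Ob C. compose (carrier (space M x)) (\<psi> x) (\<phi> x)),
      idn = (\<lambda>M. \<lambda>x\<in>Ob C. \<lambda>m\<in>carrier (space M x). m)\<rparr>"


subsection \<open>The action of the group on the category of modules\<close>

definition twist_module ::
  "('g, 'h) monoid_scheme \<Rightarrow> ('o, 'a, 'k, 'g, 'c) g_category_scheme \<Rightarrow> 'g \<Rightarrow>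
     ('o, 'a, 'k, 'm) c_module \<Rightarrow> ('o, 'a, 'k, 'm) c_module" where
  "twist_module G C s M =
     (let t = inv\<^bsub>G\<^esub> s in
      \<lparr>space = (\<lambda>x\<in>Ob C. space M (o_act C t x)),
       act = (\<lambda>y x c m.
         if x \<in> Ob C \<and> y \<in> Ob C \<and> c \<in> carrier (Mor C y x) \<and> m \<in> carrier (space M (o_act C t x))
         then act M (o_act C t y) (o_act C t x) (m_act C t y x c) m
         else undefined)\<rparr>)"

definition twist_transformation ::
  "('g, 'h) monoid_scheme \<Rightarrow> ('o, 'a, 'k, 'g, 'c) g_category_scheme \<Rightarrow> 'g \<Rightarrow>
     ('o \<Rightarrow> 'm \<Rightarrow> 'm) \<Rightarrow> 'o \<Rightarrow> 'm \<Rightarrow> 'm" where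
  "twist_transformation G C s \<phi> = (\<lambda>x\<in>Ob C. \<phi> (o_act C (inv\<^bsub>G\<^esub> s) x))"

text \<open>
  The fixed category of this action: the modules \<open>M\<close> with \<open>\<^sup>sM = M\<close> for all \<open>s\<close>, and between them the
  natural transformations \<open>\<phi>\<close> with \<open>\<^sup>s\<phi> = \<phi>\<close> for all \<open>s\<close>. The second condition is essential: the
  components at \<open>x\<close> and \<open>s x\<close> of a natural transformation between fixed modules are maps between
  the same two modules, but they need not be equal, and the full subcategory on the fixed modules
  is in general not isomorphic to the category of modules over the quotient category. For example,
  let \<open>k\<close> be a field and let \<open>C\<close> have object set \<open>G \<noteq> 1\<close> and only scalar multiples of identities as
  morphisms. The quotient category is \<open>k\<close>, and the \<open>k\<close>-module \<open>k\<close> has exactly two idempotent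
  endomorphisms, whereas in the full subcategory the endomorphism ring of a fixed module is a
  product of copies of \<open>End M\<close> indexed by \<open>G\<close>, with one or at least four idempotents.
\<close>

definition fixed_module_category ::
  "('k, 'r) ring_scheme \<Rightarrow> ('g, 'h) monoid_scheme \<Rightarrow> ('o, 'a, 'k, 'g, 'c) g_category_scheme \<Rightarrow>
     (('o, 'a, 'k, 'm) c_module, 'o \<Rightarrow> 'm \<Rightarrow> 'm) cat" where
  "fixed_module_category k G C =
     (module_category k C)
       \<lparr>obj := {M \<in> obj (module_category k C). \<forall>s\<in>carrier G. twist_module G C s M = M},
        arr := (\<lambda>N M. {\<phi> \<in> arr (module_category k C) N M.
                  \<forall>s\<in>carrier G. twist_transformation G C s \<phi> = \<phi>})\<rparr>"

end

theory Submission
  imports Defs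
begin

text \<open>
  Restriction along the covering \<open>F\<close> sends a \<open>\<B>\<close>-module \<open>M\<close> to the \<open>\<C>\<close>-module with value \<open>M (F x)\<close>
  at \<open>x\<close>, which is fixed by \<open>G\<close> because \<open>F (s x) = F x\<close> and \<open>F (s f) = F f\<close>. Conversely, a fixed
  module \<open>N\<close> takes the same value at all objects of an orbit \<open>\<alpha>\<close>, and a morphism of \<open>\<B>\<close> represented by
  \<open>u \<in> \<Oplus> \<^sub>y\<C>\<^sub>x\<close> acts on this value by the sum of the actions of the components of \<open>u\<close>. Since \<open>N\<close> is
  fixed, this sum does not change when a component \<open>f\<close> is replaced by \<open>s f\<close>, so it vanishes on
  \<open>(ker \<epsilon>)(\<Oplus> \<^sub>y\<C>\<^sub>x)\<close>, the additive subgroup generated by the differences \<open>s f - f\<close>. The two constructions are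
  inverse to each other on the nose. It is not necessary to know that \<open>\<B>\<close> is a category, only that
  its composition is well defined on classes.
\<close>

subsection \<open>Modules and additive maps\<close>

text \<open>Elements of the direct sums are finitely supported functions, morphisms of the quotient
  are cosets, and composites in the quotient are unions over all representatives. Direct computation
  with these is hopeless, so every identity is read as an equality of two additive maps on a direct
  sum and tested on elements supported in a single summand. Additivity is enough for passing to
  classes, because (ker epsilon)V is generated as an additive group; scalars are treated separately.
  Freeness enters through the uniqueness of the element t with t y = y'. It makes composition
  compatible with the action: if t carries s y to y', then t s carries y to y', and t (s f) = (t s)
  f. Descent needs no coherence data. That N is fixed is an equality of modules, so the modules at
  the points of an orbit are literally the same, and the actions of morphisms between different
  points of two orbits can be added. For natural transformations the invariance of the morphisms
  plays the same part: their components along an orbit are one and the same map, which is therefore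
  compatible with sums over several pairs of points.\<close>

lemma (in abelian_monoid) finsum_superset:
  assumes "finite A" "S \<subseteq> A" "f \<in> A \<rightarrow> carrier G" "\<And>i. i \<in> A - S \<Longrightarrow> f i = \<zero>"
  shows "finsum G f S = finsum G f A"
  using assms by (intro add.finprod_mono_neutral_cong_left) auto

lemma (in abelian_group) minus_zero_eq: "\<ominus> \<zero> = \<zero>"
  using r_neg[OF zero_closed] by simp

lemma (in abelian_group) minus_eq_zero_iff:
  assumes "x \<in> carrier G" "y \<in> carrier G" shows "x \<oplus> \<ominus> y = \<zero> \<longleftrightarrow> x = y"
  using assms add.inv_solve_right'[of "\<zero>" x y] by auto

lemma abelian_group_hom_intro:
  assumes "abelian_group V" "abelian_group W" "h \<in> carrier V \<rightarrow> carrier W"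
    and "\<And>x y. \<lbrakk>x \<in> carrier V; y \<in> carrier V\<rbrakk> \<Longrightarrow> h (x \<oplus>\<^bsub>V\<^esub> y) = h x \<oplus>\<^bsub>W\<^esub> h y"
  shows "abelian_group_hom V W h"
  using assms by (intro abelian_group_homI) (auto simp: hom_def abelian_group.a_group
      intro!: group_hom.intro group_hom_axioms.intro)

lemma module_hom_closed: "\<lbrakk>h \<in> module_hom k M N; m \<in> carrier M\<rbrakk> \<Longrightarrow> h m \<in> carrier N"
  by (auto simp: module_hom_def)

lemma module_hom_add:
  "\<lbrakk>h \<in> module_hom k M N; m \<in> carrier M; m' \<in> carrier M\<rbrakk> \<Longrightarrow> h (m \<oplus>\<^bsub>M\<^esub> m') = h m \<oplus>\<^bsub>N\<^esub> h m'"
  by (auto simp: module_hom_def)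

lemma module_hom_smult:
  "\<lbrakk>h \<in> module_hom k M N; a \<in> carrier k; m \<in> carrier M\<rbrakk> \<Longrightarrow> h (a \<odot>\<^bsub>M\<^esub> m) = a \<odot>\<^bsub>N\<^esub> h m"
  by (auto simp: module_hom_def)

lemma module_abelian_group: "module k M \<Longrightarrow> abelian_group M"
  by (simp add: module_def)

lemma module_add_closed: "\<lbrakk>module k M; x \<in> carrier M; y \<in> carrier M\<rbrakk> \<Longrightarrow> x \<oplus>\<^bsub>M\<^esub> y \<in> carrier M"
  by (rule abelian_groupE(1)[OF module_abelian_group])

lemma module_hom_comp:
  assumes "f \<in> module_hom k U V" "g \<in> module_hom k V W"
  shows "(\<lambda>x. g (f x)) \<in> module_hom k U W"
  using module_hom_closed[OF assms(1)] module_hom_closed[OF assms(2)] module_hom_add[OF assms(1)]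
    module_hom_add[OF assms(2)] module_hom_smult[OF assms(1)] module_hom_smult[OF assms(2)]
  unfolding module_hom_def[of k U W] by simp

text \<open>\<open>module_hom\<close> constrains a map only on the carrier. This transfers linearity
  to maps that are extended by \<open>undefined\<close> elsewhere, such as restricted identities,
  composites and the actions of the constructed modules.\<close>

lemma module_hom_cong:
  assumes "module k M" "h \<in> module_hom k M N" "\<And>m. m \<in> carrier M \<Longrightarrow> h' m = h m"
  shows "h' \<in> module_hom k M N"
  using module_hom_closed[OF assms(2)] module_hom_add[OF assms(2)] module_hom_smult[OF assms(2)]
  unfolding module_hom_def[of k M N]
  by (simp add: assms(3) module_add_closed[OF assms(1)] module.smult_closed[OF assms(1)])

lemma module_hom_abelian_group_hom:
  assumes "module k M" "module k N" "h \<in> module_hom k M N"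
  shows "abelian_group_hom M N h"
  using assms by (intro abelian_group_hom_intro) (auto simp: module_hom_def module_abelian_group)

lemma abelian_group_hom_comp:
  assumes "abelian_group_hom U V f" "abelian_group_hom V W g"
  shows "abelian_group_hom U W (\<lambda>x. g (f x))"
proof -
  interpret f: abelian_group_hom U V f by fact
  interpret g: abelian_group_hom V W g by fact
  show ?thesis
    by (intro abelian_group_hom_intro) (auto intro: f.G.abelian_group_axioms g.H.abelian_group_axioms)
qed

lemma abelian_group_hom_smult:
  assumes "module k V" "a \<in> carrier k"
  shows "abelian_group_hom V V (\<lambda>u. a \<odot>\<^bsub>V\<^esub> u)"
proof -
  interpret V: module k V by fact
  show ?thesis
    using assms(2) by (intro abelian_group_hom_intro V.M.abelian_group_axioms) (auto simp: V.smult_r_distr)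
qed

lemma abelian_group_hom_add:
  assumes "abelian_group_hom V W f" "abelian_group_hom V W g"
  shows "abelian_group_hom V W (\<lambda>u. f u \<oplus>\<^bsub>W\<^esub> g u)"
proof -
  interpret f: abelian_group_hom V W f by fact
  interpret g: abelian_group_hom V W g by fact
  show ?thesis
    by (intro abelian_group_hom_intro f.G.abelian_group_axioms f.H.abelian_group_axioms)
      (auto simp: f.H.a_ac)
qed

text \<open>This is the subgroup to which \<open>direct_sum_induct\<close> is applied when two
  additive maps on a direct sum are compared.\<close>

lemma additive_subgroup_equalizer:
  assumes "abelian_group_hom V W h" "abelian_group_hom V W h'"
  shows "additive_subgroup {u \<in> carrier V. h u = h' u} V"
proof -
  interpret h: abelian_group_hom V W h by fact
  interpret h': abelian_group_hom V W h' by fact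
  show ?thesis
    by (intro additive_subgroup.intro h.G.add.subgroupI)
      (auto simp flip: a_inv_def intro!: exI[of _ "\<zero>\<^bsub>V\<^esub>"])
qed

subsection \<open>Direct sums\<close>

locale module_family = cring k for k :: "('k, 'r) ring_scheme" +
  fixes I :: "'i set" and M :: "'i \<Rightarrow> ('k, 'm) module"
  assumes summand_module: "i \<in> I \<Longrightarrow> module k (M i)"
begin

lemma summand_abelian_group: "i \<in> I \<Longrightarrow> abelian_group (M i)"
  using summand_module by (simp add: module_def)

lemma direct_sum_add: "u \<oplus>\<^bsub>direct_sum I M\<^esub> v = (\<lambda>i\<in>I. u i \<oplus>\<^bsub>M i\<^esub> v i)"
  and direct_sum_zero: "\<zero>\<^bsub>direct_sum I M\<^esub> = (\<lambda>i\<in>I. \<zero>\<^bsub>M i\<^esub>)"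
  and direct_sum_smult: "a \<odot>\<^bsub>direct_sum I M\<^esub> u = (\<lambda>i\<in>I. a \<odot>\<^bsub>M i\<^esub> u i)"
  by (simp_all add: direct_sum_def Let_def)

lemma direct_sum_carrier:
  "carrier (direct_sum I M) =
     {u \<in> \<Pi>\<^sub>E i\<in>I. carrier (M i). finite {i \<in> I. u i \<noteq> \<zero>\<^bsub>M i\<^esub>}}"
  using summand_abelian_group by (simp add: direct_sum_def Let_def carrier_sum_group abelian_group.a_group)

lemma direct_sum_component: "\<lbrakk>u \<in> carrier (direct_sum I M); i \<in> I\<rbrakk> \<Longrightarrow> u i \<in> carrier (M i)"
  by (auto simp: direct_sum_carrier)

lemma direct_sum_support: "u \<in> carrier (direct_sum I M) \<Longrightarrow> finite {i \<in> I. u i \<noteq> \<zero>\<^bsub>M i\<^esub>}"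
  by (auto simp: direct_sum_carrier)

text \<open>The set \<open>A\<close> only has to contain the support, so the support of a new
  element never has to be computed exactly.\<close>

lemma direct_sum_carrierI:
  assumes "finite A" "A \<subseteq> I" "\<And>i. i \<in> I \<Longrightarrow> h i \<in> carrier (M i)"
    "\<And>i. i \<in> I - A \<Longrightarrow> h i = \<zero>\<^bsub>M i\<^esub>"
  shows "(\<lambda>i\<in>I. h i) \<in> carrier (direct_sum I M)"
proof -
  have "{i \<in> I. h i \<noteq> \<zero>\<^bsub>M i\<^esub>} \<subseteq> A" using assms by auto
  then have "finite {i \<in> I. h i \<noteq> \<zero>\<^bsub>M i\<^esub>}" using assms(1) finite_subset by blast
  then show ?thesis using assms by (auto simp: direct_sum_carrier cong: conj_cong)
qed

lemma direct_sum_smult_closed: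
  assumes "a \<in> carrier k" "u \<in> carrier (direct_sum I M)"
  shows "a \<odot>\<^bsub>direct_sum I M\<^esub> u \<in> carrier (direct_sum I M)"
  unfolding direct_sum_smult using assms
  by (intro direct_sum_carrierI[OF direct_sum_support[OF assms(2)]])
    (auto intro: module.smult_closed[OF summand_module] direct_sum_component simp: module.smult_r_null[OF summand_module])

text \<open>The carrier, addition and zero are those of \<open>sum_group\<close>, so all laws but
  one are inherited from that group. Commutativity is checked componentwise.\<close>

lemma direct_sum_abelian_group: "abelian_group (direct_sum I M)"
proof -
  let ?S = "sum_group I (\<lambda>i. add_monoid (M i))"
  have g: "group ?S" using summand_abelian_group by (intro sum_group) (auto intro: abelian_group.a_group)
  have eq: "carrier (direct_sum I M) = carrier ?S" "ring.add (direct_sum I M) = monoid.mult ?S"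
    "ring.zero (direct_sum I M) = monoid.one ?S"
    by (simp_all add: direct_sum_def Let_def)
  show ?thesis
  proof (rule abelian_groupI)
    fix x y assume "x \<in> carrier (direct_sum I M)" "y \<in> carrier (direct_sum I M)"
    then show "x \<oplus>\<^bsub>direct_sum I M\<^esub> y = y \<oplus>\<^bsub>direct_sum I M\<^esub> x"
      unfolding direct_sum_add
      by (intro restrict_ext) (auto intro!: abelian_groupE(4)[OF summand_abelian_group] direct_sum_component)
  qed (use g in \<open>auto simp only: eq group.is_monoid monoid.m_closed monoid.one_closed
        monoid.m_assoc monoid.l_one intro: group.l_inv_ex\<close>)
qed

lemma direct_sum_module: "module k (direct_sum I M)"
proof (rule moduleI[OF is_cring direct_sum_abelian_group direct_sum_smult_closed])
  show "\<one>\<^bsub>k\<^esub> \<odot>\<^bsub>direct_sum I M\<^esub> x = x" if "x \<in> carrier (direct_sum I M)" for x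
    using that unfolding direct_sum_smult
    by (intro extensionalityI[of _ I])
      (auto simp: direct_sum_carrier PiE_iff module.smult_one[OF summand_module])
qed (auto simp: direct_sum_add direct_sum_smult intro!: restrict_ext direct_sum_component
    module.smult_l_distr[OF summand_module] module.smult_r_distr[OF summand_module] module.smult_assoc1[OF summand_module])

lemma single_apply: "i \<in> I \<Longrightarrow> single I M i m i = m"
  by (simp add: single_def)

lemma single_closed:
  assumes "i \<in> I" "m \<in> carrier (M i)"
  shows "single I M i m \<in> carrier (direct_sum I M)"
  unfolding single_def using assms
  by (intro direct_sum_carrierI[of "{i}"]) (auto intro: abelian_groupE(2) summand_abelian_group)

lemma single_module_hom:
  assumes i: "i \<in> I"
  shows "single I M i \<in> module_hom k (M i) (direct_sum I M)"
proof -
  have "single I M i (m \<oplus>\<^bsub>M i\<^esub> m') = single I M i m \<oplus>\<^bsub>direct_sum I M\<^esub> single I M i m'" for m m'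
    unfolding direct_sum_add by (auto simp: single_def abelian_monoid.l_zero[OF
        abelian_group.axioms(1)[OF summand_abelian_group]] abelian_groupE(2)[OF summand_abelian_group] intro!: restrict_ext)
  moreover have "single I M i (a \<odot>\<^bsub>M i\<^esub> m) = a \<odot>\<^bsub>direct_sum I M\<^esub> single I M i m"
    if "a \<in> carrier k" for a m
    unfolding direct_sum_smult using that
    by (auto simp: single_def module.smult_r_null[OF summand_module] intro!: restrict_ext)
  ultimately show ?thesis
    using i single_closed by (auto simp: module_hom_def)
qed

text \<open>Induction on a finite set that contains the support: splitting off the component at one
  index leaves an element supported in the smaller set.\<close>

lemma direct_sum_induct:
  assumes K: "additive_subgroup K (direct_sum I M)"
    and single: "\<And>i m. \<lbrakk>i \<in> I; m \<in> carrier (M i)\<rbrakk> \<Longrightarrow> single I M i m \<in> K"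
    and u: "u \<in> carrier (direct_sum I M)"
  shows "u \<in> K"
proof -
  interpret K: additive_subgroup K "direct_sum I M" by fact
  \<comment> \<open>Inclusion of the support in \<open>A\<close> instead of equality: the step then
    works without knowing whether the component at the new index vanishes.\<close>
  have "\<forall>u\<in>carrier (direct_sum I M). {i \<in> I. u i \<noteq> \<zero>\<^bsub>M i\<^esub>} \<subseteq> A \<longrightarrow> u \<in> K"
    if "finite A" for A
    using that
  proof induction
    case empty
    have "u = \<zero>\<^bsub>direct_sum I M\<^esub>"
      if "u \<in> carrier (direct_sum I M)" "{i \<in> I. u i \<noteq> \<zero>\<^bsub>M i\<^esub>} \<subseteq> {}" for u
      using that by (intro extensionalityI[of _ I]) (auto simp: direct_sum_zero direct_sum_carrier PiE_iff)
    then show ?case using K.zero_closed by (intro ballI impI) (simp only:)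
  next
    case (insert j A)
    show ?case
    proof (intro ballI impI)
      fix u assume u: "u \<in> carrier (direct_sum I M)"
        and sub: "{i \<in> I. u i \<noteq> \<zero>\<^bsub>M i\<^esub>} \<subseteq> insert j A"
      show "u \<in> K"
      proof (cases "j \<in> I")
        case True
        define v where "v = (\<lambda>i\<in>I. if i = j then \<zero>\<^bsub>M i\<^esub> else u i)"
        have v: "v \<in> carrier (direct_sum I M)"
          unfolding v_def using u
          by (intro direct_sum_carrierI[OF direct_sum_support[OF u]])
            (auto intro: abelian_groupE(2) summand_abelian_group direct_sum_component)
        have "{i \<in> I. v i \<noteq> \<zero>\<^bsub>M i\<^esub>} \<subseteq> A" using sub by (auto simp: v_def)
        then have "v \<in> K" using insert.IH v by blast
        moreover have "single I M j (u j) \<in> K" using single True direct_sum_component[OF u] by auto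
        moreover have "u = single I M j (u j) \<oplus>\<^bsub>direct_sum I M\<^esub> v"
        proof (rule extensionalityI[of _ I])
          fix i assume i: "i \<in> I"
          interpret Mi: abelian_group "M i" using summand_abelian_group i .
          show "u i = (single I M j (u j) \<oplus>\<^bsub>direct_sum I M\<^esub> v) i"
            using i Mi.r_zero[OF direct_sum_component[OF u i]] Mi.l_zero[OF direct_sum_component[OF u i]]
            by (cases "i = j") (auto simp: direct_sum_add single_def v_def)
        qed (use u in \<open>auto simp: direct_sum_carrier direct_sum_add PiE_iff\<close>)
        ultimately show ?thesis using K.a_closed by metis
      next
        case False
        then show ?thesis using insert.IH u sub by auto
      qed
    qed
  qed
  from this[OF direct_sum_support[OF u]] u show ?thesis by blast
qed

text \<open>The uniqueness half of the universal property of the direct sum.\<close>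

lemma direct_sum_hom_eqI:
  assumes "abelian_group_hom (direct_sum I M) W h" "abelian_group_hom (direct_sum I M) W h'"
    and "\<And>i m. \<lbrakk>i \<in> I; m \<in> carrier (M i)\<rbrakk> \<Longrightarrow> h (single I M i m) = h' (single I M i m)"
    and "u \<in> carrier (direct_sum I M)"
  shows "h u = h' u"
  using direct_sum_induct[OF additive_subgroup_equalizer[OF assms(1,2)] _ assms(4)]
    assms(3) single_closed by blast

text \<open>Sums over the supports of different elements can only be compared after they have been
  extended to one index set. The added terms vanish because each \<open>h i\<close> is
  additive.\<close>

lemma finsum_support_eq:
  assumes W: "abelian_group W" and h: "\<And>i. i \<in> I \<Longrightarrow> abelian_group_hom (M i) W (h i)"
    and u: "u \<in> carrier (direct_sum I M)"
    and A: "finite A" "{i \<in> I. u i \<noteq> \<zero>\<^bsub>M i\<^esub>} \<subseteq> A" "A \<subseteq> I"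
  shows "(\<Oplus>\<^bsub>W\<^esub>i\<in>{i \<in> I. u i \<noteq> \<zero>\<^bsub>M i\<^esub>}. h i (u i)) = (\<Oplus>\<^bsub>W\<^esub>i\<in>A. h i (u i))"
proof -
  interpret W: abelian_group W by fact
  show ?thesis
  proof (rule W.finsum_superset)
    show "(\<lambda>i. h i (u i)) \<in> A \<rightarrow> carrier W"
      using A direct_sum_component[OF u] by (auto intro!: abelian_group_hom.hom_closed[OF h])
    show "h i (u i) = \<zero>\<^bsub>W\<^esub>" if "i \<in> A - {i \<in> I. u i \<noteq> \<zero>\<^bsub>M i\<^esub>}" for i
      using that A abelian_group_hom.hom_zero[OF h] by auto
  qed (use A in auto)
qed

text \<open>The existence half of the universal property. Additivity is not visible from the
  formula, since cancellation can make the support of a sum smaller than the union of the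
  supports.\<close>

lemma direct_sum_universal:
  assumes W: "abelian_group W" and h: "\<And>i. i \<in> I \<Longrightarrow> abelian_group_hom (M i) W (h i)"
  shows "abelian_group_hom (direct_sum I M) W
           (\<lambda>u. \<Oplus>\<^bsub>W\<^esub>i\<in>{i \<in> I. u i \<noteq> \<zero>\<^bsub>M i\<^esub>}. h i (u i))" (is "abelian_group_hom _ _ ?H")
    and "\<lbrakk>i \<in> I; m \<in> carrier (M i)\<rbrakk> \<Longrightarrow>
           (\<Oplus>\<^bsub>W\<^esub>j\<in>{j \<in> I. single I M i m j \<noteq> \<zero>\<^bsub>M j\<^esub>}. h j (single I M i m j)) = h i m"
proof -
  interpret W: abelian_group W by fact
  interpret V: abelian_group "direct_sum I M" by (rule direct_sum_abelian_group)
  let ?S = "\<lambda>u. {i \<in> I. u i \<noteq> \<zero>\<^bsub>M i\<^esub>}"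
  have hc: "h i (u i) \<in> carrier W" if "u \<in> carrier (direct_sum I M)" "i \<in> I" for u i
    using that direct_sum_component by (auto intro!: abelian_group_hom.hom_closed[OF h])
  show "abelian_group_hom (direct_sum I M) W ?H"
  proof (rule abelian_group_hom_intro[OF direct_sum_abelian_group W])
    show "?H \<in> carrier (direct_sum I M) \<rightarrow> carrier W"
      using hc by (auto intro!: W.finsum_closed)
  next
    fix u v assume u: "u \<in> carrier (direct_sum I M)" and v: "v \<in> carrier (direct_sum I M)"
    let ?w = "u \<oplus>\<^bsub>direct_sum I M\<^esub> v"
    have w: "?w \<in> carrier (direct_sum I M)" using u v by simp
    let ?A = "?S u \<union> ?S v \<union> ?S ?w"
    have A: "finite ?A" using u v w direct_sum_support by simp
    have "?H ?w = (\<Oplus>\<^bsub>W\<^esub>i\<in>?A. h i (?w i))" by (rule finsum_support_eq[OF W h w A]) auto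
    also have "\<dots> = (\<Oplus>\<^bsub>W\<^esub>i\<in>?A. h i (u i) \<oplus>\<^bsub>W\<^esub> h i (v i))"
      using hc[OF u] hc[OF v] direct_sum_component[OF u] direct_sum_component[OF v]
      by (intro W.add.finprod_cong') (auto simp: direct_sum_add abelian_group_hom.hom_add[OF h])
    also have "\<dots> = (\<Oplus>\<^bsub>W\<^esub>i\<in>?A. h i (u i)) \<oplus>\<^bsub>W\<^esub> (\<Oplus>\<^bsub>W\<^esub>i\<in>?A. h i (v i))"
      using hc[OF u] hc[OF v] by (intro W.finsum_addf) auto
    also have "(\<Oplus>\<^bsub>W\<^esub>i\<in>?A. h i (u i)) = ?H u" by (rule finsum_support_eq[OF W h u A, symmetric]) auto
    also have "(\<Oplus>\<^bsub>W\<^esub>i\<in>?A. h i (v i)) = ?H v" by (rule finsum_support_eq[OF W h v A, symmetric]) auto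
    finally show "?H ?w = ?H u \<oplus>\<^bsub>W\<^esub> ?H v" .
  qed
  assume i: "i \<in> I" and m: "m \<in> carrier (M i)"
  have "?H (single I M i m) = (\<Oplus>\<^bsub>W\<^esub>j\<in>{i}. h j (single I M i m j))"
    using i m by (intro finsum_support_eq[OF W h single_closed]) (auto simp: single_def split: if_splits)
  also have "\<dots> = h i m"
    using i m abelian_group_hom.hom_closed[OF h] by (simp add: single_apply)
  finally show "?H (single I M i m) = h i m" .
qed

end

text \<open>The analogue of \<open>direct_sum_universal\<close> for biadditive maps, stated as
  additivity in each argument so that no tensor product is formed. It is made for the composition
  \<open>orbit_sum_Cmp\<close>, whose defining sum has the shape of \<open>T\<close>.\<close>

lemma direct_sum_bilinear:
  fixes t :: "'i \<Rightarrow> 'j \<Rightarrow> 'm \<Rightarrow> 'n \<Rightarrow> 'w"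
  assumes "module_family k I M" "module_family k J N" and W: "abelian_group W"
    and tl: "\<And>i j n. \<lbrakk>i \<in> I; j \<in> J; n \<in> carrier (N j)\<rbrakk> \<Longrightarrow> abelian_group_hom (M i) W (\<lambda>m. t i j m n)"
    and tr: "\<And>i j m. \<lbrakk>i \<in> I; j \<in> J; m \<in> carrier (M i)\<rbrakk> \<Longrightarrow> abelian_group_hom (N j) W (t i j m)"
  defines "T \<equiv> \<lambda>v u. finsum W (\<lambda>(i, j). t i j (v i) (u j)) ({i \<in> I. v i \<noteq> \<zero>\<^bsub>M i\<^esub>} \<times> {j \<in> J. u j \<noteq> \<zero>\<^bsub>N j\<^esub>})"
  shows "u \<in> carrier (direct_sum J N) \<Longrightarrow> abelian_group_hom (direct_sum I M) W (\<lambda>v. T v u)"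
    and "v \<in> carrier (direct_sum I M) \<Longrightarrow> abelian_group_hom (direct_sum J N) W (T v)"
    and "\<lbrakk>i \<in> I; j \<in> J; m \<in> carrier (M i); n \<in> carrier (N j)\<rbrakk> \<Longrightarrow>
           T (single I M i m) (single J N j n) = t i j m n"
proof -
  interpret M: module_family k I M by fact
  interpret N: module_family k J N by fact
  interpret W: abelian_group W by fact
  interpret VM: abelian_group "direct_sum I M" by (rule M.direct_sum_abelian_group)
  interpret VN: abelian_group "direct_sum J N" by (rule N.direct_sum_abelian_group)
  let ?S = "\<lambda>u. {i \<in> I. u i \<noteq> \<zero>\<^bsub>M i\<^esub>}" and ?R = "\<lambda>u. {i \<in> J. u i \<noteq> \<zero>\<^bsub>N i\<^esub>}"
  have tc: "t i j m n \<in> carrier W"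
    if "i \<in> I" "j \<in> J" "m \<in> carrier (M i)" "n \<in> carrier (N j)" for i j m n
    using that abelian_group_hom.hom_closed[OF tr] by blast
  have tz: "t i j \<zero>\<^bsub>M i\<^esub> n = \<zero>\<^bsub>W\<^esub>" if "i \<in> I" "j \<in> J" "n \<in> carrier (N j)" for i j n
    using abelian_group_hom.hom_zero[OF tl[OF that]] by simp
  have tz': "t i j m \<zero>\<^bsub>N j\<^esub> = \<zero>\<^bsub>W\<^esub>" if "i \<in> I" "j \<in> J" "m \<in> carrier (M i)" for i j m
    using abelian_group_hom.hom_zero[OF tr[OF that]] by simp
  have tcu: "t i j (v i) (u j) \<in> carrier W"
    if "i \<in> I" "j \<in> J" "v \<in> carrier (direct_sum I M)" "u \<in> carrier (direct_sum J N)" for i j v u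
    using that by (intro tc M.direct_sum_component N.direct_sum_component)
  \<comment> \<open>Both supports may be enlarged at once, because \<open>t i j\<close> vanishes as
    soon as one of its arguments is zero. Additivity in either variable then becomes additivity of
    sums over a fixed rectangle.\<close>
  have T_eq: "T v u = (finsum W (\<lambda>(i, j). t i j (v i) (u j)) (A \<times> B))"
    if v: "v \<in> carrier (direct_sum I M)" and u: "u \<in> carrier (direct_sum J N)"
      and "finite A" "finite B" "?S v \<subseteq> A" "?R u \<subseteq> B" and AB: "A \<subseteq> I" "B \<subseteq> J" for v u A B
    unfolding T_def
  proof (rule W.finsum_superset)
    show "(case p of (i, j) \<Rightarrow> t i j (v i) (u j)) = \<zero>\<^bsub>W\<^esub>" if p: "p \<in> A \<times> B - ?S v \<times> ?R u" for p
    proof -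
      obtain i j where [simp]: "p = (i, j)" by (cases p)
      have ij: "i \<in> I" "j \<in> J" using p AB by auto
      consider "v i = \<zero>\<^bsub>M i\<^esub>" | "u j = \<zero>\<^bsub>N j\<^esub>" using p ij by auto
      then show ?thesis
        using ij M.direct_sum_component[OF v] N.direct_sum_component[OF u] by cases (simp_all add: tz tz')
    qed
    show "(\<lambda>(i, j). t i j (v i) (u j)) \<in> A \<times> B \<rightarrow> carrier W"
      using AB by (auto intro!: tcu[OF _ _ v u])
  qed (use \<open>finite A\<close> \<open>finite B\<close> \<open>?S v \<subseteq> A\<close> \<open>?R u \<subseteq> B\<close> in auto)
  have Tc: "T v u \<in> carrier W"
    if "v \<in> carrier (direct_sum I M)" "u \<in> carrier (direct_sum J N)" for v u
    unfolding T_def using tcu[OF _ _ that] by (intro W.finsum_closed) auto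
  {
    assume u: "u \<in> carrier (direct_sum J N)"
    show "abelian_group_hom (direct_sum I M) W (\<lambda>v. T v u)"
    proof (rule abelian_group_hom_intro[OF VM.abelian_group_axioms W])
      fix v v' assume v: "v \<in> carrier (direct_sum I M)" and v': "v' \<in> carrier (direct_sum I M)"
      let ?w = "v \<oplus>\<^bsub>direct_sum I M\<^esub> v'"
      have w: "?w \<in> carrier (direct_sum I M)" using v v' by simp
      let ?A = "?S v \<union> ?S v' \<union> ?S ?w"
      have A: "finite ?A" "finite (?R u)"
        using u v v' w M.direct_sum_support N.direct_sum_support by simp_all
      have "T ?w u = (finsum W (\<lambda>(i, j). t i j (?w i) (u j)) (?A \<times> ?R u))"
        by (rule T_eq[OF w u A]) auto
      also have "\<dots> = (\<Oplus>\<^bsub>W\<^esub>p\<in>?A \<times> ?R u. (case p of (i, j) \<Rightarrow> t i j (v i) (u j)) \<oplus>\<^bsub>W\<^esub>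
                                             (case p of (i, j) \<Rightarrow> t i j (v' i) (u j)))"
        using tcu[OF _ _ v u] tcu[OF _ _ v' u] N.direct_sum_component[OF u]
          M.direct_sum_component[OF v] M.direct_sum_component[OF v']
        by (intro W.add.finprod_cong')
          (auto simp: M.direct_sum_add abelian_group_hom.hom_add[OF tl])
      also have "\<dots> = (finsum W (\<lambda>(i, j). t i j (v i) (u j)) (?A \<times> ?R u)) \<oplus>\<^bsub>W\<^esub>
                        (finsum W (\<lambda>(i, j). t i j (v' i) (u j)) (?A \<times> ?R u))"
        using tcu[OF _ _ v u] tcu[OF _ _ v' u] by (intro W.finsum_addf) auto
      also have "(finsum W (\<lambda>(i, j). t i j (v i) (u j)) (?A \<times> ?R u)) = T v u"
        by (rule T_eq[OF v u A, symmetric]) auto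
      also have "(finsum W (\<lambda>(i, j). t i j (v' i) (u j)) (?A \<times> ?R u)) = T v' u"
        by (rule T_eq[OF v' u A, symmetric]) auto
      finally show "T ?w u = T v u \<oplus>\<^bsub>W\<^esub> T v' u" .
    qed (use u Tc in auto)
  }
  {
    assume v: "v \<in> carrier (direct_sum I M)"
    show "abelian_group_hom (direct_sum J N) W (T v)"
    proof (rule abelian_group_hom_intro[OF VN.abelian_group_axioms W])
      fix u u' assume u: "u \<in> carrier (direct_sum J N)" and u': "u' \<in> carrier (direct_sum J N)"
      let ?w = "u \<oplus>\<^bsub>direct_sum J N\<^esub> u'"
      have w: "?w \<in> carrier (direct_sum J N)" using u u' by simp
      let ?A = "?R u \<union> ?R u' \<union> ?R ?w"
      have A: "finite (?S v)" "finite ?A"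
        using u v u' w M.direct_sum_support N.direct_sum_support by simp_all
      have "T v ?w = (finsum W (\<lambda>(i, j). t i j (v i) (?w j)) (?S v \<times> ?A))"
        by (rule T_eq[OF v w A]) auto
      also have "\<dots> = (\<Oplus>\<^bsub>W\<^esub>p\<in>?S v \<times> ?A. (case p of (i, j) \<Rightarrow> t i j (v i) (u j)) \<oplus>\<^bsub>W\<^esub>
                                             (case p of (i, j) \<Rightarrow> t i j (v i) (u' j)))"
        using tcu[OF _ _ v u] tcu[OF _ _ v u'] M.direct_sum_component[OF v]
          N.direct_sum_component[OF u] N.direct_sum_component[OF u']
        by (intro W.add.finprod_cong')
          (auto simp: N.direct_sum_add abelian_group_hom.hom_add[OF tr])
      also have "\<dots> = (finsum W (\<lambda>(i, j). t i j (v i) (u j)) (?S v \<times> ?A)) \<oplus>\<^bsub>W\<^esub>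
                        (finsum W (\<lambda>(i, j). t i j (v i) (u' j)) (?S v \<times> ?A))"
        using tcu[OF _ _ v u] tcu[OF _ _ v u'] by (intro W.finsum_addf) auto
      also have "(finsum W (\<lambda>(i, j). t i j (v i) (u j)) (?S v \<times> ?A)) = T v u"
        by (rule T_eq[OF v u A, symmetric]) auto
      also have "(finsum W (\<lambda>(i, j). t i j (v i) (u' j)) (?S v \<times> ?A)) = T v u'"
        by (rule T_eq[OF v u' A, symmetric]) auto
      finally show "T v ?w = T v u \<oplus>\<^bsub>W\<^esub> T v u'" .
    qed (use v Tc in auto)
  }
  assume ij: "i \<in> I" "j \<in> J" and mn: "m \<in> carrier (M i)" "n \<in> carrier (N j)"
  have "T (single I M i m) (single J N j n) =
     (finsum W (\<lambda>(i', j'). t i' j' (single I M i m i') (single J N j n j')) ({i} \<times> {j}))"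
    using ij mn by (intro T_eq M.single_closed N.single_closed) (auto simp: single_def split: if_splits)
  also have "\<dots> = t i j m n"
    using ij mn tc by (simp add: M.single_apply N.single_apply)
  finally show "T (single I M i m) (single J N j n) = t i j m n" .
qed

subsection \<open>Coinvariants\<close>

text \<open>
  If \<open>\<Sum>\<^sub>s a\<^sub>s = 0\<close>, then \<open>\<Sum>\<^sub>s a\<^sub>s (s m) = \<Sum>\<^sub>s (s (a\<^sub>s m) - a\<^sub>s m)\<close>.
\<close>

lemma augmentation_submodule_least:
  assumes V: "module k V" and \<rho>: "\<And>s. s \<in> carrier G \<Longrightarrow> \<rho> s \<in> module_hom k V V"
    and K: "additive_subgroup K V"
    and diff: "\<And>s m. \<lbrakk>s \<in> carrier G; m \<in> carrier V\<rbrakk> \<Longrightarrow> \<rho> s m \<ominus>\<^bsub>V\<^esub> m \<in> K"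
  shows "augmentation_submodule k G V \<rho> \<subseteq> K"
proof -
  interpret V: module k V by fact
  interpret K: additive_subgroup K V by fact
  \<comment> \<open>Removing a point from the support destroys the condition that the coefficients
    add up to zero. The induction therefore allows arbitrary coefficients and subtracts their sum
    times \<open>m\<close>, a term that vanishes on the augmentation kernel.\<close>
  have *: "(\<Oplus>\<^bsub>V\<^esub>s\<in>S. a s \<odot>\<^bsub>V\<^esub> \<rho> s m) \<ominus>\<^bsub>V\<^esub> (\<Oplus>\<^bsub>k\<^esub>s\<in>S. a s) \<odot>\<^bsub>V\<^esub> m \<in> K"
    if "finite S" "S \<subseteq> carrier G" "a \<in> S \<rightarrow> carrier k" and m: "m \<in> carrier V" for S a m
    using that(1-3)
  proof (induction S)
    case empty
    then show ?case using m by (simp add: V.M.minus_eq V.M.minus_zero_eq)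
  next
    case (insert s S)
    let ?P = "\<Oplus>\<^bsub>V\<^esub>s\<in>S. a s \<odot>\<^bsub>V\<^esub> \<rho> s m" and ?A = "\<Oplus>\<^bsub>k\<^esub>s\<in>S. a s"
    have s: "s \<in> carrier G" "a s \<in> carrier k" "a \<in> S \<rightarrow> carrier k" "S \<subseteq> carrier G"
      using insert.prems by auto
    have c: "\<rho> t m \<in> carrier V" if "t \<in> carrier G" for t
      using module_hom_closed[OF \<rho>[OF that] m] .
    have A: "?A \<in> carrier k" using s by (intro V.R.finsum_closed)
    have f: "(\<lambda>s. a s \<odot>\<^bsub>V\<^esub> \<rho> s m) \<in> S \<rightarrow> carrier V" using c s by auto
    have P: "?P \<in> carrier V" using f by (intro V.M.finsum_closed)
    have "(\<rho> s (a s \<odot>\<^bsub>V\<^esub> m) \<ominus>\<^bsub>V\<^esub> a s \<odot>\<^bsub>V\<^esub> m) \<oplus>\<^bsub>V\<^esub> (?P \<ominus>\<^bsub>V\<^esub> ?A \<odot>\<^bsub>V\<^esub> m) \<in> K"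
      using diff[OF s(1)] s m insert.IH by (intro K.a_closed) auto
    also have "(\<rho> s (a s \<odot>\<^bsub>V\<^esub> m) \<ominus>\<^bsub>V\<^esub> a s \<odot>\<^bsub>V\<^esub> m) \<oplus>\<^bsub>V\<^esub> (?P \<ominus>\<^bsub>V\<^esub> ?A \<odot>\<^bsub>V\<^esub> m) =
        (a s \<odot>\<^bsub>V\<^esub> \<rho> s m \<oplus>\<^bsub>V\<^esub> ?P) \<ominus>\<^bsub>V\<^esub> (a s \<oplus>\<^bsub>k\<^esub> ?A) \<odot>\<^bsub>V\<^esub> m"
      using s m A P c[OF s(1)]
      by (simp add: module_hom_smult[OF \<rho>] V.smult_l_distr V.M.minus_eq V.M.minus_add V.M.a_ac)
    also have "a s \<odot>\<^bsub>V\<^esub> \<rho> s m \<oplus>\<^bsub>V\<^esub> ?P = (\<Oplus>\<^bsub>V\<^esub>s\<in>insert s S. a s \<odot>\<^bsub>V\<^esub> \<rho> s m)"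
      using insert.hyps s f c[OF s(1)] by simp
    also have "a s \<oplus>\<^bsub>k\<^esub> ?A = (\<Oplus>\<^bsub>k\<^esub>s\<in>insert s S. a s)"
      using insert.hyps s by simp
    finally show ?case .
  qed
  have "group_algebra_act k G V \<rho> a m \<in> K"
    if a: "a \<in> augmentation_kernel k G" and m: "m \<in> carrier V" for a m
  proof -
    have "finite {s \<in> carrier G. a s \<noteq> \<zero>\<^bsub>k\<^esub>}" "a \<in> {s \<in> carrier G. a s \<noteq> \<zero>\<^bsub>k\<^esub>} \<rightarrow> carrier k"
      and 0: "(\<Oplus>\<^bsub>k\<^esub>s\<in>{s \<in> carrier G. a s \<noteq> \<zero>\<^bsub>k\<^esub>}. a s) = \<zero>\<^bsub>k\<^esub>"
      using a by (auto simp: augmentation_kernel_def group_algebra_carrier_def augmentation_def)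
    then have "(\<Oplus>\<^bsub>V\<^esub>s\<in>{s \<in> carrier G. a s \<noteq> \<zero>\<^bsub>k\<^esub>}. a s \<odot>\<^bsub>V\<^esub> \<rho> s m) \<ominus>\<^bsub>V\<^esub> \<zero>\<^bsub>k\<^esub> \<odot>\<^bsub>V\<^esub> m \<in> K"
      using *[of "{s \<in> carrier G. a s \<noteq> \<zero>\<^bsub>k\<^esub>}" a m] m by auto
    moreover have "(\<Oplus>\<^bsub>V\<^esub>s\<in>{s \<in> carrier G. a s \<noteq> \<zero>\<^bsub>k\<^esub>}. a s \<odot>\<^bsub>V\<^esub> \<rho> s m) \<in> carrier V"
      using a m module_hom_closed[OF \<rho> m]
      by (intro V.M.finsum_closed) (auto simp: augmentation_kernel_def group_algebra_carrier_def)
    ultimately show ?thesis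
      using m by (simp add: group_algebra_act_def V.M.minus_eq V.M.minus_zero_eq)
  qed
  then show ?thesis
    unfolding augmentation_submodule_def
    by (intro V.M.add.generate_subgroup_incl K.a_subgroup) auto
qed

text \<open>The difference is (s - 1) m, and s - 1 has augmentation zero. The case s = 1 is separate
  because the coefficients 1 at s and -1 at the identity can only be prescribed at two distinct
  points.\<close>

lemma action_diff_in_augmentation_submodule:
  assumes V: "module k V" and G: "group G"
    and s: "s \<in> carrier G" and m: "m \<in> carrier V"
    and \<rho>s: "\<rho> s m \<in> carrier V" and \<rho>1: "\<rho> \<one>\<^bsub>G\<^esub> m = m"
  shows "\<rho> s m \<ominus>\<^bsub>V\<^esub> m \<in> augmentation_submodule k G V \<rho>"
proof (cases "s = \<one>\<^bsub>G\<^esub>")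
  case True
  interpret V: module k V by fact
  have "\<zero>\<^bsub>V\<^esub> \<in> augmentation_submodule k G V \<rho>"
    unfolding augmentation_submodule_def using generate.one[of "add_monoid V"] by simp
  then show ?thesis using True m \<rho>1 by (simp add: V.M.minus_eq V.M.r_neg)
next
  case False
  interpret V: module k V by fact
  interpret G: group G by fact
  define a where
    "a = (\<lambda>g\<in>carrier G. if g = s then \<one>\<^bsub>k\<^esub> else if g = \<one>\<^bsub>G\<^esub> then \<ominus>\<^bsub>k\<^esub> \<one>\<^bsub>k\<^esub> else \<zero>\<^bsub>k\<^esub>)"
  let ?S = "{g \<in> carrier G. a g \<noteq> \<zero>\<^bsub>k\<^esub>}"
  \<comment> \<open>Only an inclusion holds: if \<open>k\<close> is the zero ring, then the support
    is empty. The sums over \<open>?S\<close> are therefore extended to the two points before they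
    are evaluated.\<close>
  have S: "?S \<subseteq> {s, \<one>\<^bsub>G\<^esub>}" by (auto simp: a_def)
  have a: "a s = \<one>\<^bsub>k\<^esub>" "a \<one>\<^bsub>G\<^esub> = \<ominus>\<^bsub>k\<^esub> \<one>\<^bsub>k\<^esub>" using s False by (auto simp: a_def)
  have 0: "\<forall>i\<in>{s, \<one>\<^bsub>G\<^esub>} - ?S. a i = \<zero>\<^bsub>k\<^esub>" using s by auto
  have "augmentation k G a = (\<Oplus>\<^bsub>k\<^esub>g\<in>{s, \<one>\<^bsub>G\<^esub>}. a g)"
    unfolding augmentation_def using a by (intro V.R.finsum_superset[OF _ S] bspec[OF 0]) auto
  also have "\<dots> = \<zero>\<^bsub>k\<^esub>" using False by (simp add: a V.R.r_neg)
  finally have "augmentation k G a = \<zero>\<^bsub>k\<^esub>" .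
  moreover have "a \<in> carrier G \<rightarrow>\<^sub>E carrier k" by (auto simp: a_def)
  moreover have "finite ?S" using finite_subset[OF S] by simp
  ultimately have "a \<in> augmentation_kernel k G"
    by (simp add: augmentation_kernel_def group_algebra_carrier_def)
  moreover have "group_algebra_act k G V \<rho> a m = (\<Oplus>\<^bsub>V\<^esub>g\<in>{s, \<one>\<^bsub>G\<^esub>}. a g \<odot>\<^bsub>V\<^esub> \<rho> g m)"
    unfolding group_algebra_act_def
  proof (rule V.M.finsum_superset[OF _ S])
    fix i assume i: "i \<in> {s, \<one>\<^bsub>G\<^esub>} - ?S"
    show "a i \<odot>\<^bsub>V\<^esub> \<rho> i m = \<zero>\<^bsub>V\<^esub>"
      unfolding bspec[OF 0 i] using i \<rho>s \<rho>1 m by auto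
  qed (use a \<rho>s \<rho>1 m in auto)
  moreover have "\<dots> = \<rho> s m \<ominus>\<^bsub>V\<^esub> m"
    using False \<rho>s \<rho>1 m by (simp add: a V.smult_l_minus V.M.minus_eq)
  ultimately show ?thesis
    unfolding augmentation_submodule_def using m by (intro generate.incl CollectI) (auto intro!: exI[of _ a] exI[of _ m])
qed

section \<open>The coinvariants of a kG-module and the maps out of them\<close>

locale kG_module = V: module k V + G: group G
  for k :: "('k, 'r) ring_scheme" and V :: "('k, 'm) module" and G :: "('g, 'h) monoid_scheme" +
  fixes \<rho> :: "'g \<Rightarrow> 'm \<Rightarrow> 'm"
  assumes \<rho>_hom: "s \<in> carrier G \<Longrightarrow> \<rho> s \<in> module_hom k V V"
    and \<rho>_one: "m \<in> carrier V \<Longrightarrow> \<rho> \<one>\<^bsub>G\<^esub> m = m"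
begin

abbreviation "N \<equiv> augmentation_submodule k G V \<rho>"

lemma diff_in_N: "\<lbrakk>s \<in> carrier G; m \<in> carrier V\<rbrakk> \<Longrightarrow> \<rho> s m \<ominus>\<^bsub>V\<^esub> m \<in> N"
  by (intro action_diff_in_augmentation_submodule[OF V.module_axioms G.group_axioms])
    (auto intro: module_hom_closed[OF \<rho>_hom] \<rho>_one)

lemma N_least:
  assumes "additive_subgroup K V" "\<And>s m. \<lbrakk>s \<in> carrier G; m \<in> carrier V\<rbrakk> \<Longrightarrow> \<rho> s m \<ominus>\<^bsub>V\<^esub> m \<in> K"
  shows "N \<subseteq> K"
  by (rule augmentation_submodule_least[OF V.module_axioms \<rho>_hom assms])

lemma N_subgroup: "additive_subgroup N V"
proof -
  have "group_algebra_act k G V \<rho> a m \<in> carrier V"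
    if "a \<in> augmentation_kernel k G" "m \<in> carrier V" for a m
    using that module_hom_closed[OF \<rho>_hom] unfolding group_algebra_act_def
    by (intro V.M.finsum_closed) (auto simp: augmentation_kernel_def group_algebra_carrier_def)
  then show ?thesis
    unfolding augmentation_submodule_def
    by (intro additive_subgroup.intro V.M.add.generate_is_subgroup) auto
qed

sublocale N: abelian_subgroup N V
  by (rule abelian_subgroupI3[OF N_subgroup V.M.abelian_group_axioms])

text \<open>\<open>N\<close> is generated as an additive group, so stability under scalars needs an
  argument: the elements n with a n in \<open>N\<close> form a subgroup, and it contains every
  difference because a (s m - m) = s (a m) - a m.\<close>

lemma N_smult:
  assumes a: "a \<in> carrier k" and n: "n \<in> N"
  shows "a \<odot>\<^bsub>V\<^esub> n \<in> N"
proof -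
  have "additive_subgroup {n \<in> carrier V. a \<odot>\<^bsub>V\<^esub> n \<in> N} V"
    using a by (intro additive_subgroup.intro V.M.add.subgroupI)
      (auto simp: V.smult_r_distr V.smult_r_minus intro!: exI[of _ "\<zero>\<^bsub>V\<^esub>"])
  then have "N \<subseteq> {n \<in> carrier V. a \<odot>\<^bsub>V\<^esub> n \<in> N}"
  proof (rule N_least)
    fix s m assume s: "s \<in> carrier G" and m: "m \<in> carrier V"
    have "\<rho> s (a \<odot>\<^bsub>V\<^esub> m) \<ominus>\<^bsub>V\<^esub> a \<odot>\<^bsub>V\<^esub> m = a \<odot>\<^bsub>V\<^esub> (\<rho> s m \<ominus>\<^bsub>V\<^esub> m)"
      using a m module_hom_closed[OF \<rho>_hom[OF s]] module_hom_smult[OF \<rho>_hom[OF s] a m]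
      by (simp add: V.M.minus_eq V.smult_r_distr V.smult_r_minus)
    then show "\<rho> s m \<ominus>\<^bsub>V\<^esub> m \<in> {n \<in> carrier V. a \<odot>\<^bsub>V\<^esub> n \<in> N}"
      using diff_in_N[OF s, of "a \<odot>\<^bsub>V\<^esub> m"] diff_in_N[OF s m] a m by (auto simp del: N.a_Hcarr intro: N.a_Hcarr)
  qed
  then show ?thesis using n by auto
qed

abbreviation "cls u \<equiv> N +>\<^bsub>V\<^esub> u"
abbreviation "Q \<equiv> coinvariants k G V \<rho>"

lemma Q_carrier: "carrier Q = cls ` carrier V"
  by (auto simp: coinvariants_def quotient_module_def A_FactGroup_def' A_RCOSETS_def')

lemma Q_abelian_group: "abelian_group Q"
proof -
  interpret F: comm_group "V A_Mod N" by (rule N.a_factorgroup_is_comm_group)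
  have eq: "carrier Q = carrier (V A_Mod N)" "ring.add Q = monoid.mult (V A_Mod N)"
    "ring.zero Q = monoid.one (V A_Mod N)"
    by (simp_all add: coinvariants_def quotient_module_def)
  show ?thesis
    by (rule abelian_groupI, unfold eq)
      (rule F.m_closed F.one_closed F.m_assoc F.m_comm F.l_one F.l_inv_ex; assumption)+
qed

lemma cls_memD:
  assumes "u \<in> carrier V" "v \<in> cls u" shows "v \<in> carrier V" "cls v = cls u"
proof -
  show "v \<in> carrier V" by (rule N.a_elemrcos_carrier[OF assms])
  show "cls v = cls u" using N.a_repr_independence'[OF assms(2,1)] by simp
qed

lemma cls_self: "u \<in> carrier V \<Longrightarrow> u \<in> cls u"
  by (rule N.a_rcos_self)

lemma cls_eq_iff:
  assumes "u \<in> carrier V" "v \<in> carrier V"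
  shows "cls u = cls v \<longleftrightarrow> u \<ominus>\<^bsub>V\<^esub> v \<in> N"
proof -
  have "u \<ominus>\<^bsub>V\<^esub> v \<in> N \<longleftrightarrow> u \<in> cls v"
    using N.a_rcos_module[OF assms(2,1)] by (simp add: V.M.minus_eq)
  then show ?thesis using cls_memD(2)[OF assms(2)] cls_self[OF assms(1)] by blast
qed

text \<open>The scalar multiple of a coset is defined as a union over its members. By
  \<open>N_smult\<close> all members contribute the same coset, and the union is not empty since it
  is indexed by a set containing \<open>u\<close>.\<close>

lemma cls_hom: "cls \<in> module_hom k V Q"
proof -
  have "cls (a \<odot>\<^bsub>V\<^esub> u) = a \<odot>\<^bsub>Q\<^esub> cls u" if a: "a \<in> carrier k" and u: "u \<in> carrier V" for a u
  proof -
    have "cls (a \<odot>\<^bsub>V\<^esub> v) = cls (a \<odot>\<^bsub>V\<^esub> u)" if "v \<in> cls u" for v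
    proof -
      have v: "v \<in> carrier V" "cls v = cls u" using cls_memD[OF u that] .
      then have "a \<odot>\<^bsub>V\<^esub> (v \<ominus>\<^bsub>V\<^esub> u) \<in> N" using N_smult a u cls_eq_iff by blast
      moreover have "a \<odot>\<^bsub>V\<^esub> (v \<ominus>\<^bsub>V\<^esub> u) = a \<odot>\<^bsub>V\<^esub> v \<ominus>\<^bsub>V\<^esub> a \<odot>\<^bsub>V\<^esub> u"
        using a u v by (simp add: V.M.minus_eq V.smult_r_distr V.smult_r_minus)
      ultimately show ?thesis using a u v cls_eq_iff by simp
    qed
    then have "(\<Union>v\<in>cls u. cls (a \<odot>\<^bsub>V\<^esub> v)) = (\<Union>v\<in>cls u. cls (a \<odot>\<^bsub>V\<^esub> u))"
      by (intro SUP_cong refl)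
    also have "\<dots> = cls (a \<odot>\<^bsub>V\<^esub> u)" using cls_self[OF u] by blast
    finally show ?thesis by (simp add: coinvariants_def quotient_module_def)
  qed
  moreover have "cls (u \<oplus>\<^bsub>V\<^esub> v) = cls u \<oplus>\<^bsub>Q\<^esub> cls v" if "u \<in> carrier V" "v \<in> carrier V" for u v
    using N.a_rcos_sum[OF that] by (simp add: coinvariants_def quotient_module_def)
  ultimately show ?thesis by (auto simp: module_hom_def Q_carrier)
qed

lemma cls_abelian_group_hom: "abelian_group_hom V Q cls"
  using cls_hom by (intro abelian_group_hom_intro)
    (auto simp: module_hom_def V.M.abelian_group_axioms Q_abelian_group)

lemma cls_act: "\<lbrakk>s \<in> carrier G; m \<in> carrier V\<rbrakk> \<Longrightarrow> cls (\<rho> s m) = cls m"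
  using cls_eq_iff module_hom_closed[OF \<rho>_hom] diff_in_N by blast

text \<open>The universal property of the coinvariants, expressed on representatives so that no
  induced map on cosets has to be constructed. The kernel of \<open>h\<close> is a subgroup that
  contains all differences s m - m, hence contains \<open>N\<close>.\<close>

lemma hom_factors:
  assumes h: "abelian_group_hom V W h"
    and inv: "\<And>s m. \<lbrakk>s \<in> carrier G; m \<in> carrier V\<rbrakk> \<Longrightarrow> h (\<rho> s m) = h m"
    and uv: "u \<in> carrier V" "v \<in> carrier V" "cls u = cls v"
  shows "h u = h v"
proof -
  interpret h: abelian_group_hom V W h by fact
  have h_diff: "h (x \<ominus>\<^bsub>V\<^esub> y) = \<zero>\<^bsub>W\<^esub> \<longleftrightarrow> h x = h y" if "x \<in> carrier V" "y \<in> carrier V" for x y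
    using that h.H.minus_eq_zero_iff[of "h x" "h y"] by (simp add: V.M.minus_eq)
  have "N \<subseteq> a_kernel V W h"
    using h.additive_subgroup_a_kernel
  proof (rule N_least)
    fix s m assume s: "s \<in> carrier G" and m: "m \<in> carrier V"
    have c: "\<rho> s m \<in> carrier V" by (rule module_hom_closed[OF \<rho>_hom[OF s] m])
    show "\<rho> s m \<ominus>\<^bsub>V\<^esub> m \<in> a_kernel V W h"
      using h_diff[OF c m] inv[OF s m] V.M.minus_closed[OF c m] by (simp only: a_kernel_def' mem_Collect_eq)
  qed
  moreover have "u \<ominus>\<^bsub>V\<^esub> v \<in> N" using uv(3) cls_eq_iff[OF uv(1,2)] by simp
  ultimately have "h (u \<ominus>\<^bsub>V\<^esub> v) = \<zero>\<^bsub>W\<^esub>" unfolding a_kernel_def' by blast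
  then show ?thesis using h_diff[OF uv(1,2)] by simp
qed

end

subsection \<open>Composition in the quotient category\<close>

context free_G_category_over
begin

abbreviation "Orbs \<equiv> orbits G (Ob C) (o_act C)"
abbreviation "orb \<equiv> orbit G (o_act C)"
abbreviation "sng \<equiv> orbit_single C"
abbreviation "cl \<equiv> orbit_class k G C"
abbreviation "qm \<equiv> quotient_Mor k G C"

section \<open>Orbits and the group elements that connect their points\<close>

lemma G_group: "group G"
  by (rule group_axioms)

lemma o_act_closed: "\<lbrakk>s \<in> carrier G; x \<in> Ob C\<rbrakk> \<Longrightarrow> o_act C s x \<in> Ob C"
  using element_image by blast

lemma o_act_one: "x \<in> Ob C \<Longrightarrow> o_act C \<one>\<^bsub>G\<^esub> x = x"
  using id_eq_one by (metis restrict_apply')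

lemma o_act_inv_left: "\<lbrakk>s \<in> carrier G; x \<in> Ob C\<rbrakk> \<Longrightarrow> o_act C (inv\<^bsub>G\<^esub> s) (o_act C s x) = x"
  by (rule orbit_sym_aux) auto

lemma o_act_inv_right: "\<lbrakk>s \<in> carrier G; x \<in> Ob C\<rbrakk> \<Longrightarrow> o_act C s (o_act C (inv\<^bsub>G\<^esub> s) x) = x"
  using o_act_inv_left[of "inv\<^bsub>G\<^esub> s" x] group.inv_closed[OF G_group] group.inv_inv[OF G_group] by simp

lemma orbit_in_orbits: "x \<in> Ob C \<Longrightarrow> orb x \<in> Orbs"
  by (auto simp: orbits_def)

lemma orbits_subset: "\<lbrakk>\<alpha> \<in> Orbs; x \<in> \<alpha>\<rbrakk> \<Longrightarrow> x \<in> Ob C"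
  by (auto simp: orbits_def orbit_def intro: o_act_closed)

text \<open>With x = t z one has s x = (s t) z and s z = (s t^-1) x, so the orbits of x and z
  contain each other.\<close>

lemma orbit_eq:
  assumes "\<alpha> \<in> Orbs" "x \<in> \<alpha>" shows "orb x = \<alpha>"
proof -
  obtain z where z: "z \<in> Ob C" "\<alpha> = orb z" using assms by (auto simp: orbits_def)
  then obtain t where t: "t \<in> carrier G" "x = o_act C t z" using assms by (auto simp: orbit_def)
  have "o_act C s x \<in> orb z" if "s \<in> carrier G" for s
    using that z t composition_rule[of z s t] monoid.m_closed[OF group.is_monoid[OF G_group]]
    by (auto simp: orbit_def intro!: exI[of _ "s \<otimes>\<^bsub>G\<^esub> t"])
  moreover have "o_act C s z \<in> orb x" if s: "s \<in> carrier G" for s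
  proof -
    have i: "inv\<^bsub>G\<^esub> t \<in> carrier G" using t group.inv_closed[OF G_group] by simp
    have "o_act C s z = o_act C (s \<otimes>\<^bsub>G\<^esub> inv\<^bsub>G\<^esub> t) x"
      using o_act_inv_left[OF t(1) z(1)] composition_rule[OF o_act_closed[OF t(1) z(1)] s i] t(2) by simp
    moreover have "s \<otimes>\<^bsub>G\<^esub> inv\<^bsub>G\<^esub> t \<in> carrier G"
      using s i monoid.m_closed[OF group.is_monoid[OF G_group]] by simp
    ultimately show ?thesis by (auto simp: orbit_def)
  qed
  ultimately have "orb x = orb z" unfolding orbit_def[of G "o_act C" x] orbit_def[of G "o_act C" z]
    by (auto simp: orbit_def)
  then show ?thesis using z by simp
qed

lemma orbits_o_act: "\<lbrakk>\<alpha> \<in> Orbs; x \<in> \<alpha>; s \<in> carrier G\<rbrakk> \<Longrightarrow> o_act C s x \<in> \<alpha>"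
  using orbit_eq[of \<alpha> x] by (auto simp: orbit_def)

lemma orbits_transitive: "\<lbrakk>\<alpha> \<in> Orbs; x \<in> \<alpha>; y \<in> \<alpha>\<rbrakk> \<Longrightarrow> \<exists>s\<in>carrier G. o_act C s x = y"
  using orbit_eq[of \<alpha> x] by (auto simp: orbit_def)

lemma orbits_nonempty: "\<alpha> \<in> Orbs \<Longrightarrow> \<alpha> \<noteq> {}"
  using orbit_refl by (auto simp: orbits_def)

lemma orbit_o_act: "\<lbrakk>s \<in> carrier G; x \<in> Ob C\<rbrakk> \<Longrightarrow> orb (o_act C s x) = orb x"
  by (intro orbit_eq orbit_in_orbits orbits_o_act orbit_refl)

text \<open>This is where freeness is used: if t x = s x, then s^-1 t stabilizes x and is the
  identity. The definite description in \<open>transporter\<close> is thereby meaningful.\<close>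

lemma transporter_o_act:
  assumes s: "s \<in> carrier G" and x: "x \<in> Ob C"
  shows "transporter G C x (o_act C s x) = s"
  unfolding transporter_def
proof (rule the_equality)
  fix t assume t: "t \<in> carrier G \<and> o_act C t x = o_act C s x"
  then have "o_act C (inv\<^bsub>G\<^esub> s \<otimes>\<^bsub>G\<^esub> t) x = x"
    using s x by (simp add: composition_rule o_act_inv_left)
  then have "inv\<^bsub>G\<^esub> s \<otimes>\<^bsub>G\<^esub> t \<in> stabilizer G (o_act C) x"
    using s t by (simp add: stabilizer_def)
  then have "inv\<^bsub>G\<^esub> s \<otimes>\<^bsub>G\<^esub> t = \<one>\<^bsub>G\<^esub>" using free[OF x] by simp
  then have "s \<otimes>\<^bsub>G\<^esub> (inv\<^bsub>G\<^esub> s \<otimes>\<^bsub>G\<^esub> t) = s \<otimes>\<^bsub>G\<^esub> \<one>\<^bsub>G\<^esub>" by simp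
  then show "t = s" using s t by (simp add: group.inv_solve_left[OF G_group] flip: monoid.m_assoc[OF group.is_monoid[OF G_group]])
qed (use s in simp)

lemma transporter_props:
  assumes "\<alpha> \<in> Orbs" "x \<in> \<alpha>" "y \<in> \<alpha>"
  shows "transporter G C x y \<in> carrier G" "o_act C (transporter G C x y) x = y"
  using orbits_transitive[OF assms] transporter_o_act orbits_subset[OF assms(1,2)] by auto

lemma m_act_closed:
  "\<lbrakk>s \<in> carrier G; x \<in> Ob C; y \<in> Ob C; f \<in> carrier (Mor C y x)\<rbrakk> \<Longrightarrow>
     m_act C s y x f \<in> carrier (Mor C (o_act C s y) (o_act C s x))"
  by (rule module_hom_closed[OF m_act_linear])

lemma Cmp_closed:
  "\<lbrakk>x \<in> Ob C; y \<in> Ob C; z \<in> Ob C; f \<in> carrier (Mor C y x); g \<in> carrier (Mor C z y)\<rbrakk> \<Longrightarrow>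
     Cmp C z y x g f \<in> carrier (Mor C z x)"
  by (rule module_hom_closed[OF Cmp_linear_right])

lemma m_act_zero:
  assumes "s \<in> carrier G" "x \<in> Ob C" "y \<in> Ob C"
  shows "m_act C s y x \<zero>\<^bsub>Mor C y x\<^esub> = \<zero>\<^bsub>Mor C (o_act C s y) (o_act C s x)\<^esub>"
  using assms by (intro abelian_group_hom.hom_zero module_hom_abelian_group_hom[of k] m_act_linear
      Mor_module o_act_closed)

lemma m_act_inv_right:
  assumes "s \<in> carrier G" "x \<in> Ob C" "y \<in> Ob C" "f \<in> carrier (Mor C y x)"
  shows "m_act C s (o_act C (inv\<^bsub>G\<^esub> s) y) (o_act C (inv\<^bsub>G\<^esub> s) x) (m_act C (inv\<^bsub>G\<^esub> s) y x f) = f"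
  using assms m_act_mult[of "inv\<^bsub>G\<^esub> s" s x y f] m_act_one[of x y f] group.inv_closed[OF G_group]
    group.r_inv[OF G_group] by simp

section \<open>The sum of the morphism modules between two orbits, as a kG-module\<close>

lemma orbit_family:
  assumes "\<alpha> \<in> Orbs" "\<beta> \<in> Orbs"
  shows "module_family k (\<beta> \<times> \<alpha>) (\<lambda>(y, x). Mor C y x)"
  using assms by (intro module_family.intro module_family_axioms.intro is_cring)
    (auto intro!: Mor_module intro: orbits_subset)

lemma orbit_sum_module: "\<lbrakk>\<alpha> \<in> Orbs; \<beta> \<in> Orbs\<rbrakk> \<Longrightarrow> module k (orbit_sum C \<beta> \<alpha>)"
  unfolding orbit_sum_def by (rule module_family.direct_sum_module[OF orbit_family])

lemma orbit_single_hom: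
  assumes "\<alpha> \<in> Orbs" "\<beta> \<in> Orbs" "x \<in> \<alpha>" "y \<in> \<beta>"
  shows "sng \<beta> \<alpha> y x \<in> module_hom k (Mor C y x) (orbit_sum C \<beta> \<alpha>)"
  using module_family.single_module_hom[OF orbit_family[OF assms(1,2)], of "(y, x)"] assms(3,4)
  unfolding orbit_sum_def orbit_single_def[abs_def] by simp

lemmas orbit_single_closed = module_hom_closed[OF orbit_single_hom]

lemma orbit_sum_hom_eqI:
  assumes "\<alpha> \<in> Orbs" "\<beta> \<in> Orbs"
    and "abelian_group_hom (orbit_sum C \<beta> \<alpha>) W h" "abelian_group_hom (orbit_sum C \<beta> \<alpha>) W h'"
    and "\<And>y x f. \<lbrakk>y \<in> \<beta>; x \<in> \<alpha>; f \<in> carrier (Mor C y x)\<rbrakk> \<Longrightarrow> h (sng \<beta> \<alpha> y x f) = h' (sng \<beta> \<alpha> y x f)"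
    and "u \<in> carrier (orbit_sum C \<beta> \<alpha>)"
  shows "h u = h' u"
proof (rule module_family.direct_sum_hom_eqI[OF orbit_family[OF assms(1,2)] assms(3,4)[unfolded orbit_sum_def] _
      assms(6)[unfolded orbit_sum_def]])
  fix i m assume "i \<in> \<beta> \<times> \<alpha>" "m \<in> carrier (case i of (y, x) \<Rightarrow> Mor C y x)"
  then show "h (single (\<beta> \<times> \<alpha>) (\<lambda>(y, x). Mor C y x) i m) = h' (single (\<beta> \<times> \<alpha>) (\<lambda>(y, x). Mor C y x) i m)"
    using assms(5)[of "fst i" "snd i" m] by (cases i) (simp add: orbit_single_def)
qed

text \<open>\<open>orbit_sum_act\<close> is defined by components: the value at (b, a) is read at
  (s^-1 b, s^-1 a). That index equals (y, x) exactly for (b, a) = (s y, s x), and every other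
  component is the image of zero.\<close>

lemma orbit_sum_act_single:
  assumes \<alpha>: "\<alpha> \<in> Orbs" and \<beta>: "\<beta> \<in> Orbs" and s: "s \<in> carrier G"
    and x: "x \<in> \<alpha>" and y: "y \<in> \<beta>" and f: "f \<in> carrier (Mor C y x)"
  shows "orbit_sum_act G C \<beta> \<alpha> s (sng \<beta> \<alpha> y x f) =
           sng \<beta> \<alpha> (o_act C s y) (o_act C s x) (m_act C s y x f)"
proof (rule extensionalityI[of _ "\<beta> \<times> \<alpha>"])
  show "orbit_sum_act G C \<beta> \<alpha> s (sng \<beta> \<alpha> y x f) \<in> extensional (\<beta> \<times> \<alpha>)"
    unfolding orbit_sum_act_def by (rule restrict_extensional)
  show "sng \<beta> \<alpha> (o_act C s y) (o_act C s x) (m_act C s y x f) \<in> extensional (\<beta> \<times> \<alpha>)"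
    unfolding orbit_single_def single_def by (rule restrict_extensional)
  fix p assume "p \<in> \<beta> \<times> \<alpha>"
  then obtain b a where p: "p = (b, a)" and ba: "b \<in> \<beta>" "a \<in> \<alpha>" by blast
  have ob: "a \<in> Ob C" "b \<in> Ob C" "x \<in> Ob C" "y \<in> Ob C"
    using ba x y orbits_subset \<alpha> \<beta> by auto
  have i: "inv\<^bsub>G\<^esub> s \<in> carrier G" using s group.inv_closed[OF G_group] by simp
  let ?b = "o_act C (inv\<^bsub>G\<^esub> s) b" and ?a = "o_act C (inv\<^bsub>G\<^esub> s) a"
  have ab': "?b \<in> \<beta>" "?a \<in> \<alpha>" using ba i orbits_o_act \<alpha> \<beta> by auto
  show "orbit_sum_act G C \<beta> \<alpha> s (sng \<beta> \<alpha> y x f) p =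
      sng \<beta> \<alpha> (o_act C s y) (o_act C s x) (m_act C s y x f) p"
  proof (cases "(b, a) = (o_act C s y, o_act C s x)")
    case True
    then show ?thesis
      using s ob ab' x y ba by (simp add: p o_act_inv_left orbit_sum_act_def orbit_single_def single_def)
  next
    case False
    then have "(?b, ?a) \<noteq> (y, x)" using s ob o_act_inv_right by auto
    then show ?thesis
      using False s ob ab' i m_act_zero[OF s o_act_closed[OF i ob(1)] o_act_closed[OF i ob(2)]]
      by (auto simp: p ba o_act_inv_right Let_def orbit_sum_act_def orbit_single_def single_def)
  qed
qed

lemma orbit_sum_act_hom:
  assumes \<alpha>: "\<alpha> \<in> Orbs" and \<beta>: "\<beta> \<in> Orbs" and s: "s \<in> carrier G"
  shows "orbit_sum_act G C \<beta> \<alpha> s \<in> module_hom k (orbit_sum C \<beta> \<alpha>) (orbit_sum C \<beta> \<alpha>)"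
proof -
  interpret F: module_family k "\<beta> \<times> \<alpha>" "\<lambda>(y, x). Mor C y x" by (rule orbit_family[OF \<alpha> \<beta>])
  let ?V = "orbit_sum C \<beta> \<alpha>" and ?t = "o_act C (inv\<^bsub>G\<^esub> s)" and ?\<rho> = "orbit_sum_act G C \<beta> \<alpha> s"
  have i: "inv\<^bsub>G\<^esub> s \<in> carrier G" using s group.inv_closed[OF G_group] by simp
  have ob: "?t x \<in> \<alpha>" "?t x \<in> Ob C" "o_act C s (?t x) = x" if "x \<in> \<alpha>" for x
    using that orbits_o_act[OF \<alpha> _ i] orbits_subset[OF \<alpha>] s by (auto simp: o_act_inv_right)
  have ob': "?t x \<in> \<beta>" "?t x \<in> Ob C" "o_act C s (?t x) = x" if "x \<in> \<beta>" for x
    using that orbits_o_act[OF \<beta> _ i] orbits_subset[OF \<beta>] s by (auto simp: o_act_inv_right)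
  have comp: "u (?t y, ?t x) \<in> carrier (Mor C (?t y) (?t x))"
    if "u \<in> carrier ?V" "y \<in> \<beta>" "x \<in> \<alpha>" for u y x
    using F.direct_sum_component[of u "(?t y, ?t x)"] that ob ob' by (auto simp: orbit_sum_def)
  have hom: "m_act C s (?t y) (?t x) \<in> module_hom k (Mor C (?t y) (?t x)) (Mor C y x)"
    if "y \<in> \<beta>" "x \<in> \<alpha>" for y x
    using m_act_linear[OF s ob(2)[OF that(2)] ob'(2)[OF that(1)]] ob(3) ob'(3) that by simp
  have act: "?\<rho> u = (\<lambda>p\<in>\<beta> \<times> \<alpha>. m_act C s (?t (fst p)) (?t (snd p)) (u (?t (fst p), ?t (snd p))))" for u
    unfolding orbit_sum_act_def by (intro restrict_ext) (auto simp: Let_def)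
  have "?\<rho> u \<in> carrier ?V" if u: "u \<in> carrier ?V" for u
  proof -
    let ?A = "{p \<in> \<beta> \<times> \<alpha>. u p \<noteq> \<zero>\<^bsub>case p of (y, x) \<Rightarrow> Mor C y x\<^esub>}"
    have A: "finite ?A" using F.direct_sum_support u by (simp add: orbit_sum_def)
    show ?thesis
      unfolding act orbit_sum_def
    \<comment> \<open>The support of s u is contained in the translate by s of the support of u,
      which is finite.\<close>
    proof (rule F.direct_sum_carrierI[of "(\<lambda>p. (o_act C s (fst p), o_act C s (snd p))) ` ?A"])
      show "finite ((\<lambda>p. (o_act C s (fst p), o_act C s (snd p))) ` ?A)" using A by simp
      show "(\<lambda>p. (o_act C s (fst p), o_act C s (snd p))) ` ?A \<subseteq> \<beta> \<times> \<alpha>"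
        using orbits_o_act \<alpha> \<beta> s by auto
      show "m_act C s (?t (fst p)) (?t (snd p)) (u (?t (fst p), ?t (snd p)))
             \<in> carrier (case p of (y, x) \<Rightarrow> Mor C y x)" if "p \<in> \<beta> \<times> \<alpha>" for p
        using module_hom_closed[OF hom comp[OF u]] that by auto
      show "m_act C s (?t (fst p)) (?t (snd p)) (u (?t (fst p), ?t (snd p))) =
             \<zero>\<^bsub>case p of (y, x) \<Rightarrow> Mor C y x\<^esub>"
        if p: "p \<in> \<beta> \<times> \<alpha> - (\<lambda>p. (o_act C s (fst p), o_act C s (snd p))) ` ?A" for p
      proof -
        obtain y x where yx: "p = (y, x)" "y \<in> \<beta>" "x \<in> \<alpha>" using p by auto
        have "(?t y, ?t x) \<notin> ?A"
        proof
          assume "(?t y, ?t x) \<in> ?A"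
          from imageI[OF this, of "\<lambda>p. (o_act C s (fst p), o_act C s (snd p))"]
          show False using p yx ob(3) ob'(3) by simp
        qed
        then have "u (?t y, ?t x) = \<zero>\<^bsub>Mor C (?t y) (?t x)\<^esub>" using yx ob ob' by auto
        then show ?thesis
          using yx m_act_zero[OF s ob(2)[OF yx(3)] ob'(2)[OF yx(2)]] ob(3) ob'(3) by simp
      qed
    qed
  qed
  moreover have "?\<rho> (u \<oplus>\<^bsub>?V\<^esub> v) = ?\<rho> u \<oplus>\<^bsub>?V\<^esub> ?\<rho> v" if "u \<in> carrier ?V" "v \<in> carrier ?V" for u v
    unfolding act orbit_sum_def F.direct_sum_add
    using module_hom_add[OF hom comp[OF that(1)] comp[OF that(2)]] ob ob'
    by (intro restrict_ext) auto
  moreover have "?\<rho> (a \<odot>\<^bsub>?V\<^esub> u) = a \<odot>\<^bsub>?V\<^esub> ?\<rho> u" if "a \<in> carrier k" "u \<in> carrier ?V" for a u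
    unfolding act orbit_sum_def F.direct_sum_smult
    using module_hom_smult[OF hom that(1) comp[OF that(2)]] ob ob'
    by (intro restrict_ext) auto
  ultimately show ?thesis by (auto simp: module_hom_def)
qed

lemma orbit_sum_kG_module:
  assumes \<alpha>: "\<alpha> \<in> Orbs" and \<beta>: "\<beta> \<in> Orbs"
  shows "kG_module k (orbit_sum C \<beta> \<alpha>) G (orbit_sum_act G C \<beta> \<alpha>)"
proof -
  have V: "abelian_group (orbit_sum C \<beta> \<alpha>)"
    using module_abelian_group[OF orbit_sum_module[OF \<alpha> \<beta>]] .
  have one: "\<one>\<^bsub>G\<^esub> \<in> carrier G" using monoid.one_closed[OF group.is_monoid[OF G_group]] .
  have "orbit_sum_act G C \<beta> \<alpha> \<one>\<^bsub>G\<^esub> u = u" if "u \<in> carrier (orbit_sum C \<beta> \<alpha>)" for u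
  proof (rule orbit_sum_hom_eqI[OF \<alpha> \<beta> _ _ _ that])
    show "abelian_group_hom (orbit_sum C \<beta> \<alpha>) (orbit_sum C \<beta> \<alpha>) (orbit_sum_act G C \<beta> \<alpha> \<one>\<^bsub>G\<^esub>)"
      using orbit_sum_module[OF \<alpha> \<beta>] orbit_sum_act_hom[OF \<alpha> \<beta> one]
      by (intro module_hom_abelian_group_hom)
    show "abelian_group_hom (orbit_sum C \<beta> \<alpha>) (orbit_sum C \<beta> \<alpha>) (\<lambda>u. u)"
      using V by (intro abelian_group_hom_intro) auto
    show "orbit_sum_act G C \<beta> \<alpha> \<one>\<^bsub>G\<^esub> (sng \<beta> \<alpha> y x f) = sng \<beta> \<alpha> y x f"
      if "y \<in> \<beta>" "x \<in> \<alpha>" "f \<in> carrier (Mor C y x)" for y x f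
      using orbit_sum_act_single[OF \<alpha> \<beta> one that(2,1,3)] that orbits_subset[OF \<alpha>] orbits_subset[OF \<beta>]
      by (simp add: o_act_one m_act_one)
  qed
  then show ?thesis
    using orbit_sum_act_hom[OF \<alpha> \<beta>] orbit_sum_module[OF \<alpha> \<beta>] G_group
    by (intro kG_module.intro kG_module_axioms.intro)
qed

section \<open>Classes in the morphism modules of the quotient\<close>

lemma orbit_class_hom:
  "\<lbrakk>\<alpha> \<in> Orbs; \<beta> \<in> Orbs\<rbrakk> \<Longrightarrow> cl \<beta> \<alpha> \<in> module_hom k (orbit_sum C \<beta> \<alpha>) (qm \<beta> \<alpha>)"
  using kG_module.cls_hom[OF orbit_sum_kG_module] unfolding orbit_class_def[abs_def] quotient_Mor_def .

lemma quotient_Mor_carrier: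
  "\<lbrakk>\<alpha> \<in> Orbs; \<beta> \<in> Orbs\<rbrakk> \<Longrightarrow> carrier (qm \<beta> \<alpha>) = cl \<beta> \<alpha> ` carrier (orbit_sum C \<beta> \<alpha>)"
  using kG_module.Q_carrier[OF orbit_sum_kG_module] unfolding orbit_class_def[abs_def] quotient_Mor_def .

lemma orbit_class_abelian_group_hom:
  "\<lbrakk>\<alpha> \<in> Orbs; \<beta> \<in> Orbs\<rbrakk> \<Longrightarrow> abelian_group_hom (orbit_sum C \<beta> \<alpha>) (qm \<beta> \<alpha>) (cl \<beta> \<alpha>)"
  using kG_module.cls_abelian_group_hom[OF orbit_sum_kG_module]
  unfolding orbit_class_def[abs_def] quotient_Mor_def .

lemma orbit_class_memD:
  assumes "\<alpha> \<in> Orbs" "\<beta> \<in> Orbs" "u \<in> carrier (orbit_sum C \<beta> \<alpha>)" "v \<in> cl \<beta> \<alpha> u"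
  shows "v \<in> carrier (orbit_sum C \<beta> \<alpha>)" "cl \<beta> \<alpha> v = cl \<beta> \<alpha> u"
  using kG_module.cls_memD[OF orbit_sum_kG_module[OF assms(1,2)] assms(3)] assms(4)
  unfolding orbit_class_def[abs_def] by auto

lemma orbit_class_self:
  "\<lbrakk>\<alpha> \<in> Orbs; \<beta> \<in> Orbs; u \<in> carrier (orbit_sum C \<beta> \<alpha>)\<rbrakk> \<Longrightarrow> u \<in> cl \<beta> \<alpha> u"
  using kG_module.cls_self[OF orbit_sum_kG_module] unfolding orbit_class_def .

lemma orbit_class_single_act:
  assumes "\<alpha> \<in> Orbs" "\<beta> \<in> Orbs" "s \<in> carrier G" "x \<in> \<alpha>" "y \<in> \<beta>" "f \<in> carrier (Mor C y x)"
  shows "cl \<beta> \<alpha> (sng \<beta> \<alpha> (o_act C s y) (o_act C s x) (m_act C s y x f)) = cl \<beta> \<alpha> (sng \<beta> \<alpha> y x f)"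
  unfolding orbit_sum_act_single[OF assms, symmetric] orbit_class_def
  using kG_module.cls_act[OF orbit_sum_kG_module[OF assms(1,2)] assms(3)]
    orbit_single_closed[OF assms(1,2,4,5,6)] .

text \<open>Invariance under s is itself an equality of two additive maps, namely of h composed with
  s and of h, so it may be tested on single summands. Composition in the quotient and the action on
  a descended module are both shown to be well defined in this way.\<close>

lemma orbit_hom_factors:
  assumes \<alpha>: "\<alpha> \<in> Orbs" and \<beta>: "\<beta> \<in> Orbs" and h: "abelian_group_hom (orbit_sum C \<beta> \<alpha>) W h"
    and inv: "\<And>s y x f. \<lbrakk>s \<in> carrier G; y \<in> \<beta>; x \<in> \<alpha>; f \<in> carrier (Mor C y x)\<rbrakk> \<Longrightarrow>
      h (sng \<beta> \<alpha> (o_act C s y) (o_act C s x) (m_act C s y x f)) = h (sng \<beta> \<alpha> y x f)"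
    and u: "u \<in> carrier (orbit_sum C \<beta> \<alpha>)" "v \<in> carrier (orbit_sum C \<beta> \<alpha>)" "cl \<beta> \<alpha> u = cl \<beta> \<alpha> v"
  shows "h u = h v"
proof (rule kG_module.hom_factors[OF orbit_sum_kG_module[OF \<alpha> \<beta>] h _ u[unfolded orbit_class_def]])
  fix s m assume s: "s \<in> carrier G" and m: "m \<in> carrier (orbit_sum C \<beta> \<alpha>)"
  show "h (orbit_sum_act G C \<beta> \<alpha> s m) = h m"
  proof (rule orbit_sum_hom_eqI[OF \<alpha> \<beta> _ h _ m])
    show "abelian_group_hom (orbit_sum C \<beta> \<alpha>) W (\<lambda>m. h (orbit_sum_act G C \<beta> \<alpha> s m))"
      using orbit_sum_module[OF \<alpha> \<beta>] orbit_sum_act_hom[OF \<alpha> \<beta> s]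
      by (intro abelian_group_hom_comp[OF module_hom_abelian_group_hom h])
  qed (use inv s orbit_sum_act_single[OF \<alpha> \<beta> s] in simp)
qed

text \<open>An instance of \<open>direct_sum_bilinear\<close>. On the summands (z, y') and (y, x)
  the biadditive map is the \<open>t\<close> below: f is first moved by the element that carries y
  to y', which makes it composable with g. The third claim is the rule [g][f] = [g (s f)] before
  classes are taken.\<close>

lemma
  assumes \<alpha>: "\<alpha> \<in> Orbs" and \<beta>: "\<beta> \<in> Orbs" and \<gamma>: "\<gamma> \<in> Orbs"
  shows orbit_sum_Cmp_hom_left: "u \<in> carrier (orbit_sum C \<beta> \<alpha>) \<Longrightarrow>
      abelian_group_hom (orbit_sum C \<gamma> \<beta>) (orbit_sum C \<gamma> \<alpha>) (\<lambda>v. orbit_sum_Cmp G C \<gamma> \<beta> \<alpha> v u)"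
    and orbit_sum_Cmp_hom_right: "v \<in> carrier (orbit_sum C \<gamma> \<beta>) \<Longrightarrow>
      abelian_group_hom (orbit_sum C \<beta> \<alpha>) (orbit_sum C \<gamma> \<alpha>) (orbit_sum_Cmp G C \<gamma> \<beta> \<alpha> v)"
    and orbit_sum_Cmp_single:
      "\<lbrakk>z \<in> \<gamma>; y' \<in> \<beta>; g \<in> carrier (Mor C z y'); y \<in> \<beta>; x \<in> \<alpha>; f \<in> carrier (Mor C y x)\<rbrakk> \<Longrightarrow>
       orbit_sum_Cmp G C \<gamma> \<beta> \<alpha> (sng \<gamma> \<beta> z y' g) (sng \<beta> \<alpha> y x f) =
         sng \<gamma> \<alpha> z (o_act C (transporter G C y y') x)
           (Cmp C z y' (o_act C (transporter G C y y') x) g (m_act C (transporter G C y y') y x f))"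
proof -
  define t where "t = (\<lambda>(z, y') (y, x) g f.
      sng \<gamma> \<alpha> z (o_act C (transporter G C y y') x)
        (Cmp C z y' (o_act C (transporter G C y y') x) g (m_act C (transporter G C y y') y x f)))"
  let ?M = "\<lambda>(y, x). Mor C y x"
  have Cmp_eq: "orbit_sum_Cmp G C \<gamma> \<beta> \<alpha> v u =
      finsum (orbit_sum C \<gamma> \<alpha>) (\<lambda>(i, j). t i j (v i) (u j))
        ({i \<in> \<gamma> \<times> \<beta>. v i \<noteq> \<zero>\<^bsub>?M i\<^esub>} \<times> {j \<in> \<beta> \<times> \<alpha>. u j \<noteq> \<zero>\<^bsub>?M j\<^esub>})" for v u
  proof -
    have "{(z, y'). z \<in> \<gamma> \<and> y' \<in> \<beta> \<and> v (z, y') \<noteq> \<zero>\<^bsub>Mor C z y'\<^esub>} = {i \<in> \<gamma> \<times> \<beta>. v i \<noteq> \<zero>\<^bsub>?M i\<^esub>}"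
      "{(y, x). y \<in> \<beta> \<and> x \<in> \<alpha> \<and> u (y, x) \<noteq> \<zero>\<^bsub>Mor C y x\<^esub>} = {j \<in> \<beta> \<times> \<alpha>. u j \<noteq> \<zero>\<^bsub>?M j\<^esub>}"
      by auto
    then show ?thesis
      unfolding orbit_sum_Cmp_def t_def by (simp add: Let_def split_def)
  qed
  have tr: "transporter G C y y' \<in> carrier G" "o_act C (transporter G C y y') y = y'"
    "o_act C (transporter G C y y') x \<in> \<alpha>" "o_act C (transporter G C y y') x \<in> Ob C"
    if "y \<in> \<beta>" "y' \<in> \<beta>" "x \<in> \<alpha>" for y y' x
    using transporter_props[OF \<beta> that(1,2)] orbits_o_act[OF \<alpha> that(3)] orbits_subset[OF \<alpha>] by auto
  have m_hom: "m_act C (transporter G C y y') y x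
      \<in> module_hom k (Mor C y x) (Mor C y' (o_act C (transporter G C y y') x))"
    if "y \<in> \<beta>" "y' \<in> \<beta>" "x \<in> \<alpha>" for y y' x
    using m_act_linear[OF tr(1)[OF that] orbits_subset[OF \<alpha> that(3)] orbits_subset[OF \<beta> that(1)]]
      tr(2)[OF that] by simp
  have W: "abelian_group (orbit_sum C \<gamma> \<alpha>)"
    using module_abelian_group[OF orbit_sum_module[OF \<alpha> \<gamma>]] .
  have sng_hom: "abelian_group_hom (Mor C z x) (orbit_sum C \<gamma> \<alpha>) (sng \<gamma> \<alpha> z x)"
    if "z \<in> \<gamma>" "x \<in> \<alpha>" for z x
    using that \<alpha> \<gamma> by (intro module_hom_abelian_group_hom[of k] orbit_single_hom Mor_module
        orbit_sum_module) (auto intro: orbits_subset)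
  have tl: "abelian_group_hom (?M i) (orbit_sum C \<gamma> \<alpha>) (\<lambda>m. t i j m n)"
    if ij: "i \<in> \<gamma> \<times> \<beta>" "j \<in> \<beta> \<times> \<alpha>" "n \<in> carrier (?M j)" for i j n
  proof -
    obtain z y' y x where ij_eq: "i = (z, y')" "j = (y, x)" by (cases i, cases j) auto
    have zy: "z \<in> \<gamma>" "y' \<in> \<beta>" "y \<in> \<beta>" "x \<in> \<alpha>" and n: "n \<in> carrier (Mor C y x)"
      using ij ij_eq by auto
    let ?x = "o_act C (transporter G C y y') x"
    have ob: "z \<in> Ob C" "y' \<in> Ob C" "?x \<in> Ob C"
      using orbits_subset[OF \<gamma> zy(1)] orbits_subset[OF \<beta> zy(2)] tr(4)[OF zy(3,2,4)] by simp_all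
    have "(\<lambda>g. Cmp C z y' ?x g (m_act C (transporter G C y y') y x n))
        \<in> module_hom k (Mor C z y') (Mor C z ?x)"
      using ob module_hom_closed[OF m_hom n] zy by (intro Cmp_linear_left)
    then have "abelian_group_hom (Mor C z y') (Mor C z ?x)
        (\<lambda>g. Cmp C z y' ?x g (m_act C (transporter G C y y') y x n))"
      using ob by (intro module_hom_abelian_group_hom[of k] Mor_module)
    from abelian_group_hom_comp[OF this sng_hom[OF zy(1) tr(3)[OF zy(3,2,4)]]]
    show ?thesis by (simp add: ij_eq t_def)
  qed
  have tr': "abelian_group_hom (?M j) (orbit_sum C \<gamma> \<alpha>) (t i j m)"
    if ij: "i \<in> \<gamma> \<times> \<beta>" "j \<in> \<beta> \<times> \<alpha>" "m \<in> carrier (?M i)" for i j m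
  proof -
    obtain z y' y x where ij_eq: "i = (z, y')" "j = (y, x)" by (cases i, cases j) auto
    have zy: "z \<in> \<gamma>" "y' \<in> \<beta>" "y \<in> \<beta>" "x \<in> \<alpha>" and m: "m \<in> carrier (Mor C z y')"
      using ij ij_eq by auto
    let ?x = "o_act C (transporter G C y y') x"
    have ob: "z \<in> Ob C" "y' \<in> Ob C" "?x \<in> Ob C" "y \<in> Ob C" "x \<in> Ob C"
      using orbits_subset[OF \<gamma> zy(1)] orbits_subset[OF \<beta> zy(2)] tr(4)[OF zy(3,2,4)]
        orbits_subset[OF \<beta> zy(3)] orbits_subset[OF \<alpha> zy(4)] by simp_all
    have 1: "abelian_group_hom (Mor C y x) (Mor C y' ?x) (m_act C (transporter G C y y') y x)"
      using ob zy by (intro module_hom_abelian_group_hom[of k] Mor_module m_hom)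
    have 2: "abelian_group_hom (Mor C y' ?x) (Mor C z ?x) (Cmp C z y' ?x m)"
      using ob m by (intro module_hom_abelian_group_hom[of k] Mor_module Cmp_linear_right)
    from abelian_group_hom_comp[OF abelian_group_hom_comp[OF 1 2] sng_hom[OF zy(1) tr(3)[OF zy(3,2,4)]]]
    show ?thesis by (simp add: ij_eq t_def)
  qed
  note bil = direct_sum_bilinear[OF orbit_family[OF \<beta> \<gamma>] orbit_family[OF \<alpha> \<beta>] W tl tr']
  show "abelian_group_hom (orbit_sum C \<gamma> \<beta>) (orbit_sum C \<gamma> \<alpha>) (\<lambda>v. orbit_sum_Cmp G C \<gamma> \<beta> \<alpha> v u)"
    if "u \<in> carrier (orbit_sum C \<beta> \<alpha>)"
    using bil(1) that unfolding Cmp_eq orbit_sum_def by blast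
  show "abelian_group_hom (orbit_sum C \<beta> \<alpha>) (orbit_sum C \<gamma> \<alpha>) (orbit_sum_Cmp G C \<gamma> \<beta> \<alpha> v)"
    if "v \<in> carrier (orbit_sum C \<gamma> \<beta>)"
    using bil(2) that unfolding Cmp_eq[abs_def] orbit_sum_def by blast
  show "orbit_sum_Cmp G C \<gamma> \<beta> \<alpha> (sng \<gamma> \<beta> z y' g) (sng \<beta> \<alpha> y x f) =
         sng \<gamma> \<alpha> z (o_act C (transporter G C y y') x)
           (Cmp C z y' (o_act C (transporter G C y y') x) g (m_act C (transporter G C y y') y x f))"
    if "z \<in> \<gamma>" "y' \<in> \<beta>" "g \<in> carrier (Mor C z y')" "y \<in> \<beta>" "x \<in> \<alpha>" "f \<in> carrier (Mor C y x)"
    using bil(3)[of "(z, y')" "(y, x)" g f] that unfolding Cmp_eq orbit_single_def by (simp add: t_def orbit_single_def)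
qed

section \<open>Composites and identities of the quotient category\<close>

abbreviation "B \<equiv> quotient_category k G C"
abbreviation "cov \<equiv> on_mor (galois_covering k G C)"

lemma B_simps: "Ob B = Orbs" "Mor B = qm"
  by (simp_all add: quotient_category_def)

lemma orbit_sum_Cmp_closed:
  assumes "\<alpha> \<in> Orbs" "\<beta> \<in> Orbs" "\<gamma> \<in> Orbs"
    and "u \<in> carrier (orbit_sum C \<beta> \<alpha>)" "v \<in> carrier (orbit_sum C \<gamma> \<beta>)"
  shows "orbit_sum_Cmp G C \<gamma> \<beta> \<alpha> v u \<in> carrier (orbit_sum C \<gamma> \<alpha>)"
  using abelian_group_hom.hom_closed[OF orbit_sum_Cmp_hom_right[OF assms(1-3,5)] assms(4)] .

text \<open>
  Both arguments are handled by additivity: a map that is additive in one argument factors through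
  the coinvariants as soon as it is invariant on elements supported in a single summand, and this
  invariance may in turn be tested on such elements of the other argument.
\<close>

lemma orbit_class_Cmp_cong:
  assumes \<alpha>: "\<alpha> \<in> Orbs" and \<beta>: "\<beta> \<in> Orbs" and \<gamma>: "\<gamma> \<in> Orbs"
    and u: "u \<in> carrier (orbit_sum C \<beta> \<alpha>)" "u' \<in> carrier (orbit_sum C \<beta> \<alpha>)" "cl \<beta> \<alpha> u = cl \<beta> \<alpha> u'"
    and v: "v \<in> carrier (orbit_sum C \<gamma> \<beta>)" "v' \<in> carrier (orbit_sum C \<gamma> \<beta>)" "cl \<gamma> \<beta> v = cl \<gamma> \<beta> v'"
  shows "cl \<gamma> \<alpha> (orbit_sum_Cmp G C \<gamma> \<beta> \<alpha> v u) = cl \<gamma> \<alpha> (orbit_sum_Cmp G C \<gamma> \<beta> \<alpha> v' u')"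
proof -
  note hom_l = abelian_group_hom_comp[OF orbit_sum_Cmp_hom_left[OF \<alpha> \<beta> \<gamma>]
      orbit_class_abelian_group_hom[OF \<alpha> \<gamma>]]
  note hom_r = abelian_group_hom_comp[OF orbit_sum_Cmp_hom_right[OF \<alpha> \<beta> \<gamma>]
      orbit_class_abelian_group_hom[OF \<alpha> \<gamma>]]
  note sng_ba = orbit_single_closed[OF \<alpha> \<beta>] and sng_cb = orbit_single_closed[OF \<beta> \<gamma>]
  note ob = orbits_subset[OF \<alpha>] orbits_subset[OF \<beta>] orbits_subset[OF \<gamma>]
  have "cl \<gamma> \<alpha> (orbit_sum_Cmp G C \<gamma> \<beta> \<alpha> v u) = cl \<gamma> \<alpha> (orbit_sum_Cmp G C \<gamma> \<beta> \<alpha> v u')"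
  proof (rule orbit_hom_factors[OF \<alpha> \<beta> hom_r[OF v(1)] _ u])
    fix s y x f assume s: "s \<in> carrier G" and yx: "y \<in> \<beta>" "x \<in> \<alpha>" and f: "f \<in> carrier (Mor C y x)"
    have syx: "o_act C s y \<in> \<beta>" "o_act C s x \<in> \<alpha>"
      using orbits_o_act \<alpha> \<beta> yx s by auto
    have sf: "m_act C s y x f \<in> carrier (Mor C (o_act C s y) (o_act C s x))"
      using m_act_closed[OF s ob(1)[OF yx(2)] ob(2)[OF yx(1)] f] .
    show "cl \<gamma> \<alpha> (orbit_sum_Cmp G C \<gamma> \<beta> \<alpha> v (sng \<beta> \<alpha> (o_act C s y) (o_act C s x) (m_act C s y x f))) =
          cl \<gamma> \<alpha> (orbit_sum_Cmp G C \<gamma> \<beta> \<alpha> v (sng \<beta> \<alpha> y x f))"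
    proof (rule orbit_sum_hom_eqI[OF \<beta> \<gamma> hom_l[OF sng_ba[OF syx(2,1) sf]] hom_l[OF sng_ba[OF yx(2,1) f]] _ v(1)])
      fix z y' g assume z: "z \<in> \<gamma>" and y': "y' \<in> \<beta>" and g: "g \<in> carrier (Mor C z y')"
      let ?t = "transporter G C (o_act C s y) y'"
      have t: "?t \<in> carrier G" "o_act C ?t (o_act C s y) = y'"
        using transporter_props[OF \<beta> syx(1) y'] .
      have ts: "?t \<otimes>\<^bsub>G\<^esub> s \<in> carrier G"
        using t s monoid.m_closed[OF group.is_monoid[OF G_group]] by simp
      \<comment> \<open>If t carries s y to y', then t s carries y to y'. Since t (s f) = (t s) f,
        moving the right factor does not change the composite even before passing to
        classes.\<close>
      have "transporter G C y y' = ?t \<otimes>\<^bsub>G\<^esub> s"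
        using transporter_o_act[OF ts ob(2)[OF yx(1)]] composition_rule[OF ob(2)[OF yx(1)] t(1) s] t(2)
        by simp
      then show "cl \<gamma> \<alpha> (orbit_sum_Cmp G C \<gamma> \<beta> \<alpha> (sng \<gamma> \<beta> z y' g)
                   (sng \<beta> \<alpha> (o_act C s y) (o_act C s x) (m_act C s y x f))) =
            cl \<gamma> \<alpha> (orbit_sum_Cmp G C \<gamma> \<beta> \<alpha> (sng \<gamma> \<beta> z y' g) (sng \<beta> \<alpha> y x f))"
        using orbit_sum_Cmp_single[OF \<alpha> \<beta> \<gamma> z y' g syx sf] orbit_sum_Cmp_single[OF \<alpha> \<beta> \<gamma> z y' g yx f]
          composition_rule[OF ob(1)[OF yx(2)] t(1) s]
          m_act_mult[OF s t(1) ob(1)[OF yx(2)] ob(2)[OF yx(1)] f] by simp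
    qed
  qed
  also have "\<dots> = cl \<gamma> \<alpha> (orbit_sum_Cmp G C \<gamma> \<beta> \<alpha> v' u')"
  proof (rule orbit_hom_factors[OF \<beta> \<gamma> hom_l[OF u(2)] _ v])
    fix s z y' g assume s: "s \<in> carrier G" and zy: "z \<in> \<gamma>" "y' \<in> \<beta>" and g: "g \<in> carrier (Mor C z y')"
    have szy: "o_act C s z \<in> \<gamma>" "o_act C s y' \<in> \<beta>"
      using orbits_o_act \<gamma> \<beta> zy s by auto
    have sg: "m_act C s z y' g \<in> carrier (Mor C (o_act C s z) (o_act C s y'))"
      using m_act_closed[OF s ob(2)[OF zy(2)] ob(3)[OF zy(1)] g] .
    show "cl \<gamma> \<alpha> (orbit_sum_Cmp G C \<gamma> \<beta> \<alpha> (sng \<gamma> \<beta> (o_act C s z) (o_act C s y') (m_act C s z y' g)) u') =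
          cl \<gamma> \<alpha> (orbit_sum_Cmp G C \<gamma> \<beta> \<alpha> (sng \<gamma> \<beta> z y' g) u')"
    proof (rule orbit_sum_hom_eqI[OF \<alpha> \<beta> hom_r[OF sng_cb[OF szy(2,1) sg]] hom_r[OF sng_cb[OF zy(2,1) g]] _ u(2)])
      fix y x f assume yx: "y \<in> \<beta>" "x \<in> \<alpha>" and f: "f \<in> carrier (Mor C y x)"
      let ?t = "transporter G C y y'"
      let ?x = "o_act C ?t x" and ?f = "m_act C ?t y x f"
      have t: "?t \<in> carrier G" "o_act C ?t y = y'"
        using transporter_props[OF \<beta> yx(1) zy(2)] .
      have st: "s \<otimes>\<^bsub>G\<^esub> ?t \<in> carrier G"
        using t s monoid.m_closed[OF group.is_monoid[OF G_group]] by simp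
      have tr: "transporter G C y (o_act C s y') = s \<otimes>\<^bsub>G\<^esub> ?t"
        using transporter_o_act[OF st ob(2)[OF yx(1)]] composition_rule[OF ob(2)[OF yx(1)] s t(1)] t(2)
        by simp
      have x': "?x \<in> \<alpha>" using orbits_o_act[OF \<alpha> yx(2) t(1)] .
      have f': "?f \<in> carrier (Mor C y' ?x)"
        using m_act_closed[OF t(1) ob(1)[OF yx(2)] ob(2)[OF yx(1)] f] t(2) by simp
      \<comment> \<open>Moving the left factor is different: the transporter becomes s t, and (s g)
        ((s t) f) = s (g (t f)). The new composite is the translate of the old one by s, and the two
        are identified by taking classes.\<close>
      have "orbit_sum_Cmp G C \<gamma> \<beta> \<alpha> (sng \<gamma> \<beta> (o_act C s z) (o_act C s y') (m_act C s z y' g)) (sng \<beta> \<alpha> y x f)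
        = sng \<gamma> \<alpha> (o_act C s z) (o_act C s ?x) (m_act C s z ?x (Cmp C z y' ?x g ?f))"
        using orbit_sum_Cmp_single[OF \<alpha> \<beta> \<gamma> szy sg yx f] tr composition_rule[OF ob(1)[OF yx(2)] s t(1)]
          m_act_mult[OF t(1) s ob(1)[OF yx(2)] ob(2)[OF yx(1)] f] t(2)
          m_act_Cmp[OF s ob(1)[OF x'] ob(2)[OF zy(2)] ob(3)[OF zy(1)] f' g] by simp
      then show "cl \<gamma> \<alpha> (orbit_sum_Cmp G C \<gamma> \<beta> \<alpha> (sng \<gamma> \<beta> (o_act C s z) (o_act C s y') (m_act C s z y' g))
                   (sng \<beta> \<alpha> y x f)) =
            cl \<gamma> \<alpha> (orbit_sum_Cmp G C \<gamma> \<beta> \<alpha> (sng \<gamma> \<beta> z y' g) (sng \<beta> \<alpha> y x f))"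
        using orbit_sum_Cmp_single[OF \<alpha> \<beta> \<gamma> zy g yx f]
          orbit_class_single_act[OF \<alpha> \<gamma> s x' zy(1) Cmp_closed[OF ob(1)[OF x'] ob(2)[OF zy(2)] ob(3)[OF zy(1)] f' g]]
        by simp
    qed
  qed
  finally show ?thesis .
qed

text \<open>By \<open>orbit_class_Cmp_cong\<close> the double union in the definition consists of
  copies of one class, and its index sets are nonempty because a class contains its
  representative.\<close>

lemma quotient_Cmp:
  assumes \<alpha>: "\<alpha> \<in> Orbs" and \<beta>: "\<beta> \<in> Orbs" and \<gamma>: "\<gamma> \<in> Orbs"
    and u: "u \<in> carrier (orbit_sum C \<beta> \<alpha>)" and v: "v \<in> carrier (orbit_sum C \<gamma> \<beta>)"
  shows "Cmp B \<gamma> \<beta> \<alpha> (cl \<gamma> \<beta> v) (cl \<beta> \<alpha> u) = cl \<gamma> \<alpha> (orbit_sum_Cmp G C \<gamma> \<beta> \<alpha> v u)"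
proof -
  have "(\<Union>v'\<in>cl \<gamma> \<beta> v. \<Union>u'\<in>cl \<beta> \<alpha> u. cl \<gamma> \<alpha> (orbit_sum_Cmp G C \<gamma> \<beta> \<alpha> v' u')) =
        (\<Union>v'\<in>cl \<gamma> \<beta> v. \<Union>u'\<in>cl \<beta> \<alpha> u. cl \<gamma> \<alpha> (orbit_sum_Cmp G C \<gamma> \<beta> \<alpha> v u))"
    using orbit_class_memD[OF \<alpha> \<beta> u] orbit_class_memD[OF \<beta> \<gamma> v] u v
    by (intro SUP_cong refl orbit_class_Cmp_cong[OF \<alpha> \<beta> \<gamma>]) blast+
  also have "\<dots> = cl \<gamma> \<alpha> (orbit_sum_Cmp G C \<gamma> \<beta> \<alpha> v u)"
    using orbit_class_self[OF \<alpha> \<beta> u] orbit_class_self[OF \<beta> \<gamma> v] by blast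
  finally show ?thesis by (simp add: quotient_category_def)
qed

text \<open>The axioms of a G-category do not mention identities. Let i be s^-1 applied to the
  identity of s x. Then s i is that identity, and s 1 = (s 1)(s i) = s (1 i) = s i, where 1 is the
  identity of x.\<close>

lemma m_act_Idn:
  assumes s: "s \<in> carrier G" and x: "x \<in> Ob C"
  shows "m_act C s x x (Idn C x) = Idn C (o_act C s x)"
proof -
  let ?y = "o_act C s x"
  let ?i = "m_act C (inv\<^bsub>G\<^esub> s) ?y ?y (Idn C ?y)"
  have y: "?y \<in> Ob C" and i: "inv\<^bsub>G\<^esub> s \<in> carrier G"
    using s x o_act_closed group.inv_closed[OF G_group] by auto
  have ic: "?i \<in> carrier (Mor C x x)"
    using m_act_closed[OF i y y Idn_closed[OF y]] s x by (simp add: o_act_inv_left)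
  have e: "m_act C s x x (Idn C x) \<in> carrier (Mor C ?y ?y)"
    using m_act_closed[OF s x x Idn_closed[OF x]] .
  have si: "m_act C s x x ?i = Idn C ?y"
    using m_act_inv_right[OF s y y Idn_closed[OF y]] s x by (simp add: o_act_inv_left)
  have "m_act C s x x (Idn C x) = Cmp C ?y ?y ?y (m_act C s x x (Idn C x)) (m_act C s x x ?i)"
    using e y by (simp add: si Cmp_Idn_right)
  also have "\<dots> = m_act C s x x (Cmp C x x x (Idn C x) ?i)"
    using m_act_Cmp[OF s x x x ic Idn_closed[OF x]] by simp
  also have "\<dots> = Idn C ?y" using x ic by (simp add: Cmp_Idn_left si)
  finally show ?thesis .
qed

text \<open>Two points of an orbit differ by some s, which maps the identity of one to the identity
  of the other. All members of the union that defines \<open>Idn\<close> are therefore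
  equal.\<close>

lemma quotient_Idn:
  assumes \<alpha>: "\<alpha> \<in> Orbs" and x: "x \<in> \<alpha>"
  shows "Idn B \<alpha> = cl \<alpha> \<alpha> (sng \<alpha> \<alpha> x x (Idn C x))"
proof -
  have "cl \<alpha> \<alpha> (sng \<alpha> \<alpha> y y (Idn C y)) = cl \<alpha> \<alpha> (sng \<alpha> \<alpha> x x (Idn C x))" if y: "y \<in> \<alpha>" for y
  proof -
    have xC: "x \<in> Ob C" using orbits_subset[OF \<alpha> x] .
    obtain s where s: "s \<in> carrier G" "y = o_act C s x" using orbits_transitive[OF \<alpha> x y] by blast
    show ?thesis
      using orbit_class_single_act[OF \<alpha> \<alpha> s(1) x x Idn_closed[OF xC]]
      by (simp add: s(2) m_act_Idn[OF s(1) xC])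
  qed
  then have "(\<Union>y\<in>\<alpha>. cl \<alpha> \<alpha> (sng \<alpha> \<alpha> y y (Idn C y))) = (\<Union>y\<in>\<alpha>. cl \<alpha> \<alpha> (sng \<alpha> \<alpha> x x (Idn C x)))"
    by (intro SUP_cong refl)
  then show ?thesis using x by (auto simp: quotient_category_def)
qed

section \<open>The covering as a k-linear functor that is invariant under the group\<close>

lemma cov_eq: "cov y x f = cl (orb y) (orb x) (sng (orb y) (orb x) y x f)"
  by (simp add: galois_covering_def Let_def)

lemma cov_hom:
  assumes "x \<in> Ob C" "y \<in> Ob C"
  shows "cov y x \<in> module_hom k (Mor C y x) (qm (orb y) (orb x))"
  unfolding cov_eq[abs_def] using assms
  by (intro module_hom_comp[OF orbit_single_hom orbit_class_hom] orbit_in_orbits orbit_refl)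

text \<open>For morphisms that are already composable the source of g is the target of f, so the
  transporter is the identity element and f is not moved.\<close>

lemma cov_Cmp:
  assumes ob: "x \<in> Ob C" "y \<in> Ob C" "z \<in> Ob C"
    and f: "f \<in> carrier (Mor C y x)" and g: "g \<in> carrier (Mor C z y)"
  shows "cov z x (Cmp C z y x g f) = Cmp B (orb z) (orb y) (orb x) (cov z y g) (cov y x f)"
proof -
  note orbs = ob[THEN orbit_in_orbits] and refl = ob[THEN orbit_refl]
  have "\<one>\<^bsub>G\<^esub> \<in> carrier G" using monoid.one_closed[OF group.is_monoid[OF G_group]] .
  from transporter_o_act[OF this ob(2)] have "transporter G C y y = \<one>\<^bsub>G\<^esub>"
    using o_act_one[OF ob(2)] by simp
  then show ?thesis
    using quotient_Cmp[OF orbs orbit_single_closed[OF orbs(1,2) refl(1,2) f]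
        orbit_single_closed[OF orbs(2,3) refl(2,3) g]]
      orbit_sum_Cmp_single[OF orbs refl(3,2) g refl(2,1) f] ob f
    by (simp add: cov_eq o_act_one m_act_one)
qed

lemma cov_Idn: "x \<in> Ob C \<Longrightarrow> cov x x (Idn C x) = Idn B (orb x)"
  unfolding cov_eq by (rule quotient_Idn[symmetric]) (auto intro: orbit_in_orbits orbit_refl)

lemma cov_m_act:
  assumes "s \<in> carrier G" "x \<in> Ob C" "y \<in> Ob C" "f \<in> carrier (Mor C y x)"
  shows "cov (o_act C s y) (o_act C s x) (m_act C s y x f) = cov y x f"
  using assms orbit_class_single_act[of "orb x" "orb y" s x y f]
  by (simp add: cov_eq orbit_o_act orbit_in_orbits orbit_refl)

end

subsection \<open>Categories of modules\<close>

lemma left_module_act_closed: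
  assumes "left_module k C M" "x \<in> Ob C" "y \<in> Ob C" "c \<in> carrier (Mor C y x)" "m \<in> carrier (space M x)"
  shows "act M y x c m \<in> carrier (space M y)"
  using module_hom_closed[OF left_module.act_linear_right[OF assms(1-4)] assms(5)] .

lemma left_module_space:
  assumes "left_module k C M" "x \<in> Ob C" shows "module k (space M x)"
  using left_module.space_module[OF assms] by (simp add: strict_module_def)

lemma natural_transformationsD:
  assumes "\<phi> \<in> natural_transformations k C N M"
  shows "\<phi> \<in> extensional (Ob C)"
    and "x \<in> Ob C \<Longrightarrow> \<phi> x \<in> module_hom k (space M x) (space N x)"
    and "x \<in> Ob C \<Longrightarrow> \<phi> x \<in> extensional (carrier (space M x))"
    and "\<lbrakk>x \<in> Ob C; y \<in> Ob C; c \<in> carrier (Mor C y x); m \<in> carrier (space M x)\<rbrakk> \<Longrightarrow>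
           \<phi> y (act M y x c m) = act N y x c (\<phi> x m)"
  using assms by (auto simp: natural_transformations_def PiE_iff)

lemma natural_transformationsI:
  assumes "\<phi> \<in> extensional (Ob C)"
    and "\<And>x. x \<in> Ob C \<Longrightarrow> \<phi> x \<in> module_hom k (space M x) (space N x)"
    and "\<And>x. x \<in> Ob C \<Longrightarrow> \<phi> x \<in> extensional (carrier (space M x))"
    and "\<And>x y c m. \<lbrakk>x \<in> Ob C; y \<in> Ob C; c \<in> carrier (Mor C y x); m \<in> carrier (space M x)\<rbrakk> \<Longrightarrow>
           \<phi> y (act M y x c m) = act N y x c (\<phi> x m)"
  shows "\<phi> \<in> natural_transformations k C N M"
  using assms by (auto simp: natural_transformations_def PiE_iff)

text \<open>All structure is pointwise, and the care goes into the extensional encoding: families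
  and their components are \<open>undefined\<close> off their domains, so that equality of
  transformations is equality of functions.\<close>

lemma module_category_is_cat:
  fixes C :: "('o, 'a, 'k, 'c) k_category_scheme"
  shows "is_cat (module_category k C :: (('o, 'a, 'k, 'm) c_module, 'o \<Rightarrow> 'm \<Rightarrow> 'm) cat)"
proof
  fix M assume "M \<in> obj (module_category k C)"
  then interpret M: left_module k C M by (simp add: module_category_def)
  have mod: "x \<in> Ob C \<Longrightarrow> module k (space M x)" for x
    using M.space_module by (simp add: strict_module_def)
  have "(\<lambda>x\<in>Ob C. \<lambda>m\<in>carrier (space M x). m) \<in> natural_transformations k C M M"
  proof (rule natural_transformationsI)
    fix x assume x: "x \<in> Ob C"
    show "(\<lambda>x\<in>Ob C. \<lambda>m\<in>carrier (space M x). m) x \<in> module_hom k (space M x) (space M x)"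
      by (rule module_hom_cong[OF mod[OF x], of "\<lambda>m. m"]) (use x in \<open>auto simp: module_hom_def\<close>)
    show "(\<lambda>x\<in>Ob C. \<lambda>m\<in>carrier (space M x). m) x \<in> extensional (carrier (space M x))"
      using x by simp
  qed (use module_hom_closed[OF M.act_linear_right] in simp_all)
  then show "idn (module_category k C) M \<in> arr (module_category k C) M M"
    by (simp add: module_category_def)
next
  fix Q R S :: "('o, 'a, 'k, 'm) c_module" and f g :: "'o \<Rightarrow> 'm \<Rightarrow> 'm"
  assume "f \<in> arr (module_category k C) R Q" "g \<in> arr (module_category k C) S R"
    and obj: "Q \<in> obj (module_category k C)"
  then have f: "f \<in> natural_transformations k C R Q" and g: "g \<in> natural_transformations k C S R"
    by (auto simp: module_category_def)
  interpret Q: left_module k C Q using obj by (simp add: module_category_def)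
  have mod: "x \<in> Ob C \<Longrightarrow> module k (space Q x)" for x
    using Q.space_module by (simp add: strict_module_def)
  have "(\<lambda>x\<in>Ob C. compose (carrier (space Q x)) (g x) (f x)) \<in> natural_transformations k C S Q"
  proof (rule natural_transformationsI)
    fix x assume x: "x \<in> Ob C"
    have "(\<lambda>m. g x (f x m)) \<in> module_hom k (space Q x) (space S x)"
      by (rule module_hom_comp[OF natural_transformationsD(2)[OF f x] natural_transformationsD(2)[OF g x]])
    from mod[OF x] this show "(\<lambda>x\<in>Ob C. compose (carrier (space Q x)) (g x) (f x)) x \<in> module_hom k (space Q x) (space S x)"
      by (rule module_hom_cong) (use x in \<open>auto simp: compose_def\<close>)
  next
    fix x y c m assume x: "x \<in> Ob C" and y: "y \<in> Ob C" and c: "c \<in> carrier (Mor C y x)"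
      and m: "m \<in> carrier (space Q x)"
    have "act Q y x c m \<in> carrier (space Q y)" "f x m \<in> carrier (space R x)"
      using module_hom_closed[OF Q.act_linear_right[OF x y c] m]
        module_hom_closed[OF natural_transformationsD(2)[OF f x] m] .
    then show "(\<lambda>x\<in>Ob C. compose (carrier (space Q x)) (g x) (f x)) y (act Q y x c m) =
        act S y x c ((\<lambda>x\<in>Ob C. compose (carrier (space Q x)) (g x) (f x)) x m)"
      using x y m natural_transformationsD(4)[OF f x y c m] natural_transformationsD(4)[OF g x y c]
      by (simp add: compose_def)
  qed (auto simp: compose_def)
  then show "cmp (module_category k C) S R Q g f \<in> arr (module_category k C) S Q"
    by (simp add: module_category_def)
next
  fix P Q R S :: "('o, 'a, 'k, 'm) c_module" and f g h :: "'o \<Rightarrow> 'm \<Rightarrow> 'm"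
  assume "f \<in> arr (module_category k C) Q P"
  then have f: "f \<in> natural_transformations k C Q P" by (simp add: module_category_def)
  have "compose (carrier (space P x)) (compose (carrier (space Q x)) (h x) (g x)) (f x) =
      compose (carrier (space P x)) (h x) (compose (carrier (space P x)) (g x) (f x))"
    if x: "x \<in> Ob C" for x
    using module_hom_closed[OF natural_transformationsD(2)[OF f x]]
    by (auto simp: compose_def intro!: restrict_ext)
  then show "cmp (module_category k C) S Q P (cmp (module_category k C) S R Q h g) f =
      cmp (module_category k C) S R P h (cmp (module_category k C) R Q P g f)"
    by (auto simp: module_category_def intro!: restrict_ext)
next
  fix Q R :: "('o, 'a, 'k, 'm) c_module" and f :: "'o \<Rightarrow> 'm \<Rightarrow> 'm"
  assume "f \<in> arr (module_category k C) R Q"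
  then have f: "f \<in> natural_transformations k C R Q" by (simp add: module_category_def)
  note closed = module_hom_closed[OF natural_transformationsD(2)[OF f]]
    and ext = extensional_arb[OF natural_transformationsD(3)[OF f]]
    and ext' = extensional_arb[OF natural_transformationsD(1)[OF f]]
  show "cmp (module_category k C) R R Q (idn (module_category k C) R) f = f"
    using closed ext ext' by (auto simp: module_category_def compose_def restrict_def fun_eq_iff)
  show "cmp (module_category k C) R Q Q f (idn (module_category k C) Q) = f"
    using closed ext ext' by (auto simp: module_category_def compose_def restrict_def fun_eq_iff)
qed

section \<open>Fixed modules and fixed transformations\<close>

lemma twist_transformation_fixedD:
  assumes "twist_transformation G C (inv\<^bsub>G\<^esub> s) \<phi> = \<phi>" "group G" "s \<in> carrier G" "x \<in> Ob C"
  shows "\<phi> (o_act C s x) = \<phi> x"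
  using fun_cong[OF assms(1), of x] assms by (simp add: twist_transformation_def group.inv_inv)

context free_G_category_over
begin

text \<open>The twist by t evaluates at t^-1 x, so invariance under s^-1 is what yields equations at
  s x. The second equation relies on the first, by which \<open>m\<close> also lies in the module at
  s x.\<close>

lemma twist_module_fixedD:
  assumes "twist_module G C (inv\<^bsub>G\<^esub> s) M = M" "s \<in> carrier G"
  shows "x \<in> Ob C \<Longrightarrow> space M (o_act C s x) = space M x"
    and "\<lbrakk>x \<in> Ob C; y \<in> Ob C; c \<in> carrier (Mor C y x); m \<in> carrier (space M x)\<rbrakk> \<Longrightarrow>
      act M (o_act C s y) (o_act C s x) (m_act C s y x c) m = act M y x c m"
proof -
  have sp: "space M x = space (twist_module G C (inv\<^bsub>G\<^esub> s) M) x" for x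
    using assms(1) by simp
  have act: "act M y x c m = act (twist_module G C (inv\<^bsub>G\<^esub> s) M) y x c m" for x y c m
    using assms(1) by simp
  have ii: "inv\<^bsub>G\<^esub> (inv\<^bsub>G\<^esub> s) = s" using assms(2) group.inv_inv[OF G_group] by simp
  show sp': "space M (o_act C s x) = space M x" if "x \<in> Ob C" for x
    unfolding sp[of x] using that by (simp add: twist_module_def Let_def ii)
  show "act M (o_act C s y) (o_act C s x) (m_act C s y x c) m = act M y x c m"
    if "x \<in> Ob C" "y \<in> Ob C" "c \<in> carrier (Mor C y x)" "m \<in> carrier (space M x)"
    unfolding act[of y x c m] using that sp'[of x] by (simp add: twist_module_def Let_def ii)
qed

text \<open>Composites and identities are inherited, so only the closure of the fixed
  transformations under them is at stake. Both are restricted to the carriers of the source module,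
  which is why the equality of spaces along an orbit enters.\<close>

lemma fixed_module_category_is_cat: "is_cat (fixed_module_category k G C)"
proof -
  interpret A: is_cat "module_category k C" by (rule module_category_is_cat)
  let ?F = "fixed_module_category k G C"
  have sub: "M \<in> obj ?F \<Longrightarrow> M \<in> obj (module_category k C)"
    "f \<in> arr ?F N M \<Longrightarrow> f \<in> arr (module_category k C) N M"
    "cmp ?F = cmp (module_category k C)" "idn ?F = idn (module_category k C)" for M N f
    by (auto simp: fixed_module_category_def)
  have i: "inv\<^bsub>G\<^esub> s \<in> carrier G" "inv\<^bsub>G\<^esub> (inv\<^bsub>G\<^esub> s) = s" if "s \<in> carrier G" for s
    using that group.inv_closed[OF G_group] group.inv_inv[OF G_group] by auto
  have sp: "space M (o_act C (inv\<^bsub>G\<^esub> s) x) = space M x"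
    if "M \<in> obj ?F" "s \<in> carrier G" "x \<in> Ob C" for M s x
    using that i by (intro twist_module_fixedD(1)) (auto simp: fixed_module_category_def)
  have tr: "\<phi> (o_act C (inv\<^bsub>G\<^esub> s) x) = \<phi> x"
    if "\<phi> \<in> arr ?F N M" "s \<in> carrier G" "x \<in> Ob C" for \<phi> N M s x
    using that i by (intro twist_transformation_fixedD[OF _ G_group]) (auto simp: fixed_module_category_def)
  show ?thesis
  proof
    fix M assume M: "M \<in> obj ?F"
    have "twist_transformation G C s (idn ?F M) = idn ?F M" if "s \<in> carrier G" for s
      unfolding twist_transformation_def using sp[OF M that] i(1)[OF that]
      by (auto simp: sub(4) module_category_def o_act_closed intro!: restrict_ext)
    then show "idn ?F M \<in> arr ?F M M"
      using A.idn_closed[OF sub(1)[OF M]] by (simp add: fixed_module_category_def)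
  next
    fix Q R S f g
    assume Q: "Q \<in> obj ?F" and R: "R \<in> obj ?F" and S: "S \<in> obj ?F"
      and f: "f \<in> arr ?F R Q" and g: "g \<in> arr ?F S R"
    have "twist_transformation G C s (cmp ?F S R Q g f) = cmp ?F S R Q g f" if "s \<in> carrier G" for s
      unfolding twist_transformation_def using sp[OF Q that] tr[OF f that] tr[OF g that] i(1)[OF that]
      by (auto simp: sub(3) module_category_def o_act_closed intro!: restrict_ext)
    then show "cmp ?F S R Q g f \<in> arr ?F S Q"
      using A.cmp_closed[OF sub(1)[OF Q] sub(1)[OF R] sub(1)[OF S] sub(2)[OF f] sub(2)[OF g]]
      by (simp add: fixed_module_category_def)
  next
    fix P Q R S f g h
    assume "P \<in> obj ?F" "Q \<in> obj ?F" "R \<in> obj ?F" "S \<in> obj ?F"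
      "f \<in> arr ?F Q P" "g \<in> arr ?F R Q" "h \<in> arr ?F S R"
    then show "cmp ?F S Q P (cmp ?F S R Q h g) f = cmp ?F S R P h (cmp ?F R Q P g f)"
      unfolding sub(3) by (intro A.cmp_assoc sub(1) sub(2))
  next
    fix Q R f assume "Q \<in> obj ?F" "R \<in> obj ?F" "f \<in> arr ?F R Q"
    then show "cmp ?F R R Q (idn ?F R) f = f" "cmp ?F R Q Q f (idn ?F Q) = f"
      unfolding sub(3,4) by (intro A.cmp_idn_left A.cmp_idn_right sub(1) sub(2); simp)+
  qed
qed

end

subsection \<open>Restriction along the covering\<close>

text \<open>Off the domain the action is set to \<open>undefined\<close>, as
  \<open>left_module\<close> demands. The round trips below are equalities of records and include
  these values.\<close>

definition pullback_module ::
  "('k, 'r) ring_scheme \<Rightarrow> ('g, 'h) monoid_scheme \<Rightarrow> ('o, 'a, 'k, 'g, 'c) g_category_scheme \<Rightarrow>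
     ('o set, ('o \<times> 'o \<Rightarrow> 'a) set, 'k, 'm) c_module \<Rightarrow> ('o, 'a, 'k, 'm) c_module" where
  "pullback_module k G C M =
     (let F = galois_covering k G C in
      \<lparr>space = (\<lambda>x\<in>Ob C. space M (on_ob F x)),
       act = (\<lambda>y x c m.
         if x \<in> Ob C \<and> y \<in> Ob C \<and> c \<in> carrier (Mor C y x) \<and> m \<in> carrier (space M (on_ob F x))
         then act M (on_ob F y) (on_ob F x) (on_mor F y x c) m
         else undefined)\<rparr>)"

definition pullback_transformation ::
  "('g, 'h) monoid_scheme \<Rightarrow> ('o, 'a, 'k, 'g, 'c) g_category_scheme \<Rightarrow>
     ('o set \<Rightarrow> 'm \<Rightarrow> 'm) \<Rightarrow> 'o \<Rightarrow> 'm \<Rightarrow> 'm" where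
  "pullback_transformation G C \<phi> = (\<lambda>x\<in>Ob C. \<phi> (orbit G (o_act C) x))"

context free_G_category_over
begin

abbreviation "pull \<equiv> pullback_module k G C"

lemma on_ob_covering: "on_ob (galois_covering k G C) = orb"
  by (simp add: galois_covering_def)

lemma pullback_space: "x \<in> Ob C \<Longrightarrow> space (pull M) x = space M (orb x)"
  by (simp add: pullback_module_def Let_def on_ob_covering)

lemma pullback_act:
  "\<lbrakk>x \<in> Ob C; y \<in> Ob C; c \<in> carrier (Mor C y x); m \<in> carrier (space M (orb x))\<rbrakk> \<Longrightarrow>
     act (pull M) y x c m = act M (orb y) (orb x) (cov y x c) m"
  by (simp add: pullback_module_def Let_def on_ob_covering)

text \<open>Each axiom is the one for \<open>M\<close> at the images under the covering, by
  \<open>cov_hom\<close>, \<open>cov_Cmp\<close> and \<open>cov_Idn\<close>.\<close>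

lemma pullback_left_module:
  assumes M: "left_module k B M"
  shows "left_module k C (pull M)"
proof -
  interpret M: left_module k B M by fact
  have orbs: "orb x \<in> Ob B" if "x \<in> Ob C" for x
    using that by (simp add: B_simps orbit_in_orbits)
  have cov: "cov y x c \<in> carrier (Mor B (orb y) (orb x))"
    if "x \<in> Ob C" "y \<in> Ob C" "c \<in> carrier (Mor C y x)" for x y c
    using module_hom_closed[OF cov_hom] that by (simp add: B_simps)
  show ?thesis
  proof
    fix x assume "x \<in> Ob C"
    then show "strict_module k (space (pull M) x)"
      using M.space_module orbs by (simp add: pullback_space)
  next
    fix x y m assume x: "x \<in> Ob C" and y: "y \<in> Ob C" and m: "m \<in> carrier (space (pull M) x)"
    have "(\<lambda>c. act M (orb y) (orb x) (cov y x c) m) \<in> module_hom k (Mor C y x) (space M (orb y))"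
      using module_hom_comp[OF cov_hom[OF x y, folded B_simps] M.act_linear_left[OF orbs[OF x] orbs[OF y]]] m x
      by (simp add: pullback_space)
    then have "(\<lambda>c. act M (orb y) (orb x) (cov y x c) m) \<in> module_hom k (Mor C y x) (space (pull M) y)"
      using y by (simp add: pullback_space)
    from Mor_module[OF x y] this
    show "(\<lambda>c. act (pull M) y x c m) \<in> module_hom k (Mor C y x) (space (pull M) y)"
      by (rule module_hom_cong) (use x y m in \<open>simp add: pullback_act pullback_space\<close>)
  next
    fix x y c assume x: "x \<in> Ob C" and y: "y \<in> Ob C" and c: "c \<in> carrier (Mor C y x)"
    have "act M (orb y) (orb x) (cov y x c) \<in> module_hom k (space (pull M) x) (space (pull M) y)"
      using M.act_linear_right[OF orbs[OF x] orbs[OF y] cov[OF x y c]] x y by (simp add: pullback_space)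
    moreover have "module k (space (pull M) x)"
      using left_module_space[OF M orbs[OF x]] x by (simp add: pullback_space)
    ultimately show "act (pull M) y x c \<in> module_hom k (space (pull M) x) (space (pull M) y)"
      using x y c by (rule_tac module_hom_cong) (simp_all add: pullback_act pullback_space)
  next
    fix x y z f g m
    assume ob: "x \<in> Ob C" "y \<in> Ob C" "z \<in> Ob C"
      and f: "f \<in> carrier (Mor C y x)" and g: "g \<in> carrier (Mor C z y)"
      and "m \<in> carrier (space (pull M) x)"
    then have m: "m \<in> carrier (space M (orb x))" by (simp add: pullback_space)
    show "act (pull M) z x (Cmp C z y x g f) m = act (pull M) z y g (act (pull M) y x f m)"
      using ob f g m Cmp_closed[OF ob f g]
        left_module_act_closed[OF M orbs[OF ob(1)] orbs[OF ob(2)] cov[OF ob(1,2) f] m]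
        M.act_Cmp[OF orbs[OF ob(1)] orbs[OF ob(2)] orbs[OF ob(3)] cov[OF ob(1,2) f] cov[OF ob(2,3) g] m]
      by (simp add: pullback_act cov_Cmp)
  next
    fix x m assume x: "x \<in> Ob C" and "m \<in> carrier (space (pull M) x)"
    then have m: "m \<in> carrier (space M (orb x))" by (simp add: pullback_space)
    show "act (pull M) x x (Idn C x) m = m"
      using x m Idn_closed[OF x] M.act_Idn[OF orbs[OF x] m] by (simp add: pullback_act cov_Idn)
  next
    show "space (pull M) \<in> extensional (Ob C)"
      by (simp add: pullback_module_def Let_def)
  next
    fix x y c m
    assume "\<not> (x \<in> Ob C \<and> y \<in> Ob C \<and> c \<in> carrier (Mor C y x) \<and> m \<in> carrier (space (pull M) x))"
    then show "act (pull M) y x c m = undefined"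
      by (auto simp: pullback_module_def Let_def)
  qed
qed

lemma twist_pullback:
  assumes s: "s \<in> carrier G"
  shows "twist_module G C s (pull M) = pull M"
proof (rule c_module.equality)
  have i: "inv\<^bsub>G\<^esub> s \<in> carrier G" using s group.inv_closed[OF G_group] by simp
  show "space (twist_module G C s (pull M)) = space (pull M)"
    using i by (auto simp: twist_module_def pullback_module_def Let_def on_ob_covering orbit_o_act
        o_act_closed intro!: restrict_ext)
  have cov: "cov (o_act C (inv\<^bsub>G\<^esub> s) y) (o_act C (inv\<^bsub>G\<^esub> s) x) (m_act C (inv\<^bsub>G\<^esub> s) y x c) = cov y x c"
    if "x \<in> Ob C" "y \<in> Ob C" "c \<in> carrier (Mor C y x)" for x y c
    using cov_m_act[OF i that] .
  show "act (twist_module G C s (pull M)) = act (pull M)"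
    using i by (intro ext) (simp add: twist_module_def pullback_module_def Let_def on_ob_covering
        orbit_o_act o_act_closed m_act_closed cov cong: conj_cong)
qed simp

lemma pullback_transformation_natural:
  assumes \<phi>: "\<phi> \<in> natural_transformations k B N M"
    and M: "left_module k B M"
  shows "pullback_transformation G C \<phi> \<in> natural_transformations k C (pull N) (pull M)"
proof (rule natural_transformationsI)
  have orbs: "orb x \<in> Ob B" if "x \<in> Ob C" for x
    using that by (simp add: B_simps orbit_in_orbits)
  {
    fix x assume x: "x \<in> Ob C"
    show "pullback_transformation G C \<phi> x \<in> module_hom k (space (pull M) x) (space (pull N) x)"
      using natural_transformationsD(2)[OF \<phi> orbs[OF x]] x
      by (simp add: pullback_transformation_def pullback_space)
    show "pullback_transformation G C \<phi> x \<in> extensional (carrier (space (pull M) x))"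
      using natural_transformationsD(3)[OF \<phi> orbs[OF x]] x
      by (simp add: pullback_transformation_def pullback_space)
  }
  fix x y c m assume x: "x \<in> Ob C" and y: "y \<in> Ob C" and c: "c \<in> carrier (Mor C y x)"
    and "m \<in> carrier (space (pull M) x)"
  then have m: "m \<in> carrier (space M (orb x))" by (simp add: pullback_space)
  have cov: "cov y x c \<in> carrier (Mor B (orb y) (orb x))"
    using module_hom_closed[OF cov_hom[OF x y] c] by (simp add: B_simps)
  show "pullback_transformation G C \<phi> y (act (pull M) y x c m) =
      act (pull N) y x c (pullback_transformation G C \<phi> x m)"
    using x y c m natural_transformationsD(4)[OF \<phi> orbs[OF x] orbs[OF y] cov m]
      module_hom_closed[OF natural_transformationsD(2)[OF \<phi> orbs[OF x]] m]
    by (simp add: pullback_transformation_def pullback_act)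
qed (simp add: pullback_transformation_def)

lemma pullback_functor:
  "is_functor (module_category k B) (fixed_module_category k G C)
     \<lparr>on_ob = pull, on_mor = (\<lambda>N M. pullback_transformation G C)\<rparr>"
proof
  have i: "inv\<^bsub>G\<^esub> s \<in> carrier G" if "s \<in> carrier G" for s
    using that group.inv_closed[OF G_group] by simp
  fix Q R f
  assume "Q \<in> obj (module_category k B)" "f \<in> arr (module_category k B) R Q"
  then have Q: "left_module k B Q" and f: "f \<in> natural_transformations k B R Q"
    by (auto simp: module_category_def)
  have "twist_transformation G C s (pullback_transformation G C f) = pullback_transformation G C f"
    if "s \<in> carrier G" for s
    unfolding twist_transformation_def pullback_transformation_def using i[OF that]
    by (auto simp: o_act_closed orbit_o_act intro!: restrict_ext)
  then show "on_mor \<lparr>on_ob = pull, on_mor = (\<lambda>N M. pullback_transformation G C)\<rparr> R Q f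
      \<in> arr (fixed_module_category k G C)
          (on_ob \<lparr>on_ob = pull, on_mor = (\<lambda>N M. pullback_transformation G C)\<rparr> R)
          (on_ob \<lparr>on_ob = pull, on_mor = (\<lambda>N M. pullback_transformation G C)\<rparr> Q)"
    using pullback_transformation_natural[OF f Q]
    by (simp add: fixed_module_category_def module_category_def)
qed (auto simp: fixed_module_category_def module_category_def pullback_left_module twist_pullback
    pullback_transformation_def pullback_space B_simps orbit_in_orbits intro!: restrict_ext)

end

subsection \<open>Descent along the covering\<close>

definition orbit_rep :: "'o set \<Rightarrow> 'o" where
  "orbit_rep \<alpha> = (SOME x. x \<in> \<alpha>)"

text \<open>
  It is applied to modules \<open>N\<close> fixed by \<open>G\<close>, for which all \<open>space N y\<close> with \<open>y \<in> \<beta>\<close> are equal, so that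
  the chosen representative only serves to name the common value.
\<close>

definition orbit_sum_apply ::
  "('o, 'a, 'k, 'c) k_category_scheme \<Rightarrow> ('o, 'a, 'k, 'm) c_module \<Rightarrow> 'o set \<Rightarrow> 'o set \<Rightarrow>
     ('o \<times> 'o \<Rightarrow> 'a) \<Rightarrow> 'm \<Rightarrow> 'm" where
  "orbit_sum_apply C N \<beta> \<alpha> u m =
     (\<Oplus>\<^bsub>space N (orbit_rep \<beta>)\<^esub>p\<in>{p \<in> \<beta> \<times> \<alpha>. u p \<noteq> \<zero>\<^bsub>case p of (y, x) \<Rightarrow> Mor C y x\<^esub>}.
        act N (fst p) (snd p) (u p) m)"

definition descended_module ::
  "('k, 'r) ring_scheme \<Rightarrow> ('g, 'h) monoid_scheme \<Rightarrow> ('o, 'a, 'k, 'g, 'c) g_category_scheme \<Rightarrow>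
     ('o, 'a, 'k, 'm) c_module \<Rightarrow> ('o set, ('o \<times> 'o \<Rightarrow> 'a) set, 'k, 'm) c_module" where
  "descended_module k G C N =
     (let B = quotient_category k G C in
      \<lparr>space = (\<lambda>\<alpha>\<in>Ob B. space N (orbit_rep \<alpha>)),
       act = (\<lambda>\<beta> \<alpha> c m.
         if \<alpha> \<in> Ob B \<and> \<beta> \<in> Ob B \<and> c \<in> carrier (Mor B \<beta> \<alpha>) \<and> m \<in> carrier (space N (orbit_rep \<alpha>))
         then orbit_sum_apply C N \<beta> \<alpha> (SOME u. u \<in> c) m
         else undefined)\<rparr>)"

definition descended_transformation ::
  "('g, 'h) monoid_scheme \<Rightarrow> ('o, 'a, 'k, 'g, 'c) g_category_scheme \<Rightarrow>
     ('o \<Rightarrow> 'm \<Rightarrow> 'm) \<Rightarrow> 'o set \<Rightarrow> 'm \<Rightarrow> 'm" where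
  "descended_transformation G C \<phi> = (\<lambda>\<alpha>\<in>orbits G (Ob C) (o_act C). \<phi> (orbit_rep \<alpha>))"

context free_G_category_over
begin

lemma orbit_rep_in: "\<alpha> \<in> Orbs \<Longrightarrow> orbit_rep \<alpha> \<in> \<alpha>"
  unfolding orbit_rep_def by (simp add: some_in_eq orbits_nonempty)

lemma orbit_rep_Ob: "\<alpha> \<in> Orbs \<Longrightarrow> orbit_rep \<alpha> \<in> Ob C"
  by (rule orbits_subset[OF _ orbit_rep_in])

lemma orbit_rep_orbit: "\<alpha> \<in> Orbs \<Longrightarrow> orb (orbit_rep \<alpha>) = \<alpha>"
  by (rule orbit_eq[OF _ orbit_rep_in])

end

section \<open>The action of the quotient category on a fixed module\<close>

locale fixed_left_module = free_G_category_over k G C + N: left_module k C N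
  for k :: "('k, 'r) ring_scheme" and G :: "('g, 'h) monoid_scheme"
    and C :: "('o, 'a, 'k, 'g, 'c) g_category_scheme" and N :: "('o, 'a, 'k, 'm) c_module" +
  assumes fixed: "s \<in> carrier G \<Longrightarrow> twist_module G C s N = N"
begin

lemma fixed_inv: "s \<in> carrier G \<Longrightarrow> twist_module G C (inv\<^bsub>G\<^esub> s) N = N"
  using fixed group.inv_closed[OF G_group] by simp

lemma space_orbit:
  assumes "\<alpha> \<in> Orbs" "x \<in> \<alpha>" "y \<in> \<alpha>" shows "space N x = space N y"
  using orbits_transitive[OF assms] twist_module_fixedD(1)[OF fixed_inv] orbits_subset[OF assms(1,2)]
  by metis

lemmas space_rep = space_orbit[OF _ _ orbit_rep_in]

abbreviation "sp \<alpha> \<equiv> space N (orbit_rep \<alpha>)"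
abbreviation "app \<equiv> orbit_sum_apply C N"
abbreviation "desc \<equiv> descended_module k G C N"

lemma sp_module: "\<alpha> \<in> Orbs \<Longrightarrow> module k (sp \<alpha>)"
  by (intro left_module_space[OF N.left_module_axioms] orbit_rep_Ob)

text \<open>The module axioms give values in \<open>space N y\<close>, which depends on y. For a
  fixed module this is the module at the representative, so the contributions of all summands lie in
  one module and can be added.\<close>

lemma act_hom_left:
  assumes "\<alpha> \<in> Orbs" "\<beta> \<in> Orbs" "x \<in> \<alpha>" "y \<in> \<beta>" "m \<in> carrier (sp \<alpha>)"
  shows "(\<lambda>c. act N y x c m) \<in> module_hom k (Mor C y x) (sp \<beta>)"
  using N.act_linear_left[of x y m] orbits_subset assms space_rep[OF assms(1,3,1)] space_rep[OF assms(2,4,2)]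
  by metis

lemma act_hom_right:
  assumes "\<alpha> \<in> Orbs" "\<beta> \<in> Orbs" "x \<in> \<alpha>" "y \<in> \<beta>" "c \<in> carrier (Mor C y x)"
  shows "act N y x c \<in> module_hom k (sp \<alpha>) (sp \<beta>)"
  using N.act_linear_right[of x y c] orbits_subset assms space_rep[OF assms(1,3,1)] space_rep[OF assms(2,4,2)]
  by metis

text \<open>With m fixed, \<open>app\<close> is the extension to the direct sum of the maps c |-> c
  m on the summands, so both claims come from \<open>direct_sum_universal\<close>.\<close>

lemma
  assumes \<alpha>: "\<alpha> \<in> Orbs" and \<beta>: "\<beta> \<in> Orbs" and m: "m \<in> carrier (sp \<alpha>)"
  shows apply_hom: "abelian_group_hom (orbit_sum C \<beta> \<alpha>) (sp \<beta>) (\<lambda>u. app \<beta> \<alpha> u m)"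
    and apply_single: "\<lbrakk>x \<in> \<alpha>; y \<in> \<beta>; f \<in> carrier (Mor C y x)\<rbrakk> \<Longrightarrow>
      app \<beta> \<alpha> (sng \<beta> \<alpha> y x f) m = act N y x f m"
proof -
  have h: "abelian_group_hom (case p of (y, x) \<Rightarrow> Mor C y x) (sp \<beta>) (\<lambda>c. act N (fst p) (snd p) c m)"
    if p: "p \<in> \<beta> \<times> \<alpha>" for p
  proof -
    obtain y x where yx: "p = (y, x)" "y \<in> \<beta>" "x \<in> \<alpha>" using p by auto
    show ?thesis
      using module_hom_abelian_group_hom[OF _ sp_module[OF \<beta>] act_hom_left[OF \<alpha> \<beta> yx(3,2) m]]
        Mor_module[OF orbits_subset[OF \<alpha> yx(3)] orbits_subset[OF \<beta> yx(2)]] yx by simp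
  qed
  note univ = module_family.direct_sum_universal[OF orbit_family[OF \<alpha> \<beta>]
      module_abelian_group[OF sp_module[OF \<beta>]] h]
  show "abelian_group_hom (orbit_sum C \<beta> \<alpha>) (sp \<beta>) (\<lambda>u. app \<beta> \<alpha> u m)"
    using univ(1) unfolding orbit_sum_def orbit_sum_apply_def .
  show "app \<beta> \<alpha> (sng \<beta> \<alpha> y x f) m = act N y x f m"
    if "x \<in> \<alpha>" "y \<in> \<beta>" "f \<in> carrier (Mor C y x)"
    using univ(2)[of "(y, x)" f] that unfolding orbit_sum_apply_def orbit_single_def by simp
qed

lemma apply_closed:
  assumes "\<alpha> \<in> Orbs" "\<beta> \<in> Orbs" "m \<in> carrier (sp \<alpha>)" "u \<in> carrier (orbit_sum C \<beta> \<alpha>)"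
  shows "app \<beta> \<alpha> u m \<in> carrier (sp \<beta>)"
  using abelian_group_hom.hom_closed[OF apply_hom[OF assms(1-3)] assms(4)] .

text \<open>\<open>apply_hom\<close> gives additivity only. Both sides are additive in u, so scalars
  are checked on single summands, where the action is linear.\<close>

lemma apply_smult:
  assumes \<alpha>: "\<alpha> \<in> Orbs" and \<beta>: "\<beta> \<in> Orbs" and m: "m \<in> carrier (sp \<alpha>)"
    and a: "a \<in> carrier k" and u: "u \<in> carrier (orbit_sum C \<beta> \<alpha>)"
  shows "app \<beta> \<alpha> (a \<odot>\<^bsub>orbit_sum C \<beta> \<alpha>\<^esub> u) m = a \<odot>\<^bsub>sp \<beta>\<^esub> app \<beta> \<alpha> u m"
proof (rule orbit_sum_hom_eqI[OF \<alpha> \<beta> _ _ _ u])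
  show "abelian_group_hom (orbit_sum C \<beta> \<alpha>) (sp \<beta>) (\<lambda>u. app \<beta> \<alpha> (a \<odot>\<^bsub>orbit_sum C \<beta> \<alpha>\<^esub> u) m)"
    by (rule abelian_group_hom_comp[OF abelian_group_hom_smult[OF orbit_sum_module[OF \<alpha> \<beta>] a]
          apply_hom[OF \<alpha> \<beta> m]])
  show "abelian_group_hom (orbit_sum C \<beta> \<alpha>) (sp \<beta>) (\<lambda>u. a \<odot>\<^bsub>sp \<beta>\<^esub> app \<beta> \<alpha> u m)"
    by (rule abelian_group_hom_comp[OF apply_hom[OF \<alpha> \<beta> m]
          abelian_group_hom_smult[OF sp_module[OF \<beta>] a]])
  fix y x f assume yx: "y \<in> \<beta>" "x \<in> \<alpha>" and f: "f \<in> carrier (Mor C y x)"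
  have "a \<odot>\<^bsub>Mor C y x\<^esub> f \<in> carrier (Mor C y x)"
    using module.smult_closed[OF Mor_module a f] yx orbits_subset \<alpha> \<beta> by blast
  then show "app \<beta> \<alpha> (a \<odot>\<^bsub>orbit_sum C \<beta> \<alpha>\<^esub> sng \<beta> \<alpha> y x f) m = a \<odot>\<^bsub>sp \<beta>\<^esub> app \<beta> \<alpha> (sng \<beta> \<alpha> y x f) m"
    using module_hom_smult[OF orbit_single_hom[OF \<alpha> \<beta> yx(2,1)] a f]
      module_hom_smult[OF act_hom_left[OF \<alpha> \<beta> yx(2,1) m] a f]
      apply_single[OF \<alpha> \<beta> m yx(2,1)] f by metis
qed

text \<open>The arguments from \<open>sp \<alpha>\<close> are held fixed and both sides are compared
  as additive maps in u. This reduces linearity in m to that of the action of one morphism.\<close>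

lemma apply_linear:
  assumes \<alpha>: "\<alpha> \<in> Orbs" and \<beta>: "\<beta> \<in> Orbs" and u: "u \<in> carrier (orbit_sum C \<beta> \<alpha>)"
  shows "app \<beta> \<alpha> u \<in> module_hom k (sp \<alpha>) (sp \<beta>)"
proof -
  have "app \<beta> \<alpha> u (m \<oplus>\<^bsub>sp \<alpha>\<^esub> m') = app \<beta> \<alpha> u m \<oplus>\<^bsub>sp \<beta>\<^esub> app \<beta> \<alpha> u m'"
    if m: "m \<in> carrier (sp \<alpha>)" and m': "m' \<in> carrier (sp \<alpha>)" for m m'
  proof -
    have mm': "m \<oplus>\<^bsub>sp \<alpha>\<^esub> m' \<in> carrier (sp \<alpha>)"
      using module_add_closed[OF sp_module[OF \<alpha>] m m'] .
    show ?thesis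
    proof (rule orbit_sum_hom_eqI[OF \<alpha> \<beta> apply_hom[OF \<alpha> \<beta> mm']
          abelian_group_hom_add[OF apply_hom[OF \<alpha> \<beta> m] apply_hom[OF \<alpha> \<beta> m']] _ u])
      fix y x f assume yx: "y \<in> \<beta>" "x \<in> \<alpha>" and f: "f \<in> carrier (Mor C y x)"
      show "app \<beta> \<alpha> (sng \<beta> \<alpha> y x f) (m \<oplus>\<^bsub>sp \<alpha>\<^esub> m') =
          app \<beta> \<alpha> (sng \<beta> \<alpha> y x f) m \<oplus>\<^bsub>sp \<beta>\<^esub> app \<beta> \<alpha> (sng \<beta> \<alpha> y x f) m'"
        using module_hom_add[OF act_hom_right[OF \<alpha> \<beta> yx(2,1) f] m m']
        by (simp add: apply_single[OF \<alpha> \<beta> _ yx(2,1) f] m m' mm')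
    qed
  qed
  moreover have "app \<beta> \<alpha> u (a \<odot>\<^bsub>sp \<alpha>\<^esub> m) = a \<odot>\<^bsub>sp \<beta>\<^esub> app \<beta> \<alpha> u m"
    if a: "a \<in> carrier k" and m: "m \<in> carrier (sp \<alpha>)" for a m
  proof -
    have am: "a \<odot>\<^bsub>sp \<alpha>\<^esub> m \<in> carrier (sp \<alpha>)"
      using module.smult_closed[OF sp_module[OF \<alpha>] a m] .
    show ?thesis
    proof (rule orbit_sum_hom_eqI[OF \<alpha> \<beta> apply_hom[OF \<alpha> \<beta> am]
          abelian_group_hom_comp[OF apply_hom[OF \<alpha> \<beta> m] abelian_group_hom_smult[OF sp_module[OF \<beta>] a]] _ u])
      fix y x f assume yx: "y \<in> \<beta>" "x \<in> \<alpha>" and f: "f \<in> carrier (Mor C y x)"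
      show "app \<beta> \<alpha> (sng \<beta> \<alpha> y x f) (a \<odot>\<^bsub>sp \<alpha>\<^esub> m) = a \<odot>\<^bsub>sp \<beta>\<^esub> app \<beta> \<alpha> (sng \<beta> \<alpha> y x f) m"
        using module_hom_smult[OF act_hom_right[OF \<alpha> \<beta> yx(2,1) f] a m]
        by (simp add: apply_single[OF \<alpha> \<beta> _ yx(2,1) f] m am)
    qed
  qed
  ultimately show ?thesis
    using apply_closed[OF \<alpha> \<beta> _ u] by (simp add: module_hom_def)
qed

lemma apply_class:
  assumes \<alpha>: "\<alpha> \<in> Orbs" and \<beta>: "\<beta> \<in> Orbs" and m: "m \<in> carrier (sp \<alpha>)"
    and u: "u \<in> carrier (orbit_sum C \<beta> \<alpha>)" "v \<in> carrier (orbit_sum C \<beta> \<alpha>)" "cl \<beta> \<alpha> u = cl \<beta> \<alpha> v"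
  shows "app \<beta> \<alpha> u m = app \<beta> \<alpha> v m"
proof (rule orbit_hom_factors[OF \<alpha> \<beta> apply_hom[OF \<alpha> \<beta> m] _ u])
  fix s y x f assume s: "s \<in> carrier G" and yx: "y \<in> \<beta>" "x \<in> \<alpha>" and f: "f \<in> carrier (Mor C y x)"
  have ob: "x \<in> Ob C" "y \<in> Ob C" using yx orbits_subset \<alpha> \<beta> by auto
  have mx: "m \<in> carrier (space N x)" using m space_rep[OF \<alpha> yx(2) \<alpha>] by simp
  show "app \<beta> \<alpha> (sng \<beta> \<alpha> (o_act C s y) (o_act C s x) (m_act C s y x f)) m = app \<beta> \<alpha> (sng \<beta> \<alpha> y x f) m"
    using apply_single[OF \<alpha> \<beta> m orbits_o_act[OF \<alpha> yx(2) s] orbits_o_act[OF \<beta> yx(1) s] m_act_closed[OF s ob f]]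
      apply_single[OF \<alpha> \<beta> m yx(2,1) f] twist_module_fixedD(2)[OF fixed_inv[OF s] s ob f mx] by simp
qed

text \<open>Both sides are additive in v and in u, so one summand of each is enough. There the
  composite is g (t f), and t f acts on m as f does because \<open>N\<close> is fixed.\<close>

lemma apply_Cmp:
  assumes \<alpha>: "\<alpha> \<in> Orbs" and \<beta>: "\<beta> \<in> Orbs" and \<gamma>: "\<gamma> \<in> Orbs" and m: "m \<in> carrier (sp \<alpha>)"
    and u: "u \<in> carrier (orbit_sum C \<beta> \<alpha>)" and v: "v \<in> carrier (orbit_sum C \<gamma> \<beta>)"
  shows "app \<gamma> \<alpha> (orbit_sum_Cmp G C \<gamma> \<beta> \<alpha> v u) m = app \<gamma> \<beta> v (app \<beta> \<alpha> u m)"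
proof (rule orbit_sum_hom_eqI[OF \<beta> \<gamma> _ _ _ v])
  show "abelian_group_hom (orbit_sum C \<gamma> \<beta>) (sp \<gamma>) (\<lambda>v. app \<gamma> \<alpha> (orbit_sum_Cmp G C \<gamma> \<beta> \<alpha> v u) m)"
    by (rule abelian_group_hom_comp[OF orbit_sum_Cmp_hom_left[OF \<alpha> \<beta> \<gamma> u] apply_hom[OF \<alpha> \<gamma> m]])
  show "abelian_group_hom (orbit_sum C \<gamma> \<beta>) (sp \<gamma>) (\<lambda>v. app \<gamma> \<beta> v (app \<beta> \<alpha> u m))"
    by (rule apply_hom[OF \<beta> \<gamma> apply_closed[OF \<alpha> \<beta> m u]])
  fix z y' g assume zy: "z \<in> \<gamma>" "y' \<in> \<beta>" and g: "g \<in> carrier (Mor C z y')"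
  have sg: "sng \<gamma> \<beta> z y' g \<in> carrier (orbit_sum C \<gamma> \<beta>)"
    by (rule orbit_single_closed[OF \<beta> \<gamma> zy(2,1) g])
  show "app \<gamma> \<alpha> (orbit_sum_Cmp G C \<gamma> \<beta> \<alpha> (sng \<gamma> \<beta> z y' g) u) m = app \<gamma> \<beta> (sng \<gamma> \<beta> z y' g) (app \<beta> \<alpha> u m)"
  proof (rule orbit_sum_hom_eqI[OF \<alpha> \<beta> _ _ _ u])
    show "abelian_group_hom (orbit_sum C \<beta> \<alpha>) (sp \<gamma>)
        (\<lambda>u. app \<gamma> \<alpha> (orbit_sum_Cmp G C \<gamma> \<beta> \<alpha> (sng \<gamma> \<beta> z y' g) u) m)"
      by (rule abelian_group_hom_comp[OF orbit_sum_Cmp_hom_right[OF \<alpha> \<beta> \<gamma> sg] apply_hom[OF \<alpha> \<gamma> m]])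
    show "abelian_group_hom (orbit_sum C \<beta> \<alpha>) (sp \<gamma>) (\<lambda>u. app \<gamma> \<beta> (sng \<gamma> \<beta> z y' g) (app \<beta> \<alpha> u m))"
      by (rule abelian_group_hom_comp[OF apply_hom[OF \<alpha> \<beta> m]
            module_hom_abelian_group_hom[OF sp_module[OF \<beta>] sp_module[OF \<gamma>] apply_linear[OF \<beta> \<gamma> sg]]])
    fix y x f assume yx: "y \<in> \<beta>" "x \<in> \<alpha>" and f: "f \<in> carrier (Mor C y x)"
    let ?t = "transporter G C y y'"
    let ?x = "o_act C ?t x" and ?f = "m_act C ?t y x f"
    have t: "?t \<in> carrier G" "o_act C ?t y = y'" using transporter_props[OF \<beta> yx(1) zy(2)] .
    have x': "?x \<in> \<alpha>" using orbits_o_act[OF \<alpha> yx(2) t(1)] .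
    have ob: "x \<in> Ob C" "y \<in> Ob C" "?x \<in> Ob C" "y' \<in> Ob C" "z \<in> Ob C"
      using yx zy x' orbits_subset[OF \<alpha>] orbits_subset[OF \<beta>] orbits_subset[OF \<gamma>] by auto
    have f': "?f \<in> carrier (Mor C y' ?x)"
      using m_act_closed[OF t(1) ob(1,2) f] t(2) by simp
    have mx: "m \<in> carrier (space N x)" "m \<in> carrier (space N ?x)"
      using m space_rep[OF \<alpha> yx(2) \<alpha>] space_rep[OF \<alpha> x' \<alpha>] by simp_all
    have fm: "act N y x f m \<in> carrier (sp \<beta>)"
      by (rule module_hom_closed[OF act_hom_right[OF \<alpha> \<beta> yx(2,1) f] m])
    have "app \<gamma> \<alpha> (orbit_sum_Cmp G C \<gamma> \<beta> \<alpha> (sng \<gamma> \<beta> z y' g) (sng \<beta> \<alpha> y x f)) m =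
        act N z ?x (Cmp C z y' ?x g ?f) m"
      using orbit_sum_Cmp_single[OF \<alpha> \<beta> \<gamma> zy g yx f]
        apply_single[OF \<alpha> \<gamma> m x' zy(1) Cmp_closed[OF ob(3,4,5) f' g]] by simp
    also have "\<dots> = act N z y' g (act N y' ?x ?f m)"
      by (rule N.act_Cmp[OF ob(3,4,5) f' g mx(2)])
    also have "act N y' ?x ?f m = act N y x f m"
      using twist_module_fixedD(2)[OF fixed_inv[OF t(1)] t(1) ob(1,2) f mx(1)] t(2) by simp
    finally show "app \<gamma> \<alpha> (orbit_sum_Cmp G C \<gamma> \<beta> \<alpha> (sng \<gamma> \<beta> z y' g) (sng \<beta> \<alpha> y x f)) m =
        app \<gamma> \<beta> (sng \<gamma> \<beta> z y' g) (app \<beta> \<alpha> (sng \<beta> \<alpha> y x f) m)"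
      using apply_single[OF \<alpha> \<beta> m yx(2,1) f] apply_single[OF \<beta> \<gamma> fm zy(2,1) g] by simp
  qed
qed

lemma descended_space: "\<alpha> \<in> Orbs \<Longrightarrow> space desc \<alpha> = sp \<alpha>"
  by (simp add: descended_module_def Let_def B_simps)

text \<open>This removes the choice from the definition: whatever element of the class is chosen, it
  has the same class as u, and \<open>apply_class\<close> applies.\<close>

lemma descended_act:
  assumes \<alpha>: "\<alpha> \<in> Orbs" and \<beta>: "\<beta> \<in> Orbs" and m: "m \<in> carrier (sp \<alpha>)"
    and u: "u \<in> carrier (orbit_sum C \<beta> \<alpha>)"
  shows "act desc \<beta> \<alpha> (cl \<beta> \<alpha> u) m = app \<beta> \<alpha> u m"
proof -
  have "(SOME v. v \<in> cl \<beta> \<alpha> u) \<in> cl \<beta> \<alpha> u" using orbit_class_self[OF \<alpha> \<beta> u] by (auto simp: some_in_eq)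
  from orbit_class_memD[OF \<alpha> \<beta> u this] have "app \<beta> \<alpha> (SOME v. v \<in> cl \<beta> \<alpha> u) m = app \<beta> \<alpha> u m"
    using u by (intro apply_class[OF \<alpha> \<beta> m])
  then show ?thesis
    using \<alpha> \<beta> m u by (simp add: descended_module_def Let_def B_simps quotient_Mor_carrier)
qed

text \<open>Every morphism of the quotient is the class of some u, so \<open>descended_act\<close>
  turns each axiom into a property of \<open>app\<close>.\<close>

lemma descended_left_module: "left_module k B desc"
proof
  fix \<alpha> assume "\<alpha> \<in> Ob B"
  then show "strict_module k (space desc \<alpha>)"
    using N.space_module[OF orbit_rep_Ob] by (simp add: B_simps descended_space)
next
  fix \<alpha> \<beta> m assume "\<alpha> \<in> Ob B" "\<beta> \<in> Ob B" "m \<in> carrier (space desc \<alpha>)"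
  then have \<alpha>: "\<alpha> \<in> Orbs" and \<beta>: "\<beta> \<in> Orbs" and m: "m \<in> carrier (sp \<alpha>)"
    by (simp_all add: B_simps descended_space)
  have "act desc \<beta> \<alpha> (cl \<beta> \<alpha> u \<oplus>\<^bsub>qm \<beta> \<alpha>\<^esub> cl \<beta> \<alpha> v) m =
      act desc \<beta> \<alpha> (cl \<beta> \<alpha> u) m \<oplus>\<^bsub>sp \<beta>\<^esub> act desc \<beta> \<alpha> (cl \<beta> \<alpha> v) m"
    if u: "u \<in> carrier (orbit_sum C \<beta> \<alpha>)" and v: "v \<in> carrier (orbit_sum C \<beta> \<alpha>)" for u v
    using descended_act[OF \<alpha> \<beta> m] u v module_add_closed[OF orbit_sum_module[OF \<alpha> \<beta>] u v]
      abelian_group_hom.hom_add[OF apply_hom[OF \<alpha> \<beta> m] u v]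
    by (simp flip: module_hom_add[OF orbit_class_hom[OF \<alpha> \<beta>]])
  moreover have "act desc \<beta> \<alpha> (a \<odot>\<^bsub>qm \<beta> \<alpha>\<^esub> cl \<beta> \<alpha> u) m = a \<odot>\<^bsub>sp \<beta>\<^esub> act desc \<beta> \<alpha> (cl \<beta> \<alpha> u) m"
    if a: "a \<in> carrier k" and u: "u \<in> carrier (orbit_sum C \<beta> \<alpha>)" for a u
    using descended_act[OF \<alpha> \<beta> m] u a module.smult_closed[OF orbit_sum_module[OF \<alpha> \<beta>] a u]
      apply_smult[OF \<alpha> \<beta> m a u]
    by (simp flip: module_hom_smult[OF orbit_class_hom[OF \<alpha> \<beta>]])
  moreover have "act desc \<beta> \<alpha> (cl \<beta> \<alpha> u) m \<in> carrier (sp \<beta>)"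
    if "u \<in> carrier (orbit_sum C \<beta> \<alpha>)" for u
    using apply_closed[OF \<alpha> \<beta> m that] descended_act[OF \<alpha> \<beta> m that] by simp
  ultimately show "(\<lambda>c. act desc \<beta> \<alpha> c m) \<in> module_hom k (Mor B \<beta> \<alpha>) (space desc \<beta>)"
    using \<alpha> \<beta> by (auto simp: module_hom_def B_simps descended_space quotient_Mor_carrier)
next
  fix \<alpha> \<beta> c assume "\<alpha> \<in> Ob B" "\<beta> \<in> Ob B" "c \<in> carrier (Mor B \<beta> \<alpha>)"
  then obtain u where \<alpha>: "\<alpha> \<in> Orbs" and \<beta>: "\<beta> \<in> Orbs"
    and u: "u \<in> carrier (orbit_sum C \<beta> \<alpha>)" and c: "c = cl \<beta> \<alpha> u"
    by (auto simp: B_simps quotient_Mor_carrier)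
  show "act desc \<beta> \<alpha> c \<in> module_hom k (space desc \<alpha>) (space desc \<beta>)"
    unfolding descended_space[OF \<alpha>] descended_space[OF \<beta>] c
    by (rule module_hom_cong[OF sp_module[OF \<alpha>] apply_linear[OF \<alpha> \<beta> u] descended_act[OF \<alpha> \<beta> _ u]])
next
  fix \<alpha> \<beta> \<gamma> c d m
  assume "\<alpha> \<in> Ob B" "\<beta> \<in> Ob B" "\<gamma> \<in> Ob B" "c \<in> carrier (Mor B \<beta> \<alpha>)" "d \<in> carrier (Mor B \<gamma> \<beta>)"
    "m \<in> carrier (space desc \<alpha>)"
  then obtain u v where \<alpha>: "\<alpha> \<in> Orbs" and \<beta>: "\<beta> \<in> Orbs" and \<gamma>: "\<gamma> \<in> Orbs"
    and u: "u \<in> carrier (orbit_sum C \<beta> \<alpha>)" and c: "c = cl \<beta> \<alpha> u"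
    and v: "v \<in> carrier (orbit_sum C \<gamma> \<beta>)" and d: "d = cl \<gamma> \<beta> v"
    and m: "m \<in> carrier (sp \<alpha>)"
    by (auto simp: B_simps quotient_Mor_carrier descended_space)
  show "act desc \<gamma> \<alpha> (Cmp B \<gamma> \<beta> \<alpha> d c) m = act desc \<gamma> \<beta> d (act desc \<beta> \<alpha> c m)"
    unfolding c d quotient_Cmp[OF \<alpha> \<beta> \<gamma> u v] descended_act[OF \<alpha> \<beta> m u]
      descended_act[OF \<beta> \<gamma> apply_closed[OF \<alpha> \<beta> m u] v]
      descended_act[OF \<alpha> \<gamma> m orbit_sum_Cmp_closed[OF \<alpha> \<beta> \<gamma> u v]]
    by (rule apply_Cmp[OF \<alpha> \<beta> \<gamma> m u v])
next
  fix \<alpha> m assume "\<alpha> \<in> Ob B" "m \<in> carrier (space desc \<alpha>)"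
  then have \<alpha>: "\<alpha> \<in> Orbs" and m: "m \<in> carrier (sp \<alpha>)" by (simp_all add: B_simps descended_space)
  note x = orbit_rep_in[OF \<alpha>] and xC = orbit_rep_Ob[OF \<alpha>]
  show "act desc \<alpha> \<alpha> (Idn B \<alpha>) m = m"
    unfolding quotient_Idn[OF \<alpha> x] descended_act[OF \<alpha> \<alpha> m orbit_single_closed[OF \<alpha> \<alpha> x x Idn_closed[OF xC]]]
      apply_single[OF \<alpha> \<alpha> m x x Idn_closed[OF xC]]
    by (rule N.act_Idn[OF xC m])
next
  show "space desc \<in> extensional (Ob B)" by (simp add: descended_module_def Let_def)
next
  fix \<alpha> \<beta> c m
  assume "\<not> (\<alpha> \<in> Ob B \<and> \<beta> \<in> Ob B \<and> c \<in> carrier (Mor B \<beta> \<alpha>) \<and> m \<in> carrier (space desc \<alpha>))"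
  then show "act desc \<beta> \<alpha> c m = undefined" by (auto simp: descended_module_def Let_def)
qed

text \<open>At x the round trip gives the module at the representative of the orbit of x, which is
  the module at x because \<open>N\<close> is fixed. The image of c under the covering is
  represented by c in a single summand, and this acts as c does.\<close>

lemma pullback_descended: "pull desc = N"
proof (rule c_module.equality)
  have orbs: "orb x \<in> Orbs" "x \<in> orb x" if "x \<in> Ob C" for x
    using that by (simp_all add: orbit_in_orbits orbit_refl)
  have sp: "space (pull desc) x = space N x" if "x \<in> Ob C" for x
    using orbs[OF that] that space_rep[of "orb x" x] by (simp add: pullback_space descended_space)
  then show "space (pull desc) = space N"
    using left_module.space_extensional[OF pullback_left_module[OF descended_left_module]]
      N.space_extensional by (intro extensionalityI[of _ "Ob C"])
  have "act (pull desc) y x c m = act N y x c m" for y x c m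
  proof (cases "x \<in> Ob C \<and> y \<in> Ob C \<and> c \<in> carrier (Mor C y x) \<and> m \<in> carrier (space N x)")
    case True
    then have x: "x \<in> Ob C" and y: "y \<in> Ob C" and c: "c \<in> carrier (Mor C y x)"
      and m: "m \<in> carrier (space N x)" by auto
    have m': "m \<in> carrier (space desc (orb x))" "m \<in> carrier (sp (orb x))"
      using m sp[OF x] x orbs[OF x] by (simp_all add: pullback_space descended_space)
    show ?thesis
      unfolding pullback_act[OF x y c m'(1)] cov_eq
        descended_act[OF orbs(1)[OF x] orbs(1)[OF y] m'(2)
          orbit_single_closed[OF orbs(1)[OF x] orbs(1)[OF y] orbs(2)[OF x] orbs(2)[OF y] c]]
      by (rule apply_single[OF orbs(1)[OF x] orbs(1)[OF y] m'(2) orbs(2)[OF x] orbs(2)[OF y] c])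
  next
    \<comment> \<open>Since the spaces agree, the two actions have the same domain, and off this
      domain both are \<open>undefined\<close>.\<close>
    case False
    then have "\<not> (x \<in> Ob C \<and> y \<in> Ob C \<and> c \<in> carrier (Mor C y x) \<and> m \<in> carrier (space (pull desc) x))"
      using sp by auto
    then show ?thesis
      using left_module.act_extensional[OF pullback_left_module[OF descended_left_module]]
        N.act_extensional[OF False] by simp
  qed
  then show "act (pull desc) = act N" by (intro ext)
qed simp

end

section \<open>Descent of transformations, and the other round trip\<close>

context free_G_category_over
begin

lemma fixed_objD:
  assumes "M \<in> obj (fixed_module_category k G C)" shows "fixed_left_module k G C M"
  using assms free_G_category_over_axioms
  by (simp add: fixed_module_category_def module_category_def fixed_left_module_def
      fixed_left_module_axioms_def)

text \<open>The second claim is what invariance of morphisms, as opposed to that of modules,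
  contributes: the component at the representative can replace the component at any point of the
  orbit.\<close>

lemma fixed_arrD:
  assumes "\<phi> \<in> arr (fixed_module_category k G C) N M"
  shows "\<phi> \<in> natural_transformations k C N M"
    and "\<lbrakk>\<alpha> \<in> Orbs; x \<in> \<alpha>; y \<in> \<alpha>\<rbrakk> \<Longrightarrow> \<phi> x = \<phi> y"
proof -
  show "\<phi> \<in> natural_transformations k C N M"
    using assms by (simp add: fixed_module_category_def module_category_def)
  assume \<alpha>: "\<alpha> \<in> Orbs" and xy: "x \<in> \<alpha>" "y \<in> \<alpha>"
  obtain s where s: "s \<in> carrier G" "o_act C s x = y" using orbits_transitive[OF \<alpha> xy] by blast
  have "twist_transformation G C (inv\<^bsub>G\<^esub> s) \<phi> = \<phi>"
    using assms group.inv_closed[OF G_group s(1)] by (simp add: fixed_module_category_def)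
  from twist_transformation_fixedD[OF this G_group s(1) orbits_subset[OF \<alpha> xy(1)]]
  show "\<phi> x = \<phi> y" using s(2) by simp
qed

text \<open>Naturality at the class of u is an equality of two additive maps in u. For a single f
  from x to y the components at the two representatives are those at x and y, and what remains is
  naturality of \<open>\<phi>\<close> at f.\<close>

lemma descended_transformation_natural:
  assumes N: "fixed_left_module k G C N" and M: "fixed_left_module k G C M"
    and \<phi>: "\<phi> \<in> arr (fixed_module_category k G C) N M"
  shows "descended_transformation G C \<phi> \<in>
    natural_transformations k B (descended_module k G C N) (descended_module k G C M)"
proof (rule natural_transformationsI)
  interpret N: fixed_left_module k G C N by fact
  interpret M: fixed_left_module k G C M by fact
  let ?D = "descended_transformation G C \<phi>"
  note nat = fixed_arrD(1)[OF \<phi>]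
  show "?D \<in> extensional (Ob B)" by (simp add: descended_transformation_def B_simps)
  {
    fix \<alpha> assume "\<alpha> \<in> Ob B"
    then have \<alpha>: "\<alpha> \<in> Orbs" by (simp add: B_simps)
    show "?D \<alpha> \<in> module_hom k (space M.desc \<alpha>) (space N.desc \<alpha>)"
      using natural_transformationsD(2)[OF nat orbit_rep_Ob[OF \<alpha>]] \<alpha>
      by (simp add: descended_transformation_def N.descended_space M.descended_space)
    show "?D \<alpha> \<in> extensional (carrier (space M.desc \<alpha>))"
      using natural_transformationsD(3)[OF nat orbit_rep_Ob[OF \<alpha>]] \<alpha>
      by (simp add: descended_transformation_def M.descended_space)
  }
  fix \<alpha> \<beta> c m assume "\<alpha> \<in> Ob B" "\<beta> \<in> Ob B" "c \<in> carrier (Mor B \<beta> \<alpha>)" "m \<in> carrier (space M.desc \<alpha>)"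
  then obtain u where \<alpha>: "\<alpha> \<in> Orbs" and \<beta>: "\<beta> \<in> Orbs" and m: "m \<in> carrier (M.sp \<alpha>)"
    and u: "u \<in> carrier (orbit_sum C \<beta> \<alpha>)" and c: "c = cl \<beta> \<alpha> u"
    by (auto simp: B_simps quotient_Mor_carrier M.descended_space)
  let ?a = "orbit_rep \<alpha>" and ?b = "orbit_rep \<beta>"
  have \<phi>m: "\<phi> ?a m \<in> carrier (N.sp \<alpha>)"
    by (rule module_hom_closed[OF natural_transformationsD(2)[OF nat orbit_rep_Ob[OF \<alpha>]] m])
  have "\<phi> ?b (M.app \<beta> \<alpha> u m) = N.app \<beta> \<alpha> u (\<phi> ?a m)"
  proof (rule orbit_sum_hom_eqI[OF \<alpha> \<beta> _ N.apply_hom[OF \<alpha> \<beta> \<phi>m] _ u])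
    show "abelian_group_hom (orbit_sum C \<beta> \<alpha>) (N.sp \<beta>) (\<lambda>u. \<phi> ?b (M.app \<beta> \<alpha> u m))"
      by (rule abelian_group_hom_comp[OF M.apply_hom[OF \<alpha> \<beta> m] module_hom_abelian_group_hom[OF
              M.sp_module[OF \<beta>] N.sp_module[OF \<beta>] natural_transformationsD(2)[OF nat orbit_rep_Ob[OF \<beta>]]]])
    fix y x f assume yx: "y \<in> \<beta>" "x \<in> \<alpha>" and f: "f \<in> carrier (Mor C y x)"
    have mx: "m \<in> carrier (space M x)" using m M.space_rep[OF \<alpha> yx(2) \<alpha>] by simp
    show "\<phi> ?b (M.app \<beta> \<alpha> (sng \<beta> \<alpha> y x f) m) = N.app \<beta> \<alpha> (sng \<beta> \<alpha> y x f) (\<phi> ?a m)"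
      unfolding M.apply_single[OF \<alpha> \<beta> m yx(2,1) f] N.apply_single[OF \<alpha> \<beta> \<phi>m yx(2,1) f]
      unfolding fixed_arrD(2)[OF \<phi> \<alpha> orbit_rep_in[OF \<alpha>] yx(2)] fixed_arrD(2)[OF \<phi> \<beta> orbit_rep_in[OF \<beta>] yx(1)]
      by (rule natural_transformationsD(4)[OF nat orbits_subset[OF \<alpha> yx(2)] orbits_subset[OF \<beta> yx(1)] f mx])
  qed
  then show "?D \<beta> (act M.desc \<beta> \<alpha> c m) = act N.desc \<beta> \<alpha> c (?D \<alpha> m)"
    using \<alpha> \<beta> M.descended_act[OF \<alpha> \<beta> m u] N.descended_act[OF \<alpha> \<beta> \<phi>m u]
    by (simp add: descended_transformation_def c)
qed

lemma descended_functor: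
  "is_functor (fixed_module_category k G C) (module_category k B)
     \<lparr>on_ob = descended_module k G C, on_mor = (\<lambda>N M. descended_transformation G C)\<rparr>"
    (is "is_functor ?F ?B ?D")
proof
  fix Q assume "Q \<in> obj ?F"
  then interpret Q: fixed_left_module k G C Q by (rule fixed_objD)
  show "on_ob ?D Q \<in> obj ?B" using Q.descended_left_module by (simp add: module_category_def)
  show "on_mor ?D Q Q (idn ?F Q) = idn ?B (on_ob ?D Q)"
    by (auto simp: fixed_module_category_def module_category_def descended_transformation_def B_simps
        orbit_rep_Ob Q.descended_space intro!: restrict_ext)
  fix R S f g
  assume "R \<in> obj ?F" and f: "f \<in> arr ?F R Q"
  then have R: "fixed_left_module k G C R" by (intro fixed_objD)
  show "on_mor ?D R Q f \<in> arr ?B (on_ob ?D R) (on_ob ?D Q)"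
    using descended_transformation_natural[OF R Q.fixed_left_module_axioms f]
    by (simp add: module_category_def)
  show "on_mor ?D S Q (cmp ?F S R Q g f) =
      cmp ?B (on_ob ?D S) (on_ob ?D R) (on_ob ?D Q) (on_mor ?D S R g) (on_mor ?D R Q f)"
    by (auto simp: fixed_module_category_def module_category_def descended_transformation_def B_simps
        orbit_rep_Ob Q.descended_space intro!: restrict_ext)
qed

text \<open>A module over the quotient is determined by its restriction because every morphism of
  the quotient is a finite sum of images of morphisms under the covering. Concretely, u |-> [u] m is
  additive, and on a single summand it is the restricted action by definition.\<close>

lemma descended_pullback:
  assumes M: "left_module k B M"
  shows "descended_module k G C (pull M) = M"
proof (rule c_module.equality)
  interpret M: left_module k B M by fact
  interpret P: fixed_left_module k G C "pull M"
    by (intro fixed_left_module.intro fixed_left_module_axioms.intro free_G_category_over_axioms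
        pullback_left_module[OF M] twist_pullback)
  have sp: "space P.desc \<alpha> = space M \<alpha>" if "\<alpha> \<in> Orbs" for \<alpha>
    using that by (simp add: P.descended_space pullback_space orbit_rep_Ob orbit_rep_orbit)
  then show "space P.desc = space M"
    using left_module.space_extensional[OF P.descended_left_module] M.space_extensional
    by (intro extensionalityI[of _ "Ob B"]) (auto simp: B_simps)
  have "act P.desc \<beta> \<alpha> c m = act M \<beta> \<alpha> c m" for \<beta> \<alpha> c m
  proof (cases "\<alpha> \<in> Ob B \<and> \<beta> \<in> Ob B \<and> c \<in> carrier (Mor B \<beta> \<alpha>) \<and> m \<in> carrier (space M \<alpha>)")
    case True
    then obtain u where \<alpha>: "\<alpha> \<in> Orbs" and \<beta>: "\<beta> \<in> Orbs" and m: "m \<in> carrier (space M \<alpha>)"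
      and u: "u \<in> carrier (orbit_sum C \<beta> \<alpha>)" and c: "c = cl \<beta> \<alpha> u"
      by (auto simp: B_simps quotient_Mor_carrier)
    have \<alpha>': "\<alpha> \<in> Ob B" and \<beta>': "\<beta> \<in> Ob B" using \<alpha> \<beta> by (simp_all add: B_simps)
    have m': "m \<in> carrier (P.sp \<alpha>)" using m sp[OF \<alpha>] by (simp add: P.descended_space[OF \<alpha>])
    have "P.sp \<beta> = space M \<beta>" using sp[OF \<beta>] by (simp add: P.descended_space[OF \<beta>])
    moreover have "abelian_group_hom (qm \<beta> \<alpha>) (space M \<beta>) (\<lambda>c. act M \<beta> \<alpha> c m)"
      using M.act_linear_left[OF \<alpha>' \<beta>' m] abelian_group_hom.axioms(1,2)[OF orbit_class_abelian_group_hom[OF \<alpha> \<beta>]]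
        module_abelian_group[OF left_module_space[OF M \<beta>']]
      by (intro abelian_group_hom_intro) (auto simp: module_hom_def B_simps)
    ultimately have hom: "abelian_group_hom (orbit_sum C \<beta> \<alpha>) (P.sp \<beta>) (\<lambda>u. act M \<beta> \<alpha> (cl \<beta> \<alpha> u) m)"
      using abelian_group_hom_comp[OF orbit_class_abelian_group_hom[OF \<alpha> \<beta>]] by simp
    have "P.app \<beta> \<alpha> u m = act M \<beta> \<alpha> (cl \<beta> \<alpha> u) m"
    proof (rule orbit_sum_hom_eqI[OF \<alpha> \<beta> P.apply_hom[OF \<alpha> \<beta> m'] hom _ u])
      fix y x f assume yx: "y \<in> \<beta>" "x \<in> \<alpha>" and f: "f \<in> carrier (Mor C y x)"
      have "m \<in> carrier (space M (orb x))" using m orbit_eq[OF \<alpha> yx(2)] by simp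
      then show "P.app \<beta> \<alpha> (sng \<beta> \<alpha> y x f) m = act M \<beta> \<alpha> (cl \<beta> \<alpha> (sng \<beta> \<alpha> y x f)) m"
        using P.apply_single[OF \<alpha> \<beta> m' yx(2,1) f]
          pullback_act[OF orbits_subset[OF \<alpha> yx(2)] orbits_subset[OF \<beta> yx(1)] f]
        by (simp add: cov_eq orbit_eq[OF \<alpha> yx(2)] orbit_eq[OF \<beta> yx(1)])
    qed
    then show ?thesis using P.descended_act[OF \<alpha> \<beta> m' u] c by simp
  next
    case False
    then have "\<not> (\<alpha> \<in> Ob B \<and> \<beta> \<in> Ob B \<and> c \<in> carrier (Mor B \<beta> \<alpha>) \<and> m \<in> carrier (space P.desc \<alpha>))"
      using sp by (auto simp: B_simps)
    then show ?thesis
      using left_module.act_extensional[OF P.descended_left_module] M.act_extensional[OF False] by simp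
  qed
  then show "act P.desc = act M" by (intro ext)
qed simp

end

section \<open>Restriction and descent are mutually inverse functors\<close>

theorem theorem4p3:
  fixes k :: "('k, 'r) ring_scheme" and G :: "('g, 'h) monoid_scheme"
    and C :: "('o, 'a, 'k, 'g) g_category"
    and B :: "('o set, ('o \<times> 'o \<Rightarrow> 'a) set, 'k) k_category"
    and F :: "('o, 'a, 'o set, ('o \<times> 'o \<Rightarrow> 'a) set) functor_data"
  assumes "cring k" and "group G" and "free_G_category_over k G C"
    and "B = quotient_category k G C"
    and "F = galois_covering k G C"
  shows "isomorphic_categories
    (module_category k B ::
       (('o set, ('o \<times> 'o \<Rightarrow> 'a) set, 'k, 'm) c_module, 'o set \<Rightarrow> 'm \<Rightarrow> 'm) cat)
    (fixed_module_category k G C ::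
       (('o, 'a, 'k, 'm) c_module, 'o \<Rightarrow> 'm \<Rightarrow> 'm) cat)"
proof -
  interpret Q: free_G_category_over k G C by fact
  let ?P = "\<lparr>on_ob = pullback_module k G C, on_mor = (\<lambda>N M. pullback_transformation G C)\<rparr>"
    and ?D = "\<lparr>on_ob = descended_module k G C, on_mor = (\<lambda>N M. descended_transformation G C)\<rparr>"
  have "left_inverse_functor (module_category k Q.B) ?D ?P"
    unfolding left_inverse_functor_def
  proof (intro conjI ballI)
    fix Q assume "Q \<in> obj (module_category k Q.B)"
    then show "on_ob ?D (on_ob ?P Q) = Q" by (simp add: module_category_def Q.descended_pullback)
  next
    fix Q R f assume "f \<in> arr (module_category k Q.B) R Q"
    then have "f \<in> extensional (Ob Q.B)"
      by (intro natural_transformationsD(1)) (simp add: module_category_def)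
    \<comment> \<open>The round trip takes the component of \<open>f\<close> at the orbit of the
      representative of \<alpha>, which is \<alpha> itself.\<close>
    then show "on_mor ?D (on_ob ?P R) (on_ob ?P Q) (on_mor ?P R Q f) = f"
      by (intro extensionalityI[of _ "Ob Q.B"])
        (auto simp: descended_transformation_def pullback_transformation_def Q.B_simps Q.orbit_rep_Ob Q.orbit_rep_orbit)
  qed
  moreover have "left_inverse_functor (fixed_module_category k G C) ?P ?D"
    unfolding left_inverse_functor_def
  proof (intro conjI ballI)
    fix Q assume "Q \<in> obj (fixed_module_category k G C)"
    then show "on_ob ?P (on_ob ?D Q) = Q"
      using fixed_left_module.pullback_descended[OF Q.fixed_objD] by simp
  next
    fix Q R f assume f: "f \<in> arr (fixed_module_category k G C) R Q"
    \<comment> \<open>In this direction x is replaced by the representative of its orbit, and the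
      invariance of \<open>f\<close> under the group is indispensable.\<close>
    have "f (orbit_rep (Q.orb x)) = f x" if "x \<in> Ob C" for x
      using that by (intro Q.fixed_arrD(2)[OF f Q.orbit_in_orbits[OF that]] Q.orbit_rep_in
          Q.orbit_in_orbits Q.orbit_refl)
    then show "on_mor ?P (on_ob ?D R) (on_ob ?D Q) (on_mor ?D R Q f) = f"
      using natural_transformationsD(1)[OF Q.fixed_arrD(1)[OF f]]
      by (intro extensionalityI[of _ "Ob C"])
        (auto simp: descended_transformation_def pullback_transformation_def Q.orbit_in_orbits)
  qed
  ultimately show ?thesis
    unfolding isomorphic_categories_def assms(4)
    using module_category_is_cat Q.fixed_module_category_is_cat Q.pullback_functor Q.descended_functor by blast
qed

end
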